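(* Let $0<p<2$, $V(x)=-|x|^{-p}$ on $\mathbb{R}^2$, and suppose $a>a^*$. Then $$\lim_{b\to 0^+} b\,E(b)=-\frac{1}{4}\left(\frac{a}{a^*}-1\right)^2.$$
   Context: For $a>0$, $b>0$ and $u\in H^1(\mathbb{R}^2)$, the Kirchhoff energy functional is $$\mathcal{E}_b(u)= \int_{\mathbb{R}^2} |\nabla u|^2\,dx + b \left( \int_{\mathbb{R}^2} |\nabla u|^2\,dx \right)^2 + \int_{\mathbb{R}^2} V(x) |u(x)|^2\,dx - \frac{a}{2} \int_{\mathbb{R}^2} |u|^4\,dx ,$$ and $E(b)=\inf\{\mathcal{E}_b(u) \mid u\in H^1(\mathbb{R}^2),\ \|u\|_{L^2}=1\}$. The number $a^*>0$ is the optimal (largest) constant in the Gagliardo-Nirenberg inequality $$\int_{\mathbb{R}^2} |\nabla u|^2\,dx \ge \frac{a^*}{2} \int_{\mathbb{R}^2} |u|^4\,dx \quad \text{for all } u\in H^1(\mathbb{R}^2),\ \|u\|_{L^2}=1.$$ It is well known that $a^*=\int_{\mathbb{R}^2}|Q|^2=\int_{\mathbb{R}^2}|\nabla Q|^2=\frac12\int_{\mathbb{R}^2}|Q|^4$, where $Q\in H^1(\mathbb{R}^2)$ is the unique positive, radially symmetric decreasing solution of $-\Delta Q+Q-Q^3=0$ on $\mathbb{R}^2$. *)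

theory Defs
  imports "HOL-Analysis.Analysis"
begin

definition partial_deriv :: "2 \<Rightarrow> (real^2 \<Rightarrow> real) \<Rightarrow> real^2 \<Rightarrow> real" where
  "partial_deriv i \<phi> x = frechet_derivative \<phi> (at x) (axis i 1)"

primrec C_k :: "nat \<Rightarrow> (real^2 \<Rightarrow> real) \<Rightarrow> bool" where
  "C_k 0 \<phi> \<longleftrightarrow> continuous_on UNIV \<phi>"
| "C_k (Suc k) \<phi> \<longleftrightarrow> (\<forall>x. \<phi> differentiable (at x)) \<and> (\<forall>i. C_k k (partial_deriv i \<phi>))"

definition test_function :: "(real^2 \<Rightarrow> real) \<Rightarrow> bool" where
  "test_function \<phi> \<longleftrightarrow> (\<forall>k. C_k k \<phi>) \<and> compact (closure {x. \<phi> x \<noteq> 0})"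

text \<open>
  Functions are Borel representatives of the usual almost-everywhere classes; every class of
  Lebesgue measurable functions has one. The norm on \<^typ>\<open>complex^2\<close> is the Hermitian norm, so
  the square of the norm of a gradient is the sum of the squared moduli of its two components.
\<close>

definition L2 :: "(real^2 \<Rightarrow> 'v::euclidean_space) set" where
  "L2 = {u. u \<in> borel_measurable lborel \<and> integrable lborel (\<lambda>x. (norm (u x))\<^sup>2)}"

definition L2_norm :: "(real^2 \<Rightarrow> 'v::euclidean_space) \<Rightarrow> real" where
  "L2_norm u = sqrt (\<integral>x. (norm (u x))\<^sup>2 \<partial>lborel)"

definition is_weak_gradient :: "(real^2 \<Rightarrow> complex) \<Rightarrow> (real^2 \<Rightarrow> complex^2) \<Rightarrow> bool" where
  "is_weak_gradient u g \<longleftrightarrow>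
     (\<forall>\<phi> i. test_function \<phi> \<longrightarrow>
        (\<integral>x. partial_deriv i \<phi> x *\<^sub>R u x \<partial>lborel) = - (\<integral>x. \<phi> x *\<^sub>R (g x $ i) \<partial>lborel))"

definition H1 :: "(real^2 \<Rightarrow> complex) set" where
  "H1 = {u \<in> L2. \<exists>g \<in> L2. is_weak_gradient u g}"

text \<open>For \<open>u \<in> H1\<close> the chosen gradient is unique up to a null set.\<close>

definition weak_gradient :: "(real^2 \<Rightarrow> complex) \<Rightarrow> real^2 \<Rightarrow> complex^2" where
  "weak_gradient u = (SOME g. g \<in> L2 \<and> is_weak_gradient u g)"

definition dirichlet_integral :: "(real^2 \<Rightarrow> complex) \<Rightarrow> real" where
  "dirichlet_integral u = (\<integral>x. (norm (weak_gradient u x))\<^sup>2 \<partial>lborel)"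

text \<open>
  For \<open>u \<in> H1\<close> the quartic integral is finite by Sobolev embedding. The potential term is
  meaningful only when \<open>V |u|\<^sup>2\<close> is integrable, as it is for every \<open>u \<in> H1\<close> when
  \<open>V x = - |x| powr (- p)\<close> with \<open>0 < p < 2\<close> (the value at the origin is irrelevant).
\<close>

definition kirchhoff_energy ::
    "(real^2 \<Rightarrow> real) \<Rightarrow> real \<Rightarrow> real \<Rightarrow> (real^2 \<Rightarrow> complex) \<Rightarrow> real" where
  "kirchhoff_energy V a b u =
     dirichlet_integral u + b * (dirichlet_integral u)\<^sup>2
     + (\<integral>x. V x * (norm (u x))\<^sup>2 \<partial>lborel)
     - a / 2 * (\<integral>x. (norm (u x)) ^ 4 \<partial>lborel)"

text \<open>
  The infimum is taken in the reals, hence meaningful only when the energy is bounded below;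
  this holds for the above \<open>V\<close> and all \<open>b > 0\<close>.
\<close>

definition ground_state_energy :: "(real^2 \<Rightarrow> real) \<Rightarrow> real \<Rightarrow> real \<Rightarrow> real" where
  "ground_state_energy V a b = Inf {kirchhoff_energy V a b u | u. u \<in> H1 \<and> L2_norm u = 1}"

definition gagliardo_nirenberg_const :: real where
  "gagliardo_nirenberg_const =
     (GREATEST c. \<forall>u \<in> H1. L2_norm u = 1 \<longrightarrow>
        dirichlet_integral u \<ge> c / 2 * (\<integral>x. (norm (u x)) ^ 4 \<partial>lborel))"

end

theory Submission imports Defs "HOL-Real_Asymp.Real_Asymp" begin

text \<open>
  Write \<open>D\<close> for the Dirichlet integral of \<open>u\<close>, \<open>Q\<close> for the integral of \<open>|u|\<^sup>4\<close>, \<open>P\<close> for the integral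
  of \<open>|x|\<^sup>-\<^sup>p |u|\<^sup>2\<close>, \<open>a\<^sup>*\<close> for the Gagliardo-Nirenberg constant and \<open>k = a / a\<^sup>* - 1 > 0\<close>. On the unit
  sphere of \<open>H1\<close> the energy is \<open>D + b D\<^sup>2 - P - a Q / 2\<close>. For small \<open>b\<close> a nearly minimal energy
  forces \<open>D\<close> to be of order \<open>1 / b\<close>, and the energy behaves like \<open>b D\<^sup>2 - k D\<close>, whose minimum is
  \<open>- k\<^sup>2 / (4 b)\<close>; the potential term is of lower order and disappears after multiplication by \<open>b\<close>.

  Upper bound: choose \<open>u\<close> for which \<open>2 D / Q\<close> is nearly \<open>a\<^sup>*\<close> and dilate it to \<open>t u(t x)\<close>. This keeps
  the norm and multiplies both \<open>D\<close> and \<open>Q\<close> by \<open>t\<^sup>2\<close>, so \<open>D\<close> can be given the optimal value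
  \<open>k / (2 b)\<close>, while \<open>- P \<le> 0\<close> is dropped (\<open>energy_upper_bound\<close>).

  Lower bound: \<open>Q \<le> 2 D / a\<^sup>*\<close> by definition, and \<open>P \<le> \<epsilon> D + C\<close> for every \<open>\<epsilon> > 0\<close> (\<open>hardy\<close>). Hence
  the energy is at least \<open>b D\<^sup>2 - (k + \<epsilon>) D - C\<close>, and completing the square gives
  \<open>- (k + \<epsilon>)\<^sup>2 / (4 b) - C\<close> (\<open>energy_lower_bound\<close>).

  For this the constant \<open>a\<^sup>*\<close> must be the infimum of \<open>2 D / Q\<close> and must be positive, which is the
  Gagliardo-Nirenberg inequality with some constant (\<open>gagliardo_nirenberg\<close>). Both this
  inequality and the one of Hardy type are derived for weak gradients without mollification. Testing
  the definition of the weak gradient with moving averages of tensor products shows that increments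
  of \<open>u\<close> in a coordinate direction are integrals of the weak derivative over the segment
  (\<open>increment_eq_segment_integral\<close>). From this formula Ladyzhenskaya's argument bounds \<open>|u|\<^sup>2\<close>
  by a function of one coordinate in two ways, and the Hardy-type inequality results from integrating
  by parts with difference quotients in place of derivatives.
\<close>

section \<open>Smooth functions of one variable and tensor products\<close>

text \<open>Differentiability of finite order, by recursion on the order, makes the closure properties below
  plain inductions; smoothness is differentiability of every order.\<close>

primrec times_differentiable :: "nat \<Rightarrow> (real \<Rightarrow> real) \<Rightarrow> bool" where
  "times_differentiable 0 f \<longleftrightarrow> True"
| "times_differentiable (Suc k) f \<longleftrightarrow>
     (\<exists>f'. (\<forall>x. (f has_real_derivative f' x) (at x)) \<and> times_differentiable k f')"

lemma times_differentiable_mono: "times_differentiable (Suc k) f \<Longrightarrow> times_differentiable k f"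
proof (induction k arbitrary: f)
  case (Suc k)
  then show ?case
    by (metis times_differentiable.simps(2))
qed auto

lemma times_differentiable_add:
  "times_differentiable k f \<Longrightarrow> times_differentiable k g \<Longrightarrow> times_differentiable k (\<lambda>x. f x + g x)"
proof (induction k arbitrary: f g)
  case (Suc k)
  then obtain f' g' where *: "\<And>x. (f has_real_derivative f' x) (at x)" "times_differentiable k f'"
    "\<And>x. (g has_real_derivative g' x) (at x)" "times_differentiable k g'" by auto
  show ?case unfolding times_differentiable.simps
    using * by (intro exI[of _ "\<lambda>x. f' x + g' x"]) (auto intro!: derivative_eq_intros Suc.IH)
qed auto

lemma times_differentiable_mult:
  "times_differentiable k f \<Longrightarrow> times_differentiable k g \<Longrightarrow> times_differentiable k (\<lambda>x. f x * g x)"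
proof (induction k arbitrary: f g)
  case (Suc k)
  then obtain f' g' where *: "\<And>x. (f has_real_derivative f' x) (at x)" "times_differentiable k f'"
    "\<And>x. (g has_real_derivative g' x) (at x)" "times_differentiable k g'" by auto
  have "times_differentiable k f" "times_differentiable k g"
    using Suc.prems by (auto dest!: times_differentiable_mono simp del: times_differentiable.simps)
  with * show ?case unfolding times_differentiable.simps
    by (intro exI[of _ "\<lambda>x. f' x * g x + f x * g' x"])
       (auto intro!: derivative_eq_intros times_differentiable_add Suc.IH)
qed auto

lemma times_differentiable_const: "times_differentiable k (\<lambda>_. c)"
proof (induction k arbitrary: c)
  case (Suc k)
  show ?case unfolding times_differentiable.simps
    by (intro exI[of _ "\<lambda>_. 0"]) (auto intro!: derivative_eq_intros Suc.IH)
qed auto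

lemma times_differentiable_affine:
  "times_differentiable k f \<Longrightarrow> times_differentiable k (\<lambda>x. f (c * x + d))"
proof (induction k arbitrary: f)
  case (Suc k)
  then obtain f' where *: "\<And>x. (f has_real_derivative f' x) (at x)" "times_differentiable k f'"
    by auto
  show ?case unfolding times_differentiable.simps
  proof (intro exI[of _ "\<lambda>x. f' (c * x + d) * c"] conjI allI)
    show "((\<lambda>x. f (c * x + d)) has_real_derivative f' (c * x + d) * c) (at x)" for x
      by (rule DERIV_chain2[of f, OF *(1)]) (auto intro!: derivative_eq_intros)
  qed (intro times_differentiable_mult times_differentiable_const Suc.IH *)
qed auto

text \<open>The functions \<open>exp (- 1 / x) / x\<^sup>m\<close>, extended by zero to the left half-line. The family in \<open>m\<close> is
  considered because the derivative of a member is a linear combination of two later members.\<close>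

definition flat_exp :: "nat \<Rightarrow> real \<Rightarrow> real" where
  "flat_exp m x = (if x > 0 then exp (- inverse x) * inverse x ^ m else 0)"

lemma flat_exp_deriv:
  "(flat_exp m has_real_derivative flat_exp (m + 2) x - real m * flat_exp (m + 1) x) (at x)"
proof (cases "x = 0")
  case False
  show ?thesis
  proof (cases "x > 0")
    case True
    have "((\<lambda>x. exp (- inverse x) * inverse x ^ m) has_real_derivative
            flat_exp (m + 2) x - real m * flat_exp (m + 1) x) (at x)"
      using True
      by (cases m) (auto intro!: derivative_eq_intros
          simp: flat_exp_def algebra_simps power2_eq_square, metis One_nat_def power_eq_if)
    then show ?thesis
      by (rule has_field_derivative_transform_within_open[of _ _ _ "{0<..}"])
         (use True in \<open>auto simp: flat_exp_def\<close>)
  next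
    case F: False
    have "((\<lambda>x. 0) has_real_derivative 0) (at x)" by simp
    then have "(flat_exp m has_real_derivative 0) (at x)"
      by (rule has_field_derivative_transform_within_open[of _ _ _ "{..<0}"])
         (use False F in \<open>auto simp: flat_exp_def\<close>)
    then show ?thesis using False F by (simp add: flat_exp_def)
  qed
next
  case True
  have "((\<lambda>h. flat_exp m h / h) \<longlongrightarrow> 0) (at 0)"
  proof (rule filterlim_split_at)
    have "((\<lambda>h. 0::real) \<longlongrightarrow> 0) (at_left 0)" by simp
    moreover have "eventually (\<lambda>h. 0 = flat_exp m h / h) (at_left (0::real))"
      unfolding flat_exp_def by (simp add: eventually_at_filter)
    ultimately show "((\<lambda>h. flat_exp m h / h) \<longlongrightarrow> 0) (at_left 0)"
      by (rule Lim_transform_eventually)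
    have "((\<lambda>h::real. exp (- inverse h) * inverse h ^ m / h) \<longlongrightarrow> 0) (at_right 0)"
      by real_asymp
    moreover have "eventually (\<lambda>h. exp (- inverse h) * inverse h ^ m / h = flat_exp m h / h)
        (at_right (0::real))"
      unfolding flat_exp_def by (rule eventually_mono[OF eventually_at_right_less]) auto
    ultimately show "((\<lambda>h. flat_exp m h / h) \<longlongrightarrow> 0) (at_right 0)"
      by (rule Lim_transform_eventually)
  qed
  then show ?thesis
    using True by (simp add: has_field_derivative_iff flat_exp_def)
qed

lemma times_differentiable_flat_exp: "times_differentiable k (flat_exp m)"
proof (induction k arbitrary: m)
  case (Suc k)
  have "times_differentiable k (\<lambda>x. flat_exp (m + 2) x + (- real m) * flat_exp (m + 1) x)"
    by (intro times_differentiable_add times_differentiable_mult times_differentiable_const Suc)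
  then show ?case
    unfolding times_differentiable.simps using flat_exp_deriv[of m]
    by (intro exI[of _ "\<lambda>x. flat_exp (m + 2) x + (- real m) * flat_exp (m + 1) x"]) simp
qed auto

definition bump_function :: "(real \<Rightarrow> real) \<Rightarrow> bool" where
  "bump_function f \<longleftrightarrow> (\<forall>k. times_differentiable k f) \<and> (\<exists>R. \<forall>x. \<bar>x\<bar> > R \<longrightarrow> f x = 0)"

lemma bump_function_continuous: "bump_function f \<Longrightarrow> continuous_on S f"
proof -
  assume "bump_function f"
  then have "times_differentiable (Suc 0) f" unfolding bump_function_def by blast
  then obtain f' where "\<And>x. (f has_real_derivative f' x) (at x)" by auto
  then show ?thesis by (intro continuous_at_imp_continuous_on ballI DERIV_isCont)
qed

text \<open>The flat exponential \<open>e = flat_exp 0\<close> satisfies \<open>e (n x) = e(x)\<^sup>1\<^sup>/\<^sup>n\<close>, which tends to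
  the indicator of the positive axis. Rescaling the two factors by the same large number therefore
  produces smooth functions that approximate the indicator of an interval from below.\<close>

definition interval_bump :: "real \<Rightarrow> real \<Rightarrow> nat \<Rightarrow> real \<Rightarrow> real" where
  "interval_bump a b n x = flat_exp 0 (real (Suc n) * (x - a)) * flat_exp 0 (real (Suc n) * (b - x))"

lemma interval_bump_outside: "x \<notin> {a<..<b} \<Longrightarrow> interval_bump a b n x = 0"
  by (auto simp: interval_bump_def flat_exp_def zero_less_mult_iff)

lemma interval_bump_bounds: "0 \<le> interval_bump a b n x" "interval_bump a b n x \<le> 1"
  by (auto simp: interval_bump_def flat_exp_def zero_less_mult_iff intro!: mult_le_one)

lemma interval_bump_inside:
  assumes "x \<in> {a<..<b}"
  shows "interval_bump a b n x =
    exp (- inverse (real (Suc n) * (x - a))) * exp (- inverse (real (Suc n) * (b - x)))"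
  using assms by (auto simp: interval_bump_def flat_exp_def zero_less_mult_iff)

lemma bump_function_interval_bump: "bump_function (interval_bump a b n)"
proof -
  have "\<forall>x. \<bar>x\<bar> > \<bar>a\<bar> + \<bar>b\<bar> \<longrightarrow> interval_bump a b n x = 0"
    by (auto intro!: interval_bump_outside)
  moreover have "interval_bump a b n = (\<lambda>x. flat_exp 0 (real (Suc n) * x + (- real (Suc n) * a)) *
      flat_exp 0 (- real (Suc n) * x + real (Suc n) * b))"
    by (simp add: fun_eq_iff interval_bump_def algebra_simps)
  then have "times_differentiable k (interval_bump a b n)" for k
    by (simp only:) (intro times_differentiable_mult times_differentiable_affine
        times_differentiable_flat_exp)
  ultimately show ?thesis unfolding bump_function_def by blast
qed

lemma interval_bump_tendsto:
  "(\<lambda>n. interval_bump a b n x) \<longlonglongrightarrow> indicator {a<..<b} x"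
proof (cases "x \<in> {a<..<b}")
  case True
  have "(\<lambda>n. exp (- inverse (real (Suc n) * (x - a))) * exp (- inverse (real (Suc n) * (b - x))))
      \<longlonglongrightarrow> 1"
    using True by real_asymp
  then show ?thesis using True by (simp add: interval_bump_inside)
qed (auto simp: interval_bump_outside)

text \<open>Tensor products of one-dimensional bumps suffice as test functions: a partial derivative
  differentiates one factor and again yields a tensor product, and they approximate indicators of
  boxes.\<close>

definition tensor :: "(2 \<Rightarrow> real \<Rightarrow> real) \<Rightarrow> real^2 \<Rightarrow> real" where
  "tensor f x = (\<Prod>j\<in>UNIV. f j (x $ j))"

lemma tensor_has_derivative:
  assumes "\<And>j. (f j has_real_derivative f' j (x $ j)) (at (x $ j))"
  shows "(tensor f has_derivative
    (\<lambda>y. \<Sum>i\<in>UNIV. f' i (x $ i) * y $ i * (\<Prod>j\<in>UNIV - {i}. f j (x $ j)))) (at x)"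
proof -
  have "((\<lambda>x. f j (x $ j)) has_derivative (\<lambda>y. f' j (x $ j) * y $ j)) (at x)" for j
    by (rule has_derivative_compose[of "\<lambda>x. x $ j", OF _ assms[unfolded has_field_derivative_def]])
       (rule bounded_linear_imp_has_derivative[OF bounded_linear_vec_nth])
  then show ?thesis unfolding tensor_def by (intro has_derivative_prod) auto
qed

lemma partial_deriv_tensor:
  assumes "\<And>j x. (f j has_real_derivative f' j x) (at x)"
  shows "partial_deriv i (tensor f) = tensor (f(i := f' i))"
proof
  fix x
  have "partial_deriv i (tensor f) x =
      (\<Sum>k\<in>UNIV. f' k (x $ k) * axis i 1 $ k * (\<Prod>j\<in>UNIV - {k}. f j (x $ j)))"
    unfolding partial_deriv_def
    by (subst frechet_derivative_at[OF tensor_has_derivative[of f f' x], symmetric])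
       (use assms in auto)
  also have "\<dots> = (\<Sum>k\<in>{i}. f' k (x $ k) * axis i 1 $ k * (\<Prod>j\<in>UNIV - {k}. f j (x $ j)))"
    by (rule sum.mono_neutral_right) (auto simp: axis_def)
  also have "\<dots> = tensor (f(i := f' i)) x"
    by (simp add: tensor_def axis_def prod.remove[of UNIV i])
  finally show "partial_deriv i (tensor f) x = tensor (f(i := f' i)) x" .
qed

lemma C_k_tensor:
  "(\<And>j. times_differentiable (Suc k) (f j)) \<Longrightarrow> C_k k (tensor f)"
proof (induction k arbitrary: f)
  case 0
  then have "\<forall>j. \<exists>f'. \<forall>x. (f j has_real_derivative f' x) (at x)" by auto
  then obtain f' where "\<And>j x. (f j has_real_derivative f' j x) (at x)" by metis
  then have "isCont (tensor f) x" for x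
    by (rule has_derivative_continuous[OF tensor_has_derivative])
  then show ?case by (simp add: continuous_at_imp_continuous_on)
next
  case (Suc k)
  then have "\<forall>j. \<exists>f'. (\<forall>x. (f j has_real_derivative f' x) (at x)) \<and> times_differentiable (Suc k) f'"
    by (metis times_differentiable.simps(2))
  then obtain f' where f': "\<And>j x. (f j has_real_derivative f' j x) (at x)"
      "\<And>j. times_differentiable (Suc k) (f' j)" by metis
  have "C_k k (tensor (f(i := f' i)))" for i
    by (rule Suc.IH)
      (use f'(2) Suc.prems[THEN times_differentiable_mono] in \<open>simp del: times_differentiable.simps\<close>)
  moreover have "tensor f differentiable (at x)" for x
    unfolding differentiable_def by (rule exI, rule tensor_has_derivative, rule f'(1))
  ultimately show ?case using partial_deriv_tensor[of f f', OF f'(1)] by simp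
qed

lemma compact_support_tensor:
  assumes "\<And>j. bump_function (f j)"
  shows "\<exists>R. \<forall>x. tensor f x \<noteq> 0 \<longrightarrow> x \<in> cbox (\<chi> j. - R) (\<chi> j. R)"
proof -
  obtain R where R: "\<And>j x. \<bar>x\<bar> > R j \<Longrightarrow> f j x = 0"
    using assms unfolding bump_function_def by metis
  define M where "M = Max (range R)"
  have "x \<in> cbox (\<chi> j. - M) (\<chi> j. M)" if "tensor f x \<noteq> 0" for x
  proof -
    have *: "\<bar>x $ j\<bar> \<le> M" for j
    proof -
      have "f j (x $ j) \<noteq> 0" using that by (auto simp: tensor_def)
      then have "\<bar>x $ j\<bar> \<le> R j" using R[of j "x $ j"] by fastforce
      also have "\<dots> \<le> M" unfolding M_def by simp
      finally show ?thesis .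
    qed
    show ?thesis using * by (simp add: mem_box_cart abs_le_iff minus_le_iff[of M])
  qed
  then show ?thesis by blast
qed

lemma test_function_tensor:
  assumes "\<And>j. bump_function (f j)"
  shows "test_function (tensor f)"
proof -
  obtain R where "\<And>x. tensor f x \<noteq> 0 \<Longrightarrow> x \<in> cbox (\<chi> j. - R) (\<chi> j. R)"
    using compact_support_tensor[of f] assms by blast
  then have "{x. tensor f x \<noteq> 0} \<subseteq> cbox (\<chi> j. - R) (\<chi> j. R)" by auto
  then have "bounded {x. tensor f x \<noteq> 0}" by (rule bounded_subset[OF bounded_cbox])
  then show ?thesis
    using assms C_k_tensor[of _ f] by (auto simp: test_function_def bump_function_def)
qed

section \<open>Locally integrable functions and the fundamental lemma\<close>

lemma nn_integral_translate:
  fixes t :: "'a::euclidean_space"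
  assumes "f \<in> borel_measurable borel"
  shows "(\<integral>\<^sup>+x. f (x + t) \<partial>lborel) = (\<integral>\<^sup>+x. f x \<partial>lborel)"
proof -
  have "(\<integral>\<^sup>+x. f x \<partial>lborel) = (\<integral>\<^sup>+x. f x \<partial>distr lborel borel ((+) t))"
    by (simp add: lborel_distr_plus)
  also have "\<dots> = (\<integral>\<^sup>+x. f (x + t) \<partial>lborel)"
    using assms by (subst nn_integral_distr) (auto simp: add.commute)
  finally show ?thesis by simp
qed

lemma integral_translate:
  fixes t :: "'a::euclidean_space" and f :: "'a \<Rightarrow> 'b::{banach,second_countable_topology}"
  assumes "f \<in> borel_measurable borel"
  shows "(\<integral>x. f (x + t) \<partial>lborel) = (\<integral>x. f x \<partial>lborel)"
proof -
  have "(\<integral>x. f x \<partial>lborel) = (\<integral>x. f x \<partial>distr lborel borel ((+) t))"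
    by (simp add: lborel_distr_plus)
  also have "\<dots> = (\<integral>x. f (x + t) \<partial>lborel)"
    using assms by (subst integral_distr) (auto simp: add.commute)
  finally show ?thesis by simp
qed

lemma integrable_translate:
  fixes t :: "'a::euclidean_space" and f :: "'a \<Rightarrow> 'b::{banach,second_countable_topology}"
  assumes "integrable lborel f"
  shows "integrable lborel (\<lambda>x. f (x + t))"
proof -
  have "integrable (distr lborel borel ((+) t)) f" using assms by (simp add: lborel_distr_plus)
  then show ?thesis
    by (subst (asm) integrable_distr_eq) (use assms in \<open>auto simp: add.commute\<close>)
qed

lemma integral_dilate:
  fixes f :: "real^2 \<Rightarrow> 'b::{banach,second_countable_topology}"
  assumes "f \<in> borel_measurable borel" and "c > 0"
  shows "(\<integral>x. f (c *\<^sub>R x) \<partial>lborel) = (1 / c\<^sup>2) *\<^sub>R (\<integral>x. f x \<partial>lborel)"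
proof -
  have "(\<integral>x. f x \<partial>lborel) = (\<integral>x. f x \<partial>density (distr lborel borel (\<lambda>x::real^2. 0 + c *\<^sub>R x)) (\<lambda>_. ennreal (\<bar>c\<bar> ^ DIM(real^2))))"
    using lborel_affine[of c "0::real^2"] assms(2) by (simp add: ennreal_power)
  also have "\<dots> = (\<integral>x. c\<^sup>2 *\<^sub>R f (c *\<^sub>R x) \<partial>lborel)"
    using assms by (subst integral_density) (auto simp: integral_distr)
  finally show ?thesis using assms(2) by simp
qed

lemma integrable_dilate:
  fixes f :: "real^2 \<Rightarrow> 'b::{banach,second_countable_topology}"
  assumes "integrable lborel f" and "c > 0"
  shows "integrable lborel (\<lambda>x. f (c *\<^sub>R x))"
proof -
  have "integrable (density (distr lborel borel (\<lambda>x::real^2. 0 + c *\<^sub>R x)) (\<lambda>_. ennreal (\<bar>c\<bar> ^ DIM(real^2)))) f"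
    using lborel_affine[of c "0::real^2"] assms by (simp add: ennreal_power)
  then have "integrable lborel (\<lambda>x. c\<^sup>2 *\<^sub>R f (c *\<^sub>R x))"
    using assms by (subst (asm) integrable_density) (auto simp: integrable_distr_eq)
  then have "integrable lborel (\<lambda>x. (1 / c\<^sup>2) *\<^sub>R (c\<^sup>2 *\<^sub>R f (c *\<^sub>R x)))"
    by (rule integrable_scaleR_right)
  then show ?thesis using assms(2) by simp
qed

lemma integrable_bounded_mult:
  fixes w U :: "'a \<Rightarrow> real"
  assumes U: "integrable M U" and [measurable]: "w \<in> borel_measurable M"
    and w: "\<And>x. \<bar>w x\<bar> \<le> B"
  shows "integrable M (\<lambda>x. w x * U x)"
proof (rule Bochner_Integration.integrable_bound)
  have [measurable]: "U \<in> borel_measurable M" using U by simp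
  show "integrable M (\<lambda>x. B * U x)" using U by simp
  show "(\<lambda>x. w x * U x) \<in> borel_measurable M" by measurable
  show "AE x in M. norm (w x * U x) \<le> norm (B * U x)"
    by (intro AE_I2) (auto simp: abs_mult intro!: mult_right_mono order_trans[OF w])
qed

lemma integrable_bounded_support:
  fixes f :: "'a::euclidean_space \<Rightarrow> real"
  assumes [measurable]: "f \<in> borel_measurable borel"
    and B: "\<And>x. \<bar>f x\<bar> \<le> B" and R: "\<And>x. norm x > R \<Longrightarrow> f x = 0"
  shows "integrable lborel f"
proof -
  have "integrable lborel (\<lambda>x. f x * indicator (cball 0 R) x)"
    by (intro integrable_bounded_mult[OF _ _ B] integrable_real_indicator)
       (auto simp: emeasure_lborel_cball_finite[unfolded infinity_ennreal_def])
  moreover have "f x * indicator (cball 0 R) x = f x" for x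
    using R[of x] by (cases "norm x > R") (auto simp: indicator_def)
  ultimately show ?thesis by simp
qed

text \<open>Boxes form an intersection-stable generator of the Borel sets, and the sets over which the integral
  of \<open>w\<close> vanishes form a Dynkin system.\<close>

lemma AE_zero_if_box_integrals_zero:
  fixes w :: "'a::euclidean_space \<Rightarrow> real"
  assumes w: "integrable lborel w"
    and box: "\<And>a b. (\<integral>x. indicator (box a b) x * w x \<partial>lborel) = 0"
  shows "AE x in lborel. w x = 0"
proof -
  have [measurable]: "w \<in> borel_measurable borel" using w by auto
  have int: "integrable lborel (\<lambda>x. indicator A x * w x)" if "A \<in> sets borel" for A
    using integrable_mult_indicator[of A lborel w] that w by simp
  \<comment> \<open>Closure under complements needs the integral over the whole space, a limit over growing boxes.\<close>
  have total: "(\<integral>x. w x \<partial>lborel) = 0"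
  proof -
    have "(\<lambda>n. \<integral>x. indicator (box (- (real n *\<^sub>R One)) (real n *\<^sub>R One)) x * w x \<partial>lborel)
        \<longlonglongrightarrow> (\<integral>x. w x \<partial>lborel)"
    proof (rule integral_dominated_convergence[where w="\<lambda>x. norm (w x)"])
      show "AE x in lborel. (\<lambda>n. indicator (box (- (real n *\<^sub>R One)) (real n *\<^sub>R One)) x * w x) \<longlonglongrightarrow> w x"
      proof (rule AE_I2)
        fix x :: 'a
        have "eventually (\<lambda>n. indicator (box (- (real n *\<^sub>R One)) (real n *\<^sub>R One)) x * w x = w x) sequentially"
        proof -
          obtain N where N: "norm x < real N" using reals_Archimedean2 by blast
          have "x \<in> box (- (real n *\<^sub>R One)) (real n *\<^sub>R One)" if "n \<ge> N" for n
          proof -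
            have "\<bar>x \<bullet> i\<bar> < real n" if "i \<in> Basis" for i
              using Basis_le_norm[OF that, of x] N \<open>n \<ge> N\<close> by linarith
            then show ?thesis by (force simp: mem_box abs_less_iff)
          qed
          then show ?thesis unfolding eventually_sequentially by (intro exI[of _ N]) auto
        qed
        then show "(\<lambda>n. indicator (box (- (real n *\<^sub>R One)) (real n *\<^sub>R One)) x * w x) \<longlonglongrightarrow> w x"
          by (rule tendsto_eventually)
      qed
    qed (use w in \<open>auto simp: indicator_def\<close>)
    then show ?thesis unfolding box by (simp add: LIMSEQ_const_iff)
  qed
  have "(\<integral>x. indicator A x * w x \<partial>lborel) = 0" if "A \<in> sets borel" for A
  proof -
    let ?G = "range (\<lambda>(a, b). box a b :: 'a set)"
    have "Int_stable ?G" by (auto simp: Int_stable_def box_Int_box)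
    moreover have "?G \<subseteq> Pow UNIV" by simp
    moreover have "A \<in> sigma_sets UNIV ?G" using that by (simp add: borel_eq_box)
    ultimately show ?thesis
    proof (rule sigma_sets_induct_disjoint)
      show "(\<integral>x. indicator A x * w x \<partial>lborel) = 0" if "A \<in> ?G" for A using that box by auto
      show "(\<integral>x. indicator {} x * w x \<partial>lborel) = 0" by simp
    next
      fix A assume A: "A \<in> sigma_sets UNIV ?G" "(\<integral>x. indicator A x * w x \<partial>lborel) = 0"
      then have [measurable]: "A \<in> sets borel" by (simp add: borel_eq_box)
      have "(\<integral>x. indicator (UNIV - A) x * w x \<partial>lborel) = (\<integral>x. w x - indicator A x * w x \<partial>lborel)"
        by (intro Bochner_Integration.integral_cong) (auto simp: indicator_def)
      also have "\<dots> = 0" using A total w int by (subst Bochner_Integration.integral_diff) auto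
      finally show "(\<integral>x. indicator (UNIV - A) x * w x \<partial>lborel) = 0" .
    next
      fix A :: "nat \<Rightarrow> 'a set"
      assume A: "disjoint_family A" "range A \<subseteq> sigma_sets UNIV ?G"
        "\<And>i. (\<integral>x. indicator (A i) x * w x \<partial>lborel) = 0"
      have B: "A i \<in> sets lborel" for i using A(2) by (auto simp: borel_eq_box)
      have "set_integrable lborel (\<Union>i. A i) w"
        unfolding set_integrable_def using B w by (intro integrable_mult_indicator) auto
      then have "(LINT x:(\<Union>i. A i)|lborel. w x) = (\<Sum>i. LINT x:A i|lborel. w x)"
        using A(1) B by (intro lebesgue_integral_countable_add) (auto simp: disjoint_family_on_def)
      then show "(\<integral>x. indicator (\<Union>i. A i) x * w x \<partial>lborel) = 0"
        using A(3) by (simp add: set_lebesgue_integral_def)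
    qed
  qed
  then show ?thesis
    by (intro density_unique_real) (use w in \<open>auto simp: set_lebesgue_integral_def\<close>)
qed

definition locally_integrable :: "('a::euclidean_space \<Rightarrow> 'v::{banach,second_countable_topology}) \<Rightarrow> bool" where
  "locally_integrable w \<longleftrightarrow>
     w \<in> borel_measurable borel \<and> (\<forall>a b. integrable lborel (\<lambda>x. indicator (cbox a b) x *\<^sub>R w x))"

lemma locally_integrable_scaleR:
  fixes w :: "'a::euclidean_space \<Rightarrow> 'v::{banach,second_countable_topology}"
  assumes w: "locally_integrable w" and f[measurable]: "f \<in> borel_measurable borel"
    and bound: "\<And>x. \<bar>f x\<bar> \<le> B" and supp: "\<And>x. f x \<noteq> 0 \<Longrightarrow> x \<in> cbox a b"
  shows "integrable lborel (\<lambda>x. f x *\<^sub>R w x)"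
proof (rule Bochner_Integration.integrable_bound)
  show "integrable lborel (\<lambda>x. B *\<^sub>R (indicator (cbox a b) x *\<^sub>R w x))"
    by (rule integrable_scaleR_right) (use w in \<open>simp add: locally_integrable_def\<close>)
  show "(\<lambda>x. f x *\<^sub>R w x) \<in> borel_measurable lborel" using w by (auto simp: locally_integrable_def)
  have "norm (f x *\<^sub>R w x) \<le> norm (B *\<^sub>R (indicator (cbox a b) x *\<^sub>R w x))" for x
    using bound[of x] supp[of x] by (cases "f x = 0") (auto intro!: mult_right_mono)
  then show "AE x in lborel. norm (f x *\<^sub>R w x) \<le> norm (B *\<^sub>R (indicator (cbox a b) x *\<^sub>R w x))" by simp
qed

lemma locally_integrable_diff:
  "locally_integrable v \<Longrightarrow> locally_integrable w \<Longrightarrow> locally_integrable (\<lambda>x. v x - w x)"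
  by (auto simp: locally_integrable_def scaleR_diff_right)

text \<open>Interval bumps approximate the indicator of a box boundedly from within the box, so by dominated
  convergence the hypothesis passes to integrals over boxes.\<close>

lemma fundamental_lemma_tensor:
  fixes w :: "real^2 \<Rightarrow> 'v::euclidean_space"
  assumes w: "locally_integrable w"
    and test: "\<And>f. (\<And>j. bump_function (f j)) \<Longrightarrow> (\<integral>x. tensor f x *\<^sub>R w x \<partial>lborel) = 0"
  shows "AE x in lborel. w x = 0"
proof -
  have [measurable]: "w \<in> borel_measurable borel" using w by (simp add: locally_integrable_def)
  have ibox: "integrable lborel (\<lambda>x. indicator (box a b) x *\<^sub>R w x)" for a b
    by (rule locally_integrable_scaleR[OF w, of _ 1 a b])
       (auto simp: indicator_def dest: subsetD[OF box_subset_cbox])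
  have box: "(\<integral>x. indicator (box a b) x *\<^sub>R w x \<partial>lborel) = 0" for a b
  proof -
    let ?f = "\<lambda>n j. interval_bump (a $ j) (b $ j) n"
    have "(\<lambda>n. \<integral>x. tensor (?f n) x *\<^sub>R w x \<partial>lborel)
      \<longlonglongrightarrow> (\<integral>x. indicator (box a b) x *\<^sub>R w x \<partial>lborel)"
    proof (rule integral_dominated_convergence[where w="\<lambda>x. norm (indicator (box a b) x *\<^sub>R w x)"])
      show "integrable lborel (\<lambda>x. norm (indicator (box a b) x *\<^sub>R w x))"
        by (rule integrable_norm[OF ibox])
      have ind: "indicator (box a b) x = (\<Prod>j\<in>UNIV. indicator {a $ j<..<b $ j} (x $ j) :: real)" for x
        by (auto simp: indicator_def mem_box_cart)
      show "AE x in lborel. (\<lambda>n. tensor (?f n) x *\<^sub>R w x) \<longlonglongrightarrow> indicator (box a b) x *\<^sub>R w x"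
        unfolding ind tensor_def
        by (intro AE_I2 tendsto_scaleR tendsto_prod interval_bump_tendsto tendsto_const)
      have "\<bar>tensor (?f n) x\<bar> \<le> indicator (box a b) x" for n x
      proof (cases "x \<in> box a b")
        case True
        then show ?thesis
          by (auto simp: tensor_def abs_prod interval_bump_bounds intro!: prod_le_1)
      next
        case False
        then obtain j where "x $ j \<notin> {a $ j<..<b $ j}" by (auto simp: mem_box_cart)
        then have "interval_bump (a $ j) (b $ j) n (x $ j) = 0" by (rule interval_bump_outside)
        then have "tensor (?f n) x = 0" unfolding tensor_def by (metis finite iso_tuple_UNIV_I prod_zero)
        then show ?thesis by simp
      qed
      then show "AE x in lborel. norm (tensor (?f n) x *\<^sub>R w x) \<le> norm (indicator (box a b) x *\<^sub>R w x)" for n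
        by (auto intro!: AE_I2 mult_right_mono)
      have "continuous_on UNIV (tensor (?f n))" for n
        unfolding tensor_def
        by (intro continuous_intros continuous_on_compose2[OF bump_function_continuous[OF bump_function_interval_bump, of UNIV]]) auto
      then have "tensor (?f n) \<in> borel_measurable borel" for n
        by (rule borel_measurable_continuous_onI)
      then show "(\<lambda>x. tensor (?f n) x *\<^sub>R w x) \<in> borel_measurable lborel" for n by simp
    qed (use ibox[of a b] in auto)
    then show ?thesis
      using test[of "?f _"] bump_function_interval_bump by (simp add: LIMSEQ_const_iff)
  qed
  \<comment> \<open>Cutting off to large boxes gives integrable functions; intersections of boxes are boxes.\<close>
  have "AE x in lborel. \<forall>e\<in>Basis. \<forall>n. indicator (box (\<chi> j. - real n) (\<chi> j. real n)) x * (w x \<bullet> e) = 0"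
  proof (subst AE_finite_all, simp, rule ballI, subst AE_all_countable, rule allI)
    fix e :: 'v and n :: nat
    let ?B = "box (\<chi> j. - real n) (\<chi> j. real n) :: (real^2) set"
    have inner: "indicator S x * (w x \<bullet> e) = (indicator S x *\<^sub>R w x) \<bullet> e" for S x by simp
    show "AE x in lborel. indicator ?B x * (w x \<bullet> e) = 0"
    proof (rule AE_zero_if_box_integrals_zero)
      show "integrable lborel (\<lambda>x. indicator ?B x * (w x \<bullet> e))"
        unfolding inner by (intro integrable_inner_left) (use ibox in auto)
      fix a b
      obtain c d where cd: "box a b \<inter> ?B = box c d" by (auto simp: box_Int_box)
      have "(\<integral>x. indicator (box a b) x * (indicator ?B x * (w x \<bullet> e)) \<partial>lborel) =
          (\<integral>x. (indicator (box c d) x *\<^sub>R w x) \<bullet> e \<partial>lborel)"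
        unfolding cd[symmetric] by (intro Bochner_Integration.integral_cong) (auto simp: indicator_def)
      also have "\<dots> = 0" by (subst integral_inner_left) (use ibox box in auto)
      finally show "(\<integral>x. indicator (box a b) x * (indicator ?B x * (w x \<bullet> e)) \<partial>lborel) = 0" .
    qed
  qed
  then show ?thesis
  proof eventually_elim
    case (elim x)
    obtain n where n: "norm x < real n" using reals_Archimedean2 by blast
    have "- real n < x $ j \<and> x $ j < real n" for j
      using component_le_norm_cart[of x j] n by linarith
    then have "x \<in> box (\<chi> j. - real n) (\<chi> j. real n)"
      by (simp add: mem_box_cart)
    then have "w x \<bullet> e = 0" if "e \<in> Basis" for e
      using elim[rule_format, OF that, of n] by simp
    then show ?case unfolding euclidean_eq_iff[of "w x"] by (metis inner_zero_left)
  qed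
qed

section \<open>Weak gradients along lines\<close>

lemma real_le_one_plus_square: "t \<le> 1 + t\<^sup>2" for t :: real
  using zero_le_power2[of "t - 1 / 2"] by (simp add: power2_eq_square algebra_simps)

lemma L2_measurable: "u \<in> L2 \<Longrightarrow> u \<in> borel_measurable borel"
  by (simp add: L2_def)

lemma L2_locally_integrable: "u \<in> L2 \<Longrightarrow> locally_integrable u"
  unfolding locally_integrable_def
proof (intro conjI allI)
  assume u: "u \<in> L2"
  then show [measurable]: "u \<in> borel_measurable borel" by (rule L2_measurable)
  fix a b :: "real^2"
  show "integrable lborel (\<lambda>x. indicator (cbox a b) x *\<^sub>R u x)"
  proof (rule Bochner_Integration.integrable_bound)
    show "integrable lborel (\<lambda>x. indicator (cbox a b) x + (norm (u x))\<^sup>2)"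
      using u by (intro Bochner_Integration.integrable_add integrable_real_indicator)
        (auto simp: L2_def emeasure_lborel_cbox_finite[unfolded infinity_ennreal_def])
    show "AE x in lborel. norm (indicator (cbox a b) x *\<^sub>R u x) \<le> norm (indicator (cbox a b) x + (norm (u x))\<^sup>2)"
      using real_le_one_plus_square
      by (intro AE_I2) (auto simp: indicator_def)
  qed measurable
qed

lemma measurable_vec_nth [measurable]:
  fixes g :: "'a \<Rightarrow> complex^2"
  assumes [measurable]: "g \<in> borel_measurable M"
  shows "(\<lambda>x. g x $ i) \<in> borel_measurable M"
proof (rule measurable_compose[OF assms])
  show "(\<lambda>v. v $ i) \<in> borel_measurable (borel :: (complex^2) measure)"
    by (intro borel_measurable_continuous_onI continuous_intros)
qed

lemma L2_component:
  fixes g :: "real^2 \<Rightarrow> complex^2"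
  assumes g: "g \<in> L2"
  shows "(\<lambda>x. g x $ i) \<in> L2"
proof -
  have [measurable]: "g \<in> borel_measurable borel" using g by (rule L2_measurable)
  have "integrable lborel (\<lambda>x. (norm (g x $ i))\<^sup>2)"
  proof (rule Bochner_Integration.integrable_bound)
    show "integrable lborel (\<lambda>x. (norm (g x))\<^sup>2)" using g by (simp add: L2_def)
    show "AE x in lborel. norm ((norm (g x $ i))\<^sup>2) \<le> norm ((norm (g x))\<^sup>2)"
      by (intro AE_I2) (simp add: power_mono Finite_Cartesian_Product.norm_nth_le)
  qed measurable
  then show ?thesis by (simp add: L2_def)
qed

lemma nn_integral_L2:
  "u \<in> L2 \<Longrightarrow> (\<integral>\<^sup>+x. ennreal ((norm (u x))\<^sup>2) \<partial>lborel) = ennreal (\<integral>x. (norm (u x))\<^sup>2 \<partial>lborel)"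
  by (intro nn_integral_eq_integral) (auto simp: L2_def)

lemma tensor_continuous:
  assumes "\<And>j. bump_function (f j)"
  shows "continuous_on S (tensor f)"
  unfolding tensor_def
  by (intro continuous_intros continuous_on_compose2[OF bump_function_continuous[OF assms, of UNIV]]) auto

lemma tensor_bounded:
  assumes "\<And>j. bump_function (f j)"
  shows "\<exists>a b B. (\<forall>x. \<bar>tensor f x\<bar> \<le> B) \<and> (\<forall>x. tensor f x \<noteq> 0 \<longrightarrow> x \<in> cbox a b)"
proof -
  obtain R where R: "\<And>x. tensor f x \<noteq> 0 \<Longrightarrow> x \<in> cbox (\<chi> j. - R) (\<chi> j. R)"
    using compact_support_tensor[of f, OF assms] by blast
  have "bounded (tensor f ` cbox (\<chi> j. - R) (\<chi> j. R))"
    by (intro compact_imp_bounded compact_continuous_image tensor_continuous assms) auto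
  then obtain B where B: "\<And>x. x \<in> cbox (\<chi> j. - R) (\<chi> j. R) \<Longrightarrow> \<bar>tensor f x\<bar> \<le> B"
    by (auto simp: bounded_real)
  have "\<bar>tensor f x\<bar> \<le> max 0 B" for x
    using B[of x] R[of x] by (cases "tensor f x = 0") auto
  with R show ?thesis by blast
qed

lemma tensor_measurable:
  "(\<And>j. bump_function (f j)) \<Longrightarrow> tensor f \<in> borel_measurable borel"
  by (intro borel_measurable_continuous_onI tensor_continuous)

lemma integrable_tensor_scaleR:
  assumes "\<And>j. bump_function (f j)" and "locally_integrable w"
  shows "integrable lborel (\<lambda>x. tensor f x *\<^sub>R w x)"
proof -
  obtain a b B where *: "\<And>x. \<bar>tensor f x\<bar> \<le> B" "\<And>x. tensor f x \<noteq> 0 \<Longrightarrow> x \<in> cbox a b"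
    using tensor_bounded[of f, OF assms(1)] by blast
  show ?thesis
    by (rule locally_integrable_scaleR[OF assms(2) tensor_measurable[of f, OF assms(1)] *])
qed

lemma weak_gradient_unique:
  assumes "g \<in> L2" "g' \<in> L2" "is_weak_gradient u g" "is_weak_gradient u g'"
  shows "AE x in lborel. g x = g' x"
proof -
  have "AE x in lborel. g x $ i - g' x $ i = 0" for i
  proof (rule fundamental_lemma_tensor)
    have loc: "locally_integrable (\<lambda>x. g x $ i)" "locally_integrable (\<lambda>x. g' x $ i)"
      using assms by (auto intro!: L2_locally_integrable L2_component)
    then show "locally_integrable (\<lambda>x. g x $ i - g' x $ i)" by (rule locally_integrable_diff)
    fix f :: "2 \<Rightarrow> real \<Rightarrow> real" assume f: "\<And>j. bump_function (f j)"
    have "(\<integral>x. tensor f x *\<^sub>R (g x $ i) \<partial>lborel) = (\<integral>x. tensor f x *\<^sub>R (g' x $ i) \<partial>lborel)"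
      using assms(3,4)[unfolded is_weak_gradient_def, rule_format, OF test_function_tensor[OF f], of i]
      by simp
    then show "(\<integral>x. tensor f x *\<^sub>R (g x $ i - g' x $ i) \<partial>lborel) = 0"
      unfolding scaleR_diff_right
      by (subst Bochner_Integration.integral_diff) (auto intro!: integrable_tensor_scaleR f loc)
  qed
  then have "AE x in lborel. \<forall>i\<in>UNIV. g x $ i - g' x $ i = 0"
    by (subst AE_finite_all) simp_all
  then show ?thesis by eventually_elim (simp add: vec_eq_iff)
qed

text \<open>The antiderivative is needed on the whole line; integrals from 0 provide it on every bounded
  interval at once.\<close>

lemma bump_antiderivative:
  assumes "bump_function f"
  obtains A where "\<And>x. (A has_real_derivative f x) (at x)"
proof -
  define A where "A u = (LBINT y=0..ereal u. f y)" for u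
  have "(A has_real_derivative f x) (at x)" for x
  proof -
    define N where "N = \<bar>x\<bar> + 1"
    have "((\<lambda>u. LBINT y=ereal 0..ereal u. f y) has_vector_derivative f x) (at x within {-N..N})"
      by (rule interval_integral_FTC2) (auto simp: N_def bump_function_continuous[OF assms])
    moreover have "at x within {-N..N} = at x"
      by (rule at_within_interior) (auto simp: N_def)
    ultimately show ?thesis
      by (simp add: A_def[abs_def] has_real_derivative_iff_has_vector_derivative zero_ereal_def)
  qed
  then show thesis by (rule that)
qed

text \<open>The moving average over \<open>[y - h, y]\<close>, up to normalisation. Its derivative is the increment
  \<open>f y - f (y - h)\<close>; replacing one factor of a tensor product by its moving average therefore turns the
  weak derivative identity into an identity for increments.\<close>

definition window_integral :: "real \<Rightarrow> (real \<Rightarrow> real) \<Rightarrow> real \<Rightarrow> real" where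
  "window_integral h f y = (\<integral>s. indicator {0..h} s * f (y - s) \<partial>lborel)"

lemma window_integral_deriv:
  assumes f: "bump_function f" and "h \<ge> 0"
  shows "(window_integral h f has_real_derivative f y - f (y - h)) (at y)"
proof -
  obtain A where A: "\<And>x. (A has_real_derivative f x) (at x)" using bump_antiderivative[OF f] by blast
  have "isCont f x" for x
    using bump_function_continuous[OF f, of UNIV] by (simp add: continuous_on_eq_continuous_at)
  then have cont: "isCont (\<lambda>s. f (y - s)) s" for s y
    by (intro continuous_intros isCont_o2[where f="\<lambda>s. y - s" and g=f]) auto
  have deriv: "((\<lambda>s. - A (y - s)) has_real_derivative f (y - s)) (at s)" for s y
    by (auto intro!: derivative_eq_intros DERIV_chain2[OF A])
  have "window_integral h f y = A y - A (y - h)" for y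
    unfolding window_integral_def
    using integral_FTC_Icc_real[of 0 h "\<lambda>s. - A (y - s)" "\<lambda>s. f (y - s)"] assms(2) deriv cont
    by (simp add: mult.commute)
  then have "window_integral h f = (\<lambda>y. A y - A (y - h))" by auto
  then show ?thesis by (auto intro!: derivative_eq_intros A DERIV_chain2[OF A])
qed

lemma bump_function_window_integral:
  assumes f: "bump_function f" and h: "h \<ge> 0"
  shows "bump_function (window_integral h f)"
proof -
  have td: "times_differentiable k f" for k using f by (simp add: bump_function_def)
  have "times_differentiable (Suc k) (window_integral h f)" for k
    unfolding times_differentiable.simps
  proof (intro exI conjI allI)
    show "(window_integral h f has_real_derivative f y - f (y - h)) (at y)" for y
      by (rule window_integral_deriv[OF f h])
    have "times_differentiable k (\<lambda>y. f y + (- 1) * f (1 * y + (- h)))"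
      by (intro times_differentiable_add times_differentiable_mult times_differentiable_const
          times_differentiable_affine td)
    then show "times_differentiable k (\<lambda>y. f y - f (y - h))" by simp
  qed
  then have "\<forall>k. times_differentiable k (window_integral h f)" using times_differentiable_mono by blast
  moreover obtain R where R: "\<And>x. \<bar>x\<bar> > R \<Longrightarrow> f x = 0" using f by (auto simp: bump_function_def)
  have "window_integral h f y = 0" if "\<bar>y\<bar> > R + h" for y
  proof -
    have "indicator {0..h} s * f (y - s) = 0" for s
      using R[of "y - s"] that h by (auto simp: indicator_def)
    then show ?thesis by (simp only: window_integral_def) simp
  qed
  ultimately show ?thesis unfolding bump_function_def by blast
qed

lemma tensor_window_integral:
  "tensor (f(i := window_integral h (f i))) x =
     (\<integral>s. indicator {0..h} s * tensor f (x - s *\<^sub>R axis i 1) \<partial>lborel)"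
proof -
  have *: "tensor f (x - s *\<^sub>R axis i 1) = f i (x $ i - s) * (\<Prod>j\<in>UNIV - {i}. f j (x $ j))" for s
    by (simp add: tensor_def prod.remove[of UNIV i] axis_def)
  have "tensor (f(i := window_integral h (f i))) x
      = window_integral h (f i) (x $ i) * (\<Prod>j\<in>UNIV - {i}. f j (x $ j))"
    by (simp add: tensor_def prod.remove[of UNIV i])
  also have "\<dots> = (\<integral>s. indicator {0..h} s * tensor f (x - s *\<^sub>R axis i 1) \<partial>lborel)"
    unfolding * window_integral_def by (simp add: mult.assoc[symmetric])
  finally show ?thesis .
qed

text \<open>These are the two integrability facts that allow integration over the plane and along a segment to be
  exchanged, before and after the translation by \<open>s e\<close>. The estimate \<open>|G| \<le> 1 + |G|\<^sup>2\<close> is enough, since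
  everything is restricted to a bounded set.\<close>

lemma integrable_along_segment:
  fixes G :: "real^2 \<Rightarrow> 'v::euclidean_space"
  assumes G: "G \<in> L2" and f[measurable]: "f \<in> borel_measurable borel"
    and bound: "\<And>x. \<bar>f x\<bar> \<le> B" and supp: "\<And>x. f x \<noteq> 0 \<Longrightarrow> x \<in> cbox a b"
  shows "integrable (lborel \<Otimes>\<^sub>M lborel) (\<lambda>(x, s). (indicator {0..h} s * f x) *\<^sub>R G (x + s *\<^sub>R e))"
    and "integrable (lborel \<Otimes>\<^sub>M lborel) (\<lambda>(x, s). (indicator {0..h} s * f (x - s *\<^sub>R e)) *\<^sub>R G x)"
proof -
  have [measurable]: "G \<in> borel_measurable borel" using G by (rule L2_measurable)
  have inner: "(\<integral>\<^sup>+x. ennreal (norm ((indicator {0..h} s * f x) *\<^sub>R G (x + s *\<^sub>R e))) \<partial>lborel)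
      \<le> indicator {0..h} s * (ennreal B * (emeasure lborel (cbox a b) + ennreal (\<integral>x. (norm (G x))\<^sup>2 \<partial>lborel)))" for s
  proof -
    have "B \<ge> 0" using bound[of undefined] by linarith
    have pt: "ennreal (norm ((indicator {0..h} s * f x) *\<^sub>R G (x + s *\<^sub>R e))) \<le>
        indicator {0..h} s * (ennreal B * (indicator (cbox a b) x + ennreal ((norm (G (x + s *\<^sub>R e)))\<^sup>2)))" for x
    proof (cases "s \<in> {0..h} \<and> x \<in> cbox a b")
      case True
      have "norm ((indicator {0..h} s * f x) *\<^sub>R G (x + s *\<^sub>R e)) \<le> B * (1 + (norm (G (x + s *\<^sub>R e)))\<^sup>2)"
        using True bound[of x] real_le_one_plus_square[of "norm (G (x + s *\<^sub>R e))"] \<open>B \<ge> 0\<close>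
        by (auto intro!: mult_mono)
      then show ?thesis
        using True \<open>B \<ge> 0\<close> by (simp add: ennreal_mult[symmetric] ennreal_plus[symmetric] flip: ennreal_1 del: ennreal_plus)
    next
      case False
      then have "(indicator {0..h} s * f x) *\<^sub>R G (x + s *\<^sub>R e) = 0"
        using supp[of x] by (auto simp: indicator_def)
      then show ?thesis by (simp only: norm_zero ennreal_0 zero_le)
    qed
    have "(\<integral>\<^sup>+x. ennreal (norm ((indicator {0..h} s * f x) *\<^sub>R G (x + s *\<^sub>R e))) \<partial>lborel) \<le>
       (\<integral>\<^sup>+x. indicator {0..h} s * (ennreal B * (indicator (cbox a b) x + ennreal ((norm (G (x + s *\<^sub>R e)))\<^sup>2))) \<partial>lborel)"
      by (intro nn_integral_mono pt)
    also have "\<dots> = indicator {0..h} s * (ennreal B * (emeasure lborel (cbox a b) +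
        (\<integral>\<^sup>+x. ennreal ((norm (G (x + s *\<^sub>R e)))\<^sup>2) \<partial>lborel)))"
      by (simp add: nn_integral_cmult nn_integral_add)
    also have "(\<integral>\<^sup>+x. ennreal ((norm (G (x + s *\<^sub>R e)))\<^sup>2) \<partial>lborel) = ennreal (\<integral>x. (norm (G x))\<^sup>2 \<partial>lborel)"
      using nn_integral_translate[of "\<lambda>x. ennreal ((norm (G x))\<^sup>2)" "s *\<^sub>R e"] nn_integral_L2[OF G] by simp
    finally show ?thesis .
  qed
  have fin: "(\<integral>\<^sup>+s. indicator {0..h} s * (ennreal B * (emeasure lborel (cbox a b) + ennreal (\<integral>x. (norm (G x))\<^sup>2 \<partial>lborel))) \<partial>lborel) < \<infinity>"
    by (subst nn_integral_multc) (auto simp: ennreal_mult_less_top emeasure_lborel_cbox_finite[unfolded infinity_ennreal_def]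
        emeasure_lborel_Icc_eq)
  show "integrable (lborel \<Otimes>\<^sub>M lborel) (\<lambda>(x, s). (indicator {0..h} s * f x) *\<^sub>R G (x + s *\<^sub>R e))"
  proof (rule integrableI_bounded)
    have "(\<integral>\<^sup>+z. ennreal (norm (case z of (x, s) \<Rightarrow> (indicator {0..h} s * f x) *\<^sub>R G (x + s *\<^sub>R e))) \<partial>(lborel \<Otimes>\<^sub>M lborel))
      = (\<integral>\<^sup>+s. \<integral>\<^sup>+x. ennreal (norm ((indicator {0..h} s * f x) *\<^sub>R G (x + s *\<^sub>R e))) \<partial>lborel \<partial>lborel)"
      by (subst lborel_pair.nn_integral_snd[symmetric]) auto
    also have "\<dots> < \<infinity>" by (rule le_less_trans[OF nn_integral_mono[OF inner] fin])
    finally show "(\<integral>\<^sup>+z. ennreal (norm (case z of (x, s) \<Rightarrow> (indicator {0..h} s * f x) *\<^sub>R G (x + s *\<^sub>R e))) \<partial>(lborel \<Otimes>\<^sub>M lborel)) < \<infinity>" .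
  qed measurable
  show "integrable (lborel \<Otimes>\<^sub>M lborel) (\<lambda>(x, s). (indicator {0..h} s * f (x - s *\<^sub>R e)) *\<^sub>R G x)"
  proof (rule integrableI_bounded)
    have "(\<integral>\<^sup>+z. ennreal (norm (case z of (x, s) \<Rightarrow> (indicator {0..h} s * f (x - s *\<^sub>R e)) *\<^sub>R G x)) \<partial>(lborel \<Otimes>\<^sub>M lborel))
      = (\<integral>\<^sup>+s. \<integral>\<^sup>+x. ennreal (norm ((indicator {0..h} s * f (x - s *\<^sub>R e)) *\<^sub>R G x)) \<partial>lborel \<partial>lborel)"
      by (subst lborel_pair.nn_integral_snd[symmetric]) auto
    also have "\<dots> = (\<integral>\<^sup>+s. \<integral>\<^sup>+x. ennreal (norm ((indicator {0..h} s * f x) *\<^sub>R G (x + s *\<^sub>R e))) \<partial>lborel \<partial>lborel)"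
    proof (rule nn_integral_cong)
      show "(\<integral>\<^sup>+x. ennreal (norm ((indicator {0..h} s * f (x - s *\<^sub>R e)) *\<^sub>R G x)) \<partial>lborel) =
          (\<integral>\<^sup>+x. ennreal (norm ((indicator {0..h} s * f x) *\<^sub>R G (x + s *\<^sub>R e))) \<partial>lborel)" for s
        using nn_integral_translate[of "\<lambda>x. ennreal (norm ((indicator {0..h} s * f (x - s *\<^sub>R e)) *\<^sub>R G x))" "s *\<^sub>R e"]
        by simp
    qed
    also have "\<dots> < \<infinity>" by (rule le_less_trans[OF nn_integral_mono[OF inner] fin])
    finally show "(\<integral>\<^sup>+z. ennreal (norm (case z of (x, s) \<Rightarrow> (indicator {0..h} s * f (x - s *\<^sub>R e)) *\<^sub>R G x)) \<partial>(lborel \<Otimes>\<^sub>M lborel)) < \<infinity>" .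
  qed measurable
qed

lemma locally_integrable_segment_integral:
  fixes G :: "real^2 \<Rightarrow> 'v::euclidean_space"
  assumes G: "G \<in> L2"
  shows "locally_integrable (\<lambda>x. \<integral>s. indicator {0..h} s *\<^sub>R G (x + s *\<^sub>R e) \<partial>lborel)"
  unfolding locally_integrable_def
proof (intro conjI allI)
  have [measurable]: "G \<in> borel_measurable borel" using G by (rule L2_measurable)
  show "(\<lambda>x. \<integral>s. indicator {0..h} s *\<^sub>R G (x + s *\<^sub>R e) \<partial>lborel) \<in> borel_measurable borel"
    by measurable
  fix a b
  have "integrable (lborel \<Otimes>\<^sub>M lborel) (\<lambda>(x, s). (indicator {0..h} s * indicator (cbox a b) x) *\<^sub>R G (x + s *\<^sub>R e))"
    by (rule integrable_along_segment[OF G, of _ 1 a b]) (auto simp: indicator_def)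
  from lborel_pair.integrable_fst[OF this]
  show "integrable lborel (\<lambda>x. indicator (cbox a b) x *\<^sub>R (\<integral>s. indicator {0..h} s *\<^sub>R G (x + s *\<^sub>R e) \<partial>lborel))"
    by (simp only: mult.commute[of _ "indicator (cbox a b) _"] scaleR_scaleR[symmetric] integral_scaleR_right)
qed

text \<open>Let \<open>f\<close> be a tensor product and \<open>F\<close> the tensor product in which the \<open>i\<close>-th factor is replaced by its
  moving average. Then \<open>\<partial>\<^sub>i F = f - f (\<cdot> - h e)\<close>, and \<open>F\<close> is the integral of \<open>f (\<cdot> - s e)\<close> over
  \<open>s \<in> [0, h]\<close>. Testing the weak gradient with \<open>F\<close> and moving the translations from the test function
  to \<open>u\<close> and \<open>g\<close> shows that the difference of the two sides is annihilated by every \<open>f\<close>.\<close>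

lemma increment_eq_segment_integral:
  assumes u: "u \<in> L2" and g: "g \<in> L2" and wg: "is_weak_gradient u g" and h: "h \<ge> 0"
  shows "AE x in lborel. u (x + h *\<^sub>R axis i 1) - u x =
    (\<integral>s. indicator {0..h} s *\<^sub>R (g (x + s *\<^sub>R axis i 1) $ i) \<partial>lborel)"
proof -
  define e :: "real^2" where "e = axis i 1"
  define G where "G x = g x $ i" for x
  define v where "v x = (\<integral>s. indicator {0..h} s *\<^sub>R G (x + s *\<^sub>R e) \<partial>lborel)" for x
  have G: "G \<in> L2" unfolding G_def[abs_def] by (rule L2_component[OF g])
  have [measurable]: "G \<in> borel_measurable borel" "u \<in> borel_measurable borel"
    using G u by (auto intro: L2_measurable)
  have lv: "locally_integrable v" unfolding v_def[abs_def] by (rule locally_integrable_segment_integral[OF G])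
  have "(\<lambda>x. u (x + h *\<^sub>R e)) \<in> L2"
    using u integrable_translate[of "\<lambda>x. (norm (u x))\<^sup>2" "h *\<^sub>R e"] by (auto simp: L2_def)
  then have luh: "locally_integrable (\<lambda>x. u (x + h *\<^sub>R e))" by (rule L2_locally_integrable)
  have lu: "locally_integrable u" using u by (rule L2_locally_integrable)
  have "AE x in lborel. (u (x + h *\<^sub>R e) - u x) - v x = 0"
  proof (rule fundamental_lemma_tensor)
    show "locally_integrable (\<lambda>x. (u (x + h *\<^sub>R e) - u x) - v x)"
      by (intro locally_integrable_diff luh lu lv)
    fix f :: "2 \<Rightarrow> real \<Rightarrow> real" assume f: "\<And>j. bump_function (f j)"
    obtain a b B where fB: "\<And>x. \<bar>tensor f x\<bar> \<le> B" "\<And>x. tensor f x \<noteq> 0 \<Longrightarrow> x \<in> cbox a b"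
      using tensor_bounded[of f, OF f] by blast
    have [measurable]: "tensor f \<in> borel_measurable borel" by (rule tensor_measurable[OF f])
    define F where "F = f(i := window_integral h (f i))"
    have F: "bump_function (F j)" for j
      by (simp add: F_def f h bump_function_window_integral)
    have td: "\<exists>f'. \<forall>x. (f j has_real_derivative f' x) (at x)" for j
    proof -
      have "times_differentiable (Suc 0) (f j)" using f[of j] unfolding bump_function_def by blast
      then show ?thesis by auto
    qed
    then obtain f' where f': "\<And>j x. (f j has_real_derivative f' j x) (at x)" by metis
    define F' where "F' = f'(i := (\<lambda>y. f i y - f i (y - h)))"
    have "(F j has_real_derivative F' j x) (at x)" for j x
      using window_integral_deriv[OF f h, of i] f' by (simp add: F_def F'_def)
    then have "partial_deriv i (tensor F) = tensor (F(i := F' i))" by (rule partial_deriv_tensor)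
    then have dF: "partial_deriv i (tensor F) x = tensor f x - tensor f (x - h *\<^sub>R e)" for x
      by (simp add: F_def F'_def e_def tensor_def prod.remove[of UNIV i] axis_def left_diff_distrib)
    have i1: "integrable lborel (\<lambda>x. tensor f x *\<^sub>R u x)"
      by (intro integrable_tensor_scaleR f lu)
    have i2: "integrable lborel (\<lambda>x. tensor f x *\<^sub>R u (x + h *\<^sub>R e))"
      by (intro integrable_tensor_scaleR f luh)
    then have i3: "integrable lborel (\<lambda>x. tensor f (x - h *\<^sub>R e) *\<^sub>R u x)"
      using integrable_translate[OF i2, of "- (h *\<^sub>R e)"] by simp
    have iv: "integrable lborel (\<lambda>x. tensor f x *\<^sub>R v x)"
      by (intro integrable_tensor_scaleR f lv)
    have "(\<integral>x. tensor f x *\<^sub>R u x \<partial>lborel) - (\<integral>x. tensor f x *\<^sub>R u (x + h *\<^sub>R e) \<partial>lborel)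
       = (\<integral>x. tensor f x *\<^sub>R u x \<partial>lborel) - (\<integral>x. tensor f (x - h *\<^sub>R e) *\<^sub>R u x \<partial>lborel)"
      using integral_translate[of "\<lambda>x. tensor f (x - h *\<^sub>R e) *\<^sub>R u x" "h *\<^sub>R e"] by simp
    also have "\<dots> = (\<integral>x. partial_deriv i (tensor F) x *\<^sub>R u x \<partial>lborel)"
      unfolding dF using i1 i3 by (simp add: scaleR_diff_left)
    also have "\<dots> = - (\<integral>x. tensor F x *\<^sub>R G x \<partial>lborel)"
      unfolding G_def by (rule wg[unfolded is_weak_gradient_def, rule_format, OF test_function_tensor[OF F]])
    also have "(\<integral>x. tensor F x *\<^sub>R G x \<partial>lborel) =
        (\<integral>x. \<integral>s. (indicator {0..h} s * tensor f (x - s *\<^sub>R e)) *\<^sub>R G x \<partial>lborel \<partial>lborel)"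
    proof (intro Bochner_Integration.integral_cong refl)
      fix x
      show "tensor F x *\<^sub>R G x = (\<integral>s. (indicator {0..h} s * tensor f (x - s *\<^sub>R e)) *\<^sub>R G x \<partial>lborel)"
      proof -
        have "B \<ge> 0" using fB(1)[of x] by linarith
        have "integrable lborel (\<lambda>s. indicator {0..h} s * tensor f (x - s *\<^sub>R e))"
        proof (rule Bochner_Integration.integrable_bound)
          show "integrable lborel (\<lambda>s. B * indicator {0..h} s)"
            by (intro integrable_mult_right integrable_real_indicator) (auto simp: emeasure_lborel_Icc_eq)
          show "AE s in lborel. norm (indicator {0..h} s * tensor f (x - s *\<^sub>R e)) \<le> norm (B * indicator {0..h} s :: real)"
            using fB(1) \<open>B \<ge> 0\<close> by (intro AE_I2) (auto simp: indicator_def)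
        qed measurable
        then show ?thesis
          unfolding F_def tensor_window_integral e_def[symmetric]
          by (intro integral_scaleR_left[symmetric])
      qed
    qed
    also have "\<dots> = (\<integral>s. \<integral>x. (indicator {0..h} s * tensor f (x - s *\<^sub>R e)) *\<^sub>R G x \<partial>lborel \<partial>lborel)"
      by (intro lborel_pair.Fubini_integral[symmetric] integrable_along_segment(2)[OF G _ fB]) auto
    also have "\<dots> = (\<integral>s. \<integral>x. (indicator {0..h} s * tensor f x) *\<^sub>R G (x + s *\<^sub>R e) \<partial>lborel \<partial>lborel)"
    proof (rule Bochner_Integration.integral_cong[OF refl])
      show "(\<integral>x. (indicator {0..h} s * tensor f (x - s *\<^sub>R e)) *\<^sub>R G x \<partial>lborel) =
          (\<integral>x. (indicator {0..h} s * tensor f x) *\<^sub>R G (x + s *\<^sub>R e) \<partial>lborel)" for s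
        using integral_translate[of "\<lambda>x. (indicator {0..h} s * tensor f (x - s *\<^sub>R e)) *\<^sub>R G x" "s *\<^sub>R e"]
        by simp
    qed
    also have "\<dots> = (\<integral>x. \<integral>s. (indicator {0..h} s * tensor f x) *\<^sub>R G (x + s *\<^sub>R e) \<partial>lborel \<partial>lborel)"
      by (intro lborel_pair.Fubini_integral integrable_along_segment(1)[OF G _ fB]) auto
    also have "\<dots> = (\<integral>x. tensor f x *\<^sub>R v x \<partial>lborel)"
      unfolding v_def
      by (simp only: mult.commute[of _ "tensor f _"] scaleR_scaleR[symmetric] integral_scaleR_right)
    finally show "(\<integral>x. tensor f x *\<^sub>R ((u (x + h *\<^sub>R e) - u x) - v x) \<partial>lborel) = 0"
      using i1 i2 iv by (simp add: scaleR_diff_right algebra_simps)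
  qed
  then show ?thesis by eventually_elim (simp add: v_def G_def e_def)
qed

lemma increment_bound:
  assumes u: "u \<in> L2" and g: "g \<in> L2" and wg: "is_weak_gradient u g" and h: "h \<ge> 0"
  shows "AE x in lborel. ennreal ((norm (u (x + h *\<^sub>R axis i 1) - u x))\<^sup>2) \<le>
    ennreal h * (\<integral>\<^sup>+s. indicator {0..h} s * ennreal ((norm (g (x + s *\<^sub>R axis i 1) $ i))\<^sup>2) \<partial>lborel)"
  using increment_eq_segment_integral[OF assms, of i]
proof eventually_elim
  case (elim x)
  define G where "G s = g (x + s *\<^sub>R axis i 1) $ i" for s
  have [measurable]: "g \<in> borel_measurable borel" using g by (rule L2_measurable)
  have [measurable]: "G \<in> borel_measurable borel" unfolding G_def by measurable
  have "ennreal (norm (\<integral>s. indicator {0..h} s *\<^sub>R G s \<partial>lborel)) \<le> (\<integral>\<^sup>+s. ennreal (norm (indicator {0..h} s *\<^sub>R G s)) \<partial>lborel)"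
    by (cases "integrable lborel (\<lambda>s. indicator {0..h} s *\<^sub>R G s)")
       (simp_all add: integral_norm_bound_ennreal not_integrable_integral_eq del: norm_scaleR)
  also have "\<dots> = (\<integral>\<^sup>+s. indicator {0..h} s * (indicator {0..h} s * ennreal (norm (G s))) \<partial>lborel)"
    by (intro nn_integral_cong) (auto simp: indicator_def)
  finally have "ennreal (norm (\<integral>s. indicator {0..h} s *\<^sub>R G s \<partial>lborel)) ^ 2 \<le>
     (\<integral>\<^sup>+s. indicator {0..h} s * (indicator {0..h} s * ennreal (norm (G s))) \<partial>lborel) ^ 2"
    by (rule power_mono) simp
  also have "\<dots> \<le> (\<integral>\<^sup>+s. indicator {0..h} s ^ 2 \<partial>lborel) * (\<integral>\<^sup>+s. (indicator {0..h} s * ennreal (norm (G s))) ^ 2 \<partial>lborel)"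
    by (rule Cauchy_Schwarz_nn_integral) auto
  also have "(\<integral>\<^sup>+s. indicator {0..h} s ^ 2 \<partial>lborel) = (\<integral>\<^sup>+s. indicator {0..h} s \<partial>lborel)"
    by (intro nn_integral_cong) (auto simp: indicator_def)
  also have "\<dots> = ennreal h" using h by (simp add: emeasure_lborel_Icc_eq)
  also have "(\<integral>\<^sup>+s. (indicator {0..h} s * ennreal (norm (G s))) ^ 2 \<partial>lborel)
      = (\<integral>\<^sup>+s. indicator {0..h} s * ennreal ((norm (G s))\<^sup>2) \<partial>lborel)"
    by (intro nn_integral_cong) (auto simp: indicator_def ennreal_power)
  finally show ?case unfolding elim using h by (simp add: G_def ennreal_power)
qed

lemma translation_L2_bound:
  assumes u: "u \<in> L2" and g: "g \<in> L2" and wg: "is_weak_gradient u g" and h: "h \<ge> 0"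
  shows "integrable lborel (\<lambda>x. (norm (u (x + h *\<^sub>R axis i 1) - u x))\<^sup>2)"
    and "(\<integral>x. (norm (u (x + h *\<^sub>R axis i 1) - u x))\<^sup>2 \<partial>lborel) \<le> h\<^sup>2 * (\<integral>x. (norm (g x $ i))\<^sup>2 \<partial>lborel)"
proof -
  define e :: "real^2" where "e = axis i 1"
  define K where "K = (\<integral>x. (norm (g x $ i))\<^sup>2 \<partial>lborel)"
  have "K \<ge> 0" by (simp add: K_def)
  have [measurable]: "g \<in> borel_measurable borel" "u \<in> borel_measurable borel"
    using g u by (auto intro: L2_measurable)
  have slice: "(\<integral>\<^sup>+x. ennreal ((norm (g (x + s *\<^sub>R e) $ i))\<^sup>2) \<partial>lborel) = ennreal K" for s
    using nn_integral_translate[of "\<lambda>x. ennreal ((norm (g x $ i))\<^sup>2)" "s *\<^sub>R e"]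
      nn_integral_L2[OF L2_component[OF g, of i]] by (simp add: K_def)
  have "(\<integral>\<^sup>+x. ennreal ((norm (u (x + h *\<^sub>R e) - u x))\<^sup>2) \<partial>lborel) \<le>
      (\<integral>\<^sup>+x. ennreal h * (\<integral>\<^sup>+s. indicator {0..h} s * ennreal ((norm (g (x + s *\<^sub>R e) $ i))\<^sup>2) \<partial>lborel) \<partial>lborel)"
    unfolding e_def by (rule nn_integral_mono_AE[OF increment_bound[OF assms]])
  also have "\<dots> = ennreal h * (\<integral>\<^sup>+x. \<integral>\<^sup>+s. indicator {0..h} s * ennreal ((norm (g (x + s *\<^sub>R e) $ i))\<^sup>2) \<partial>lborel \<partial>lborel)"
    by (rule nn_integral_cmult) measurable
  also have "(\<integral>\<^sup>+x. \<integral>\<^sup>+s. indicator {0..h} s * ennreal ((norm (g (x + s *\<^sub>R e) $ i))\<^sup>2) \<partial>lborel \<partial>lborel)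
      = (\<integral>\<^sup>+s. \<integral>\<^sup>+x. indicator {0..h} s * ennreal ((norm (g (x + s *\<^sub>R e) $ i))\<^sup>2) \<partial>lborel \<partial>lborel)"
    by (rule lborel_pair.Fubini') measurable
  also have "\<dots> = (\<integral>\<^sup>+s. ennreal K * indicator {0..h} s \<partial>lborel)"
    by (simp add: nn_integral_cmult slice mult.commute)
  also have "\<dots> = ennreal K * ennreal h"
    using h by (simp add: nn_integral_cmult emeasure_lborel_Icc_eq)
  finally have *: "(\<integral>\<^sup>+x. ennreal ((norm (u (x + h *\<^sub>R e) - u x))\<^sup>2) \<partial>lborel) \<le> ennreal (h\<^sup>2 * K)"
    using h \<open>K \<ge> 0\<close> by (simp add: ennreal_mult[symmetric] power2_eq_square mult.assoc mult.left_commute mult.commute)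
  then have "integrable lborel (\<lambda>x. (norm (u (x + h *\<^sub>R e) - u x))\<^sup>2)"
    by (intro integrableI_bounded) (auto intro: le_less_trans)
  then show "integrable lborel (\<lambda>x. (norm (u (x + h *\<^sub>R axis i 1) - u x))\<^sup>2)" by (simp add: e_def)
  have "(\<integral>x. (norm (u (x + h *\<^sub>R e) - u x))\<^sup>2 \<partial>lborel) \<le> h\<^sup>2 * K"
    by (rule integral_real_bounded) (use \<open>K \<ge> 0\<close> * in auto)
  then show "(\<integral>x. (norm (u (x + h *\<^sub>R axis i 1) - u x))\<^sup>2 \<partial>lborel) \<le> h\<^sup>2 * (\<integral>x. (norm (g x $ i))\<^sup>2 \<partial>lborel)"
    by (simp add: e_def K_def)
qed

section \<open>The Gagliardo-Nirenberg inequality\<close>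

lemma norm_square_add_le: "(norm (a :: 'a::real_normed_vector))\<^sup>2 \<le> 2 * (norm b)\<^sup>2 + 2 * (norm (b - a))\<^sup>2"
proof -
  have "norm a \<le> norm b + norm (b - a)" by (metis norm_minus_commute norm_triangle_sub)
  then have "(norm a)\<^sup>2 \<le> (norm b + norm (b - a))\<^sup>2" by (rule power_mono) simp
  also have "\<dots> \<le> 2 * (norm b)\<^sup>2 + 2 * (norm (b - a))\<^sup>2"
    using zero_le_power2[of "norm b - norm (b - a)"] by (simp add: power2_eq_square algebra_simps)
  finally show ?thesis .
qed

text \<open>Compare \<open>u x\<close> with \<open>u (x + s e)\<close> by \<open>increment_bound\<close>, and average over \<open>0 \<le> s \<le> L\<close>. The
  bound depends only on the line through \<open>x\<close> in direction \<open>e\<close>; the length \<open>L\<close> balances the two terms.\<close>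

lemma line_bound:
  assumes u: "u \<in> L2" and g: "g \<in> L2" and wg: "is_weak_gradient u g" and L: "L > 0"
  shows "AE x in lborel. ennreal ((norm (u x))\<^sup>2) \<le>
    (\<integral>\<^sup>+s. ennreal (2 / L * (norm (u (x + s *\<^sub>R axis i 1)))\<^sup>2 + 2 * L * (norm (g (x + s *\<^sub>R axis i 1) $ i))\<^sup>2) \<partial>lborel)"
proof -
  define e :: "real^2" where "e = axis i 1"
  have [measurable]: "g \<in> borel_measurable borel" "u \<in> borel_measurable borel"
    using g u by (auto intro: L2_measurable)
  define I where "I x = (\<integral>\<^sup>+s. ennreal ((norm (g (x + s *\<^sub>R e) $ i))\<^sup>2) \<partial>lborel)" for x
  have [measurable]: "I \<in> borel_measurable borel" unfolding I_def[abs_def] by measurable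
  define P where "P x s \<longleftrightarrow> (s \<in> {0..L} \<longrightarrow> ennreal ((norm (u (x + s *\<^sub>R e) - u x))\<^sup>2) \<le> ennreal L * I x)" for x s
  have "AE x in lborel. P x s" for s
  proof (cases "s \<in> {0..L}")
    case True
    then have "0 \<le> s" by simp
    from increment_bound[OF u g wg this, of i] show ?thesis
    proof eventually_elim
      case (elim x)
      have "ennreal ((norm (u (x + s *\<^sub>R e) - u x))\<^sup>2) \<le> ennreal s * (\<integral>\<^sup>+r. indicator {0..s} r * ennreal ((norm (g (x + r *\<^sub>R e) $ i))\<^sup>2) \<partial>lborel)"
        using elim by (simp add: e_def)
      also have "\<dots> \<le> ennreal L * I x"
        unfolding I_def using True
        by (intro mult_mono nn_integral_mono) (auto simp: indicator_def ennreal_leI)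
      finally show ?case by (simp add: P_def)
    qed
  qed (auto simp: P_def)
  then have "AE s in lborel. AE x in lborel. P x s" by simp
  moreover have "{z \<in> space (lborel \<Otimes>\<^sub>M lborel). P (fst z) (snd z)} \<in> sets (lborel \<Otimes>\<^sub>M lborel)"
    unfolding P_def by measurable
  \<comment> \<open>The exceptional null set depends on the increment \<open>s\<close>; by Fubini almost every point is good for almost
      every \<open>s\<close>.\<close>
  ultimately have "AE x in lborel. AE s in lborel. P x s"
    using lborel_pair.AE_commute[of P] by blast
  then show ?thesis
  proof eventually_elim
    case (elim x)
    have "ennreal ((norm (u x))\<^sup>2) * ennreal L = (\<integral>\<^sup>+s. ennreal ((norm (u x))\<^sup>2) * indicator {0..L} s \<partial>lborel)"
      using L by (simp add: nn_integral_cmult emeasure_lborel_Icc_eq)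
    also have "\<dots> \<le> (\<integral>\<^sup>+s. 2 * ennreal ((norm (u (x + s *\<^sub>R e)))\<^sup>2) + (2 * (ennreal L * I x)) * indicator {0..L} s \<partial>lborel)"
    proof (rule nn_integral_mono_AE, use elim in eventually_elim)
      case (elim s)
      show ?case
      proof (cases "s \<in> {0..L}")
        case True
        have "ennreal ((norm (u x))\<^sup>2) \<le> ennreal (2 * (norm (u (x + s *\<^sub>R e)))\<^sup>2 + 2 * (norm (u (x + s *\<^sub>R e) - u x))\<^sup>2)"
          by (rule ennreal_leI[OF norm_square_add_le])
        also have "\<dots> = 2 * ennreal ((norm (u (x + s *\<^sub>R e)))\<^sup>2) + 2 * ennreal ((norm (u (x + s *\<^sub>R e) - u x))\<^sup>2)"
          by (simp add: ennreal_plus ennreal_mult)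
        also have "\<dots> \<le> 2 * ennreal ((norm (u (x + s *\<^sub>R e)))\<^sup>2) + 2 * (ennreal L * I x)"
          using elim True by (intro add_left_mono mult_left_mono) (auto simp: P_def)
        finally show ?thesis using True by simp
      qed simp
    qed
    also have "\<dots> = (\<integral>\<^sup>+s. 2 * ennreal ((norm (u (x + s *\<^sub>R e)))\<^sup>2) \<partial>lborel) + 2 * (ennreal L * I x) * ennreal L"
      using L by (simp add: nn_integral_add nn_integral_cmult emeasure_lborel_Icc_eq)
    also have "\<dots> = ennreal L * (\<integral>\<^sup>+s. ennreal (2 / L * (norm (u (x + s *\<^sub>R e)))\<^sup>2 + 2 * L * (norm (g (x + s *\<^sub>R e) $ i))\<^sup>2) \<partial>lborel)"
    proof -
      have split: "ennreal L * ennreal (2 / L * (norm (u (x + s *\<^sub>R e)))\<^sup>2 + 2 * L * (norm (g (x + s *\<^sub>R e) $ i))\<^sup>2)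
         = 2 * ennreal ((norm (u (x + s *\<^sub>R e)))\<^sup>2) + 2 * ennreal L * ennreal L * ennreal ((norm (g (x + s *\<^sub>R e) $ i))\<^sup>2)" for s
      proof -
        have "ennreal L * ennreal (2 / L * (norm (u (x + s *\<^sub>R e)))\<^sup>2 + 2 * L * (norm (g (x + s *\<^sub>R e) $ i))\<^sup>2)
          = ennreal (2 * (norm (u (x + s *\<^sub>R e)))\<^sup>2 + 2 * L * L * (norm (g (x + s *\<^sub>R e) $ i))\<^sup>2)"
          using L by (subst ennreal_mult'[symmetric]) (auto simp: field_simps simp del: ennreal_plus)
        also have "\<dots> = 2 * ennreal ((norm (u (x + s *\<^sub>R e)))\<^sup>2) + 2 * ennreal L * ennreal L * ennreal ((norm (g (x + s *\<^sub>R e) $ i))\<^sup>2)"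
          using L by (simp add: ennreal_plus ennreal_mult)
        finally show ?thesis .
      qed
      have "ennreal L * (\<integral>\<^sup>+s. ennreal (2 / L * (norm (u (x + s *\<^sub>R e)))\<^sup>2 + 2 * L * (norm (g (x + s *\<^sub>R e) $ i))\<^sup>2) \<partial>lborel)
        = (\<integral>\<^sup>+s. 2 * ennreal ((norm (u (x + s *\<^sub>R e)))\<^sup>2) + 2 * ennreal L * ennreal L * ennreal ((norm (g (x + s *\<^sub>R e) $ i))\<^sup>2) \<partial>lborel)"
        unfolding split[symmetric] by (rule nn_integral_cmult[symmetric]) measurable
      also have "\<dots> = (\<integral>\<^sup>+s. 2 * ennreal ((norm (u (x + s *\<^sub>R e)))\<^sup>2) \<partial>lborel) + 2 * (ennreal L * I x) * ennreal L"
        by (simp add: nn_integral_add nn_integral_cmult I_def mult_ac)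
      finally show ?thesis by simp
    qed
    finally have "ennreal L * ennreal ((norm (u x))\<^sup>2) \<le> ennreal L * (\<integral>\<^sup>+s. ennreal (2 / L * (norm (u (x + s *\<^sub>R e)))\<^sup>2 + 2 * L * (norm (g (x + s *\<^sub>R e) $ i))\<^sup>2) \<partial>lborel)"
      by (simp add: mult.commute)
    then show ?case
      using L by (subst (asm) ennreal_mult_le_mult_iff) (auto simp: e_def)
  qed
qed

definition plane_point :: "real \<times> real \<Rightarrow> real^2" where
  "plane_point z = fst z *\<^sub>R axis 1 1 + snd z *\<^sub>R axis 2 1"

lemma plane_point_nth [simp]: "plane_point (s, t) $ 1 = s" "plane_point (s, t) $ 2 = t"
  by (simp_all add: plane_point_def axis_def)

lemma plane_point_add: "plane_point (a, b) + s *\<^sub>R axis 1 1 = plane_point (a + s, b)"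
    "plane_point (a, b) + s *\<^sub>R axis 2 1 = plane_point (a, b + s)"
  by (simp_all add: plane_point_def algebra_simps)

lemma plane_point_measurable [measurable]: "plane_point \<in> borel_measurable borel"
  unfolding plane_point_def[abs_def]
  by (intro borel_measurable_continuous_onI continuous_intros)

lemma lborel_plane: "lborel = distr (lborel \<Otimes>\<^sub>M lborel) borel plane_point"
proof (rule lborel_eqI)
  fix l u :: "real^2"
  assume le: "\<And>b. b \<in> Basis \<Longrightarrow> l \<bullet> b \<le> u \<bullet> b"
  have lu: "l $ j \<le> u $ j" for j
    using le[of "axis j 1"] by (simp add: inner_axis axis_in_Basis_iff)
  have [measurable]: "plane_point \<in> (lborel \<Otimes>\<^sub>M lborel) \<rightarrow>\<^sub>M borel"
    by (simp add: lborel_prod)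
  have "plane_point -` box l u \<inter> space (lborel \<Otimes>\<^sub>M lborel) = {l $ 1<..<u $ 1} \<times> {l $ 2<..<u $ 2}"
    by (auto simp: mem_box_cart forall_2 space_pair_measure)
  then have "emeasure (distr (lborel \<Otimes>\<^sub>M lborel) borel plane_point) (box l u) =
      emeasure (lborel \<Otimes>\<^sub>M lborel) ({l $ 1<..<u $ 1} \<times> {l $ 2<..<u $ 2})"
    by (simp add: emeasure_distr)
  also have "\<dots> = ennreal (u $ 1 - l $ 1) * ennreal (u $ 2 - l $ 2)"
    using lu by (simp add: lborel.emeasure_pair_measure_Times)
  also have "\<dots> = ennreal (\<Prod>b\<in>Basis. (u - l) \<bullet> b)"
  proof -
    have B: "(Basis :: (real^2) set) = (\<lambda>i. axis i 1) ` UNIV" by (auto simp: Basis_vec_def)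
    have "(\<Prod>b\<in>Basis. (u - l) \<bullet> b) = (\<Prod>i\<in>UNIV. (u - l) $ i)"
      unfolding B by (subst prod.reindex) (auto simp: inj_on_def axis_eq_axis inner_axis)
    also have "\<dots> = (u $ 1 - l $ 1) * (u $ 2 - l $ 2)" by (simp add: UNIV_2)
    finally show ?thesis using lu by (simp add: ennreal_mult)
  qed
  finally show "emeasure (distr (lborel \<Otimes>\<^sub>M lborel) borel plane_point) (box l u) = ennreal (\<Prod>b\<in>Basis. (u - l) \<bullet> b)" .
qed simp

lemma nn_integral_plane:
  assumes [measurable]: "f \<in> borel_measurable borel"
  shows "(\<integral>\<^sup>+x. f x \<partial>lborel) = (\<integral>\<^sup>+s. \<integral>\<^sup>+t. f (plane_point (s, t)) \<partial>lborel \<partial>lborel)"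
    and "(\<integral>\<^sup>+x. f x \<partial>lborel) = (\<integral>\<^sup>+t. \<integral>\<^sup>+s. f (plane_point (s, t)) \<partial>lborel \<partial>lborel)"
proof -
  have [measurable]: "plane_point \<in> (lborel \<Otimes>\<^sub>M lborel) \<rightarrow>\<^sub>M borel"
    by (simp add: lborel_prod)
  have *: "(\<integral>\<^sup>+x. f x \<partial>lborel) = (\<integral>\<^sup>+z. f (plane_point z) \<partial>(lborel \<Otimes>\<^sub>M lborel))"
    by (subst lborel_plane) (simp add: nn_integral_distr)
  show "(\<integral>\<^sup>+x. f x \<partial>lborel) = (\<integral>\<^sup>+s. \<integral>\<^sup>+t. f (plane_point (s, t)) \<partial>lborel \<partial>lborel)"
    unfolding * by (rule lborel.nn_integral_fst[symmetric]) measurable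
  show "(\<integral>\<^sup>+x. f x \<partial>lborel) = (\<integral>\<^sup>+t. \<integral>\<^sup>+s. f (plane_point (s, t)) \<partial>lborel \<partial>lborel)"
    unfolding * by (rule lborel_pair.nn_integral_snd[symmetric]) measurable
qed

text \<open>The integral along horizontal lines depends only on the second coordinate and the integral along
  vertical lines only on the first one, so the double integral of their product factorises.\<close>

lemma nn_integral_product_of_line_integrals:
  assumes [measurable]: "F \<in> borel_measurable borel" "H \<in> borel_measurable borel"
  shows "(\<integral>\<^sup>+x. (\<integral>\<^sup>+s. F (x + s *\<^sub>R axis 1 1) \<partial>lborel) * (\<integral>\<^sup>+s. H (x + s *\<^sub>R axis 2 1) \<partial>lborel) \<partial>lborel)
    = (\<integral>\<^sup>+x. F x \<partial>lborel) * (\<integral>\<^sup>+x. H x \<partial>(lborel :: (real^2) measure))"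
proof -
  have [measurable]: "plane_point \<in> (lborel \<Otimes>\<^sub>M lborel) \<rightarrow>\<^sub>M borel"
    by (simp add: lborel_prod)
  have F: "(\<integral>\<^sup>+s. F (plane_point (a + s, b)) \<partial>lborel) = (\<integral>\<^sup>+s. F (plane_point (s, b)) \<partial>lborel)" for a b
    using nn_integral_translate[of "\<lambda>s. F (plane_point (s, b))" a] by (simp add: add.commute)
  have H: "(\<integral>\<^sup>+s. H (plane_point (a, b + s)) \<partial>lborel) = (\<integral>\<^sup>+s. H (plane_point (a, s)) \<partial>lborel)" for a b
    using nn_integral_translate[of "\<lambda>s. H (plane_point (a, s))" b] by (simp add: add.commute)
  have "(\<integral>\<^sup>+x. (\<integral>\<^sup>+s. F (x + s *\<^sub>R axis 1 1) \<partial>lborel) * (\<integral>\<^sup>+s. H (x + s *\<^sub>R axis 2 1) \<partial>lborel) \<partial>lborel)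
    = (\<integral>\<^sup>+a. \<integral>\<^sup>+b. (\<integral>\<^sup>+s. F (plane_point (s, b)) \<partial>lborel) * (\<integral>\<^sup>+s. H (plane_point (a, s)) \<partial>lborel) \<partial>lborel \<partial>lborel)"
    by (subst nn_integral_plane(1)) (simp_all add: plane_point_add F H)
  also have "\<dots> = (\<integral>\<^sup>+a. (\<integral>\<^sup>+b. \<integral>\<^sup>+s. F (plane_point (s, b)) \<partial>lborel \<partial>lborel) * (\<integral>\<^sup>+s. H (plane_point (a, s)) \<partial>lborel) \<partial>lborel)"
    by (intro nn_integral_cong nn_integral_multc) measurable
  also have "\<dots> = (\<integral>\<^sup>+b. \<integral>\<^sup>+s. F (plane_point (s, b)) \<partial>lborel \<partial>lborel) * (\<integral>\<^sup>+a. \<integral>\<^sup>+s. H (plane_point (a, s)) \<partial>lborel \<partial>lborel)"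
    by (intro nn_integral_cmult) measurable
  finally show ?thesis by (simp add: nn_integral_plane(2)[of F] nn_integral_plane(1)[of H])
qed

text \<open>Ladyzhenskaya's argument: estimate one factor \<open>|u|\<^sup>2\<close> by the horizontal and the other one by the vertical
  line bound.\<close>

lemma quartic_bound:
  assumes u: "u \<in> L2" and g: "g \<in> L2" and wg: "is_weak_gradient u g" and L: "L > 0"
  shows "integrable lborel (\<lambda>x. (norm (u x)) ^ 4)"
    and "(\<integral>x. (norm (u x)) ^ 4 \<partial>lborel) \<le>
      (2 / L * (\<integral>x. (norm (u x))\<^sup>2 \<partial>lborel) + 2 * L * (\<integral>x. (norm (g x))\<^sup>2 \<partial>lborel))\<^sup>2"
proof -
  have [measurable]: "g \<in> borel_measurable borel" "u \<in> borel_measurable borel"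
    using g u by (auto intro: L2_measurable)
  define A where "A = 2 / L * (\<integral>x. (norm (u x))\<^sup>2 \<partial>lborel) + 2 * L * (\<integral>x. (norm (g x))\<^sup>2 \<partial>lborel)"
  have "A \<ge> 0" using L by (auto simp: A_def intro!: add_nonneg_nonneg)
  define F where "F i x = ennreal (2 / L * (norm (u x))\<^sup>2 + 2 * L * (norm (g x $ i))\<^sup>2)" for i x
  have [measurable]: "F i \<in> borel_measurable borel" for i unfolding F_def[abs_def] by measurable
  have FA: "(\<integral>\<^sup>+x. F i x \<partial>lborel) \<le> ennreal A" for i
  proof -
    have "(\<integral>\<^sup>+x. F i x \<partial>lborel) \<le> (\<integral>\<^sup>+x. ennreal (2 / L * (norm (u x))\<^sup>2 + 2 * L * (norm (g x))\<^sup>2) \<partial>lborel)"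
      unfolding F_def using L
      by (intro nn_integral_mono ennreal_leI add_left_mono mult_left_mono power_mono
          Finite_Cartesian_Product.norm_nth_le) auto
    also have "\<dots> = ennreal (\<integral>x. 2 / L * (norm (u x))\<^sup>2 + 2 * L * (norm (g x))\<^sup>2 \<partial>lborel)"
      using u g L by (intro nn_integral_eq_integral) (auto simp: L2_def)
    also have "\<dots> = ennreal A" using u g by (simp add: A_def L2_def)
    finally show ?thesis .
  qed
  have "(\<integral>\<^sup>+x. ennreal ((norm (u x)) ^ 4) \<partial>lborel) \<le>
    (\<integral>\<^sup>+x. (\<integral>\<^sup>+s. F 1 (x + s *\<^sub>R axis 1 1) \<partial>lborel) * (\<integral>\<^sup>+s. F 2 (x + s *\<^sub>R axis 2 1) \<partial>lborel) \<partial>lborel)"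
  proof (rule nn_integral_mono_AE, use line_bound[OF u g wg L, of 1] line_bound[OF u g wg L, of 2] in eventually_elim)
    case (elim x)
    have "ennreal ((norm (u x)) ^ 4) = ennreal ((norm (u x))\<^sup>2) * ennreal ((norm (u x))\<^sup>2)"
      by (simp add: ennreal_mult[symmetric] power_add[symmetric])
    also have "\<dots> \<le> (\<integral>\<^sup>+s. F 1 (x + s *\<^sub>R axis 1 1) \<partial>lborel) * (\<integral>\<^sup>+s. F 2 (x + s *\<^sub>R axis 2 1) \<partial>lborel)"
      using elim unfolding F_def by (rule mult_mono) auto
    finally show ?case .
  qed
  also have "\<dots> = (\<integral>\<^sup>+x. F 1 x \<partial>lborel) * (\<integral>\<^sup>+x. F 2 x \<partial>lborel)"
    by (rule nn_integral_product_of_line_integrals) measurable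
  also have "\<dots> \<le> ennreal A * ennreal A" by (intro mult_mono FA) auto
  also have "\<dots> = ennreal (A\<^sup>2)" using \<open>A \<ge> 0\<close> by (simp add: ennreal_mult[symmetric] power2_eq_square)
  finally have *: "(\<integral>\<^sup>+x. ennreal ((norm (u x)) ^ 4) \<partial>lborel) \<le> ennreal (A\<^sup>2)" .
  then show "integrable lborel (\<lambda>x. (norm (u x)) ^ 4)"
    by (intro integrableI_bounded) (auto intro: le_less_trans)
  show "(\<integral>x. (norm (u x)) ^ 4 \<partial>lborel) \<le>
      (2 / L * (\<integral>x. (norm (u x))\<^sup>2 \<partial>lborel) + 2 * L * (\<integral>x. (norm (g x))\<^sup>2 \<partial>lborel))\<^sup>2"
    unfolding A_def[symmetric] by (rule integral_real_bounded) (use * in auto)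
qed

text \<open>The choice \<open>L = D\<^sup>-\<^sup>1\<^sup>/\<^sup>2\<close> equalises the two terms of \<open>quartic_bound\<close>. If \<open>D = 0\<close>, large \<open>L\<close> show that
  the quartic integral vanishes.\<close>

lemma gagliardo_nirenberg:
  assumes u: "u \<in> L2" and g: "g \<in> L2" and wg: "is_weak_gradient u g"
    and one: "(\<integral>x. (norm (u x))\<^sup>2 \<partial>lborel) = 1"
  shows "(\<integral>x. (norm (u x)) ^ 4 \<partial>lborel) \<le> 16 * (\<integral>x. (norm (g x))\<^sup>2 \<partial>lborel)"
proof -
  define Q where "Q = (\<integral>x. (norm (u x)) ^ 4 \<partial>lborel)"
  define D where "D = (\<integral>x. (norm (g x))\<^sup>2 \<partial>lborel)"
  have "Q \<ge> 0" "D \<ge> 0" by (auto simp: Q_def D_def)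
  have b: "Q \<le> (2 / L + 2 * L * D)\<^sup>2" if "L > 0" for L
    using quartic_bound(2)[OF u g wg that] by (simp add: one Q_def D_def)
  have "Q \<le> 16 * D"
  proof (cases "D = 0")
    case False
    then have "D > 0" using \<open>D \<ge> 0\<close> by simp
    then have "2 / (1 / sqrt D) + 2 * (1 / sqrt D) * D = 4 * sqrt D"
      by (simp add: field_simps)
    then show ?thesis using b[of "1 / sqrt D"] \<open>D > 0\<close> by (simp add: power_mult_distrib)
  next
    case True
    show ?thesis
    proof (rule ccontr)
      assume "\<not> Q \<le> 16 * D"
      then have "Q > 0" using True by simp
      then have "Q \<le> (sqrt Q / 2)\<^sup>2" using b[of "4 / sqrt Q"] True by simp
      then show False using \<open>Q > 0\<close> by (simp add: power_divide)
    qed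
  qed
  then show ?thesis by (simp add: Q_def D_def)
qed

section \<open>A Hardy-type inequality for the singular potential\<close>

lemma derivative_along_line:
  fixes F F' :: "'a::real_normed_vector \<Rightarrow> real"
  assumes "\<And>x. ((\<lambda>t. F (x + t *\<^sub>R e)) has_real_derivative F' x) (at 0)"
  shows "((\<lambda>t. F (x + t *\<^sub>R e)) has_real_derivative F' (x + t *\<^sub>R e)) (at t)"
proof -
  have "((\<lambda>r. F (x + (r + t) *\<^sub>R e)) has_real_derivative F' (x + t *\<^sub>R e)) (at 0)"
    using assms[of "x + t *\<^sub>R e"] by (simp add: algebra_simps)
  then show ?thesis
    using DERIV_shift[of "\<lambda>r. F (x + r *\<^sub>R e)" "F' (x + t *\<^sub>R e)" 0 t] by simp
qed

text \<open>Formally, \<open>\<integral> \<partial>\<^sub>i\<psi> |u|\<^sup>2 = - \<integral> \<psi> \<partial>\<^sub>i|u|\<^sup>2 \<le> 2 \<integral> |\<psi> u| |\<partial>\<^sub>i u|\<close>, followed by Young's inequality. With a difference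
  quotient in place of \<open>\<partial>\<^sub>i\<psi>\<close>, integration by parts is a translation of the integration variable, and
  a product rule for weak derivatives is replaced by
  \<open>|v|\<^sup>2 - |u|\<^sup>2 \<le> |v - u| (|v| + |u|)\<close> and \<open>translation_L2_bound\<close>.\<close>

lemma weight_derivative_bound:
  fixes \<psi> \<psi>' :: "real^2 \<Rightarrow> real"
  assumes u: "u \<in> L2" and g: "g \<in> L2" and wg: "is_weak_gradient u g" and \<kappa>: "\<kappa> > 0"
    and [measurable]: "\<psi> \<in> borel_measurable borel" "\<psi>' \<in> borel_measurable borel"
    and B: "\<And>x. \<bar>\<psi> x\<bar> \<le> B" and K: "\<And>x. \<bar>\<psi>' x\<bar> \<le> K"
    and deriv: "\<And>x. ((\<lambda>t. \<psi> (x + t *\<^sub>R axis i 1)) has_real_derivative \<psi>' x) (at 0)"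
  shows "(\<integral>x. \<psi>' x * (norm (u x))\<^sup>2 \<partial>lborel) \<le>
    \<kappa> * (\<integral>x. (norm (g x $ i))\<^sup>2 \<partial>lborel) + 1 / \<kappa> * (\<integral>x. (\<psi> x)\<^sup>2 * (norm (u x))\<^sup>2 \<partial>lborel)"
proof -
  define e :: "real^2" where "e = axis i 1"
  define h where "h n = 1 / real (Suc n)" for n
  have h: "h n > 0" for n by (simp add: h_def)
  have h0: "h \<longlonglongrightarrow> 0" unfolding h_def by (rule LIMSEQ_Suc[OF lim_1_over_n])
  have [measurable]: "g \<in> borel_measurable borel" "u \<in> borel_measurable borel"
    using g u by (auto intro: L2_measurable)
  have iu: "integrable lborel (\<lambda>x. (norm (u x))\<^sup>2)" using u by (simp add: L2_def)
  define U where "U x = (norm (u x))\<^sup>2" for x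
  have [measurable]: "U \<in> borel_measurable borel" unfolding U_def[abs_def] by measurable
  have "B \<ge> 0" using B[of 0] by linarith
  have "K \<ge> 0" using K[of 0] by linarith
  have iU: "integrable lborel U" using iu by (simp add: U_def[abs_def])
  note iw = integrable_bounded_mult[OF iU]
  note deriv_line = derivative_along_line[OF deriv, folded e_def]
  have lip: "\<bar>\<psi> x - \<psi> (x - h n *\<^sub>R e)\<bar> \<le> K * h n" for x n
  proof -
    obtain z where z: "\<psi> (x + 0 *\<^sub>R e) - \<psi> (x + (- h n) *\<^sub>R e) = (0 - (- h n)) * \<psi>' (x + z *\<^sub>R e)"
      using MVT2[of "- h n" 0 "\<lambda>t. \<psi> (x + t *\<^sub>R e)" "\<lambda>t. \<psi>' (x + t *\<^sub>R e)"] deriv_line h[of n] by auto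
    then show ?thesis using K[of "x + z *\<^sub>R e"] h[of n] by (simp add: abs_mult mult.commute)
  qed
  have shift: "(\<lambda>n. \<psi> (x - h n *\<^sub>R e)) \<longlonglongrightarrow> \<psi> x" for x
  proof -
    have "isCont (\<lambda>t. \<psi> (x + t *\<^sub>R e)) 0" using deriv_line[of x 0] by (rule DERIV_isCont)
    moreover have "(\<lambda>n. - h n) \<longlonglongrightarrow> 0" using tendsto_minus[OF h0] by simp
    ultimately have "(\<lambda>n. \<psi> (x + (- h n) *\<^sub>R e)) \<longlonglongrightarrow> \<psi> (x + 0 *\<^sub>R e)"
      by (rule isCont_tendsto_compose)
    then show ?thesis by simp
  qed
  have quot: "(\<lambda>n. (\<psi> x - \<psi> (x - h n *\<^sub>R e)) / h n) \<longlonglongrightarrow> \<psi>' x" for x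
  proof -
    have "((\<lambda>t. (\<psi> (x + t *\<^sub>R e) - \<psi> x) / t) \<longlongrightarrow> \<psi>' x) (at 0)"
      using deriv_line[of x 0] by (simp add: has_field_derivative_iff)
    moreover have "filterlim (\<lambda>n. - h n) (at 0) sequentially"
      using tendsto_minus[OF h0] h by (auto simp: filterlim_at intro!: always_eventually) (metis less_irrefl)
    ultimately have "(\<lambda>n. (\<psi> (x + (- h n) *\<^sub>R e) - \<psi> x) / (- h n)) \<longlonglongrightarrow> \<psi>' x"
      by (rule filterlim_compose)
    moreover have "(\<psi> (x + (- h n) *\<^sub>R e) - \<psi> x) / (- h n) = (\<psi> x - \<psi> (x - h n *\<^sub>R e)) / h n" for n
      using h[of n] by (simp add: field_simps)
    ultimately show ?thesis by simp
  qed
  have limI: "(\<lambda>n. \<integral>x. (\<psi> x - \<psi> (x - h n *\<^sub>R e)) / h n * U x \<partial>lborel) \<longlonglongrightarrow> (\<integral>x. \<psi>' x * U x \<partial>lborel)"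
  proof (rule integral_dominated_convergence[where w="\<lambda>x. K * U x"])
    show "integrable lborel (\<lambda>x. K * U x)" using iu by (simp add: U_def)
    show "AE x in lborel. (\<lambda>n. (\<psi> x - \<psi> (x - h n *\<^sub>R e)) / h n * U x) \<longlonglongrightarrow> \<psi>' x * U x"
      by (intro AE_I2 tendsto_mult_right quot)
    have "\<bar>(\<psi> x - \<psi> (x - h n *\<^sub>R e)) / h n\<bar> \<le> K" for x n
      using lip[of x n] h[of n] by (simp add: field_simps)
    then show "AE x in lborel. norm ((\<psi> x - \<psi> (x - h n *\<^sub>R e)) / h n * U x) \<le> K * U x" for n
      using \<open>K \<ge> 0\<close>
      by (intro AE_I2, simp only: real_norm_def abs_mult, intro mult_mono) (auto simp: U_def)
  qed measurable
  have limJ: "(\<lambda>n. \<integral>x. (\<psi> (x - h n *\<^sub>R e))\<^sup>2 * U x \<partial>lborel) \<longlonglongrightarrow> (\<integral>x. (\<psi> x)\<^sup>2 * U x \<partial>lborel)"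
  proof (rule integral_dominated_convergence[where w="\<lambda>x. B\<^sup>2 * U x"])
    show "integrable lborel (\<lambda>x. B\<^sup>2 * U x)" using iu by (simp add: U_def)
    show "AE x in lborel. (\<lambda>n. (\<psi> (x - h n *\<^sub>R e))\<^sup>2 * U x) \<longlonglongrightarrow> (\<psi> x)\<^sup>2 * U x"
      by (intro AE_I2 tendsto_mult_right tendsto_power shift)
    have "(\<psi> x)\<^sup>2 \<le> B\<^sup>2" for x using B[of x] \<open>B \<ge> 0\<close> by (simp add: abs_le_square_iff[symmetric])
    then show "AE x in lborel. norm ((\<psi> (x - h n *\<^sub>R e))\<^sup>2 * U x) \<le> B\<^sup>2 * U x" for n
      by (intro AE_I2) (simp add: abs_mult U_def mult_right_mono)
  qed measurable
  define G where "G = (\<integral>x. (norm (g x $ i))\<^sup>2 \<partial>lborel)"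
  define J where "J = (\<integral>x. (\<psi> x)\<^sup>2 * U x \<partial>lborel)"
  have step: "(\<integral>x. (\<psi> x - \<psi> (x - h n *\<^sub>R e)) / h n * U x \<partial>lborel) \<le>
    \<kappa> * G + 1 / (2 * \<kappa>) * ((\<integral>x. (\<psi> (x - h n *\<^sub>R e))\<^sup>2 * U x \<partial>lborel) + J)" for n
  proof -
    define t where "t = h n"
    have t: "t > 0" using h by (simp add: t_def)
    define v where "v x = u (x + t *\<^sub>R e)" for x
    have [measurable]: "v \<in> borel_measurable borel" unfolding v_def[abs_def] by measurable
    have b2: "\<bar>(\<psi> x)\<^sup>2\<bar> \<le> B\<^sup>2" for x using B[of x] \<open>B \<ge> 0\<close> by (simp add: abs_le_square_iff[symmetric])
    have i1: "integrable lborel (\<lambda>x. \<psi> x * U x)" by (rule iw[OF _ B]) measurable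
    have i2: "integrable lborel (\<lambda>x. \<psi> (x - t *\<^sub>R e) * U x)" by (rule iw[OF _ B]) measurable
    have i3: "integrable lborel (\<lambda>x. \<psi> x * U (x + t *\<^sub>R e))"
      using integrable_translate[OF i2, of "t *\<^sub>R e"] by simp
    have i4: "integrable lborel (\<lambda>x. (\<psi> x)\<^sup>2 * U x)" by (rule iw[OF _ b2]) measurable
    have i5: "integrable lborel (\<lambda>x. (\<psi> (x - t *\<^sub>R e))\<^sup>2 * U x)" by (rule iw[OF _ b2]) measurable
    have i6: "integrable lborel (\<lambda>x. (\<psi> x)\<^sup>2 * U (x + t *\<^sub>R e))"
      using integrable_translate[OF i5, of "t *\<^sub>R e"] by simp
    have i7: "integrable lborel (\<lambda>x. (norm (v x - u x))\<^sup>2)"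
      and v7: "(\<integral>x. (norm (v x - u x))\<^sup>2 \<partial>lborel) \<le> t\<^sup>2 * G"
      using translation_L2_bound[OF u g wg, of t i] t by (auto simp: v_def e_def G_def)
    have "(\<integral>x. (\<psi> x - \<psi> (x - t *\<^sub>R e)) / t * U x \<partial>lborel)
      = ((\<integral>x. \<psi> x * U x \<partial>lborel) - (\<integral>x. \<psi> (x - t *\<^sub>R e) * U x \<partial>lborel)) / t"
      using i1 i2 by (simp add: left_diff_distrib)
    also have "(\<integral>x. \<psi> (x - t *\<^sub>R e) * U x \<partial>lborel) = (\<integral>x. \<psi> x * U (x + t *\<^sub>R e) \<partial>lborel)"
      using integral_translate[of "\<lambda>x. \<psi> (x - t *\<^sub>R e) * U x" "t *\<^sub>R e"] by simp
    also have "((\<integral>x. \<psi> x * U x \<partial>lborel) - (\<integral>x. \<psi> x * U (x + t *\<^sub>R e) \<partial>lborel)) / t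
      = (\<integral>x. (\<psi> x * U x - \<psi> x * U (x + t *\<^sub>R e)) / t \<partial>lborel)"
      using i1 i3 by simp
    also have "\<dots> \<le> (\<integral>x. \<kappa> / t\<^sup>2 * (norm (v x - u x))\<^sup>2 + 1 / (2 * \<kappa>) * ((\<psi> x)\<^sup>2 * U (x + t *\<^sub>R e) + (\<psi> x)\<^sup>2 * U x) \<partial>lborel)"
    proof (rule integral_mono)
      show "integrable lborel (\<lambda>x. (\<psi> x * U x - \<psi> x * U (x + t *\<^sub>R e)) / t)" using i1 i3 by simp
      show "integrable lborel (\<lambda>x. \<kappa> / t\<^sup>2 * (norm (v x - u x))\<^sup>2 + 1 / (2 * \<kappa>) * ((\<psi> x)\<^sup>2 * U (x + t *\<^sub>R e) + (\<psi> x)\<^sup>2 * U x))"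
        using i4 i6 i7 by simp
      fix x
      define a where "a = norm (u x)"
      define b where "b = norm (v x)"
      define d where "d = norm (v x - u x) / t"
      have d: "\<bar>a - b\<bar> \<le> t * d"
        using t norm_triangle_ineq3[of "v x" "u x"] by (simp add: a_def b_def d_def abs_minus_commute)
      have "(\<psi> x * a\<^sup>2 - \<psi> x * b\<^sup>2) / t = \<psi> x * (a + b) * ((a - b) / t)"
        by (simp add: power2_eq_square algebra_simps diff_divide_distrib)
      also have "\<dots> \<le> \<bar>\<psi> x * (a + b)\<bar> * \<bar>(a - b) / t\<bar>"
        by (metis abs_ge_self abs_mult)
      also have "\<dots> \<le> \<bar>\<psi> x * (a + b)\<bar> * d"
        using d t by (intro mult_left_mono) (auto simp: field_simps)
      also have "\<dots> \<le> \<kappa> * d\<^sup>2 + 1 / (4 * \<kappa>) * (\<psi> x * (a + b))\<^sup>2"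
      proof -
        have "0 \<le> (2 * \<kappa> * d - \<bar>\<psi> x * (a + b)\<bar>)\<^sup>2" by simp
        then have "4 * \<kappa> * (\<bar>\<psi> x * (a + b)\<bar> * d) \<le> 4 * \<kappa> * (\<kappa> * d\<^sup>2) + (\<psi> x * (a + b))\<^sup>2"
          by (simp add: power2_diff power_mult_distrib algebra_simps power2_eq_square)
        then show ?thesis using \<kappa> by (simp add: field_simps)
      qed
      also have "1 / (4 * \<kappa>) * (\<psi> x * (a + b))\<^sup>2 \<le> 1 / (2 * \<kappa>) * ((\<psi> x)\<^sup>2 * b\<^sup>2 + (\<psi> x)\<^sup>2 * a\<^sup>2)"
      proof -
        have "(a + b)\<^sup>2 \<le> 2 * (b\<^sup>2 + a\<^sup>2)"
          using zero_le_power2[of "a - b"] by (simp add: power2_eq_square algebra_simps)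
        then have "(\<psi> x)\<^sup>2 * (a + b)\<^sup>2 \<le> (\<psi> x)\<^sup>2 * (2 * (b\<^sup>2 + a\<^sup>2))" by (rule mult_left_mono) simp
        then have "1 / (4 * \<kappa>) * (\<psi> x * (a + b))\<^sup>2 \<le> 1 / (4 * \<kappa>) * ((\<psi> x)\<^sup>2 * (2 * (b\<^sup>2 + a\<^sup>2)))"
          using \<kappa> by (intro mult_left_mono) (auto simp: power_mult_distrib)
        then show ?thesis by (simp add: algebra_simps)
      qed
      finally show "(\<psi> x * U x - \<psi> x * U (x + t *\<^sub>R e)) / t \<le>
          \<kappa> / t\<^sup>2 * (norm (v x - u x))\<^sup>2 + 1 / (2 * \<kappa>) * ((\<psi> x)\<^sup>2 * U (x + t *\<^sub>R e) + (\<psi> x)\<^sup>2 * U x)"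
        by (simp add: a_def b_def d_def v_def U_def power_divide)
    qed
    also have "\<dots> = \<kappa> / t\<^sup>2 * (\<integral>x. (norm (v x - u x))\<^sup>2 \<partial>lborel) + 1 / (2 * \<kappa>) * ((\<integral>x. (\<psi> x)\<^sup>2 * U (x + t *\<^sub>R e) \<partial>lborel) + J)"
      using i4 i6 i7 by (simp add: J_def)
    also have "(\<integral>x. (\<psi> x)\<^sup>2 * U (x + t *\<^sub>R e) \<partial>lborel) = (\<integral>x. (\<psi> (x - t *\<^sub>R e))\<^sup>2 * U x \<partial>lborel)"
      using integral_translate[of "\<lambda>x. (\<psi> (x - t *\<^sub>R e))\<^sup>2 * U x" "t *\<^sub>R e"] by simp
    also have "\<kappa> / t\<^sup>2 * (\<integral>x. (norm (v x - u x))\<^sup>2 \<partial>lborel) \<le> \<kappa> / t\<^sup>2 * (t\<^sup>2 * G)"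
      using v7 \<kappa> by (intro mult_left_mono) auto
    also have "\<kappa> / t\<^sup>2 * (t\<^sup>2 * G) = \<kappa> * G" using t by simp
    finally show ?thesis by (simp add: t_def)
  qed
  have "(\<integral>x. \<psi>' x * U x \<partial>lborel) \<le> \<kappa> * G + 1 / (2 * \<kappa>) * (J + J)"
  proof (rule LIMSEQ_le[OF limI])
    show "(\<lambda>n. \<kappa> * G + 1 / (2 * \<kappa>) * ((\<integral>x. (\<psi> (x - h n *\<^sub>R e))\<^sup>2 * U x \<partial>lborel) + J))
        \<longlonglongrightarrow> \<kappa> * G + 1 / (2 * \<kappa>) * (J + J)"
      using limJ unfolding J_def by (intro tendsto_intros)
    show "\<exists>N. \<forall>n\<ge>N. (\<integral>x. (\<psi> x - \<psi> (x - h n *\<^sub>R e)) / h n * U x \<partial>lborel) \<le>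
        \<kappa> * G + 1 / (2 * \<kappa>) * ((\<integral>x. (\<psi> (x - h n *\<^sub>R e))\<^sup>2 * U x \<partial>lborel) + J)"
      using step by blast
  qed
  then show ?thesis by (simp add: G_def J_def U_def)
qed

lemma radial_field_deriv:
  fixes x :: "real^2"
  assumes \<eta>: "\<eta> > 0"
  shows "((\<lambda>t. (x + t *\<^sub>R axis i 1) $ i * ((norm (x + t *\<^sub>R axis i 1))\<^sup>2 + \<eta>) powr (- r)) has_real_derivative
    ((norm x)\<^sup>2 + \<eta>) powr (- r) - 2 * r * (x $ i)\<^sup>2 * ((norm x)\<^sup>2 + \<eta>) powr (- r - 1)) (at 0)"
proof -
  have *: "(norm (x + t *\<^sub>R axis i 1))\<^sup>2 = (norm x)\<^sup>2 + 2 * t * x $ i + t\<^sup>2" for t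
    unfolding power2_norm_eq_inner
    by (simp add: inner_add_left inner_add_right inner_axis inner_commute[of "axis i 1"] power2_eq_square algebra_simps)
  have "(norm x)\<^sup>2 + \<eta> > 0" using \<eta> by (simp add: add_nonneg_pos)
  then have "((\<lambda>t. (x $ i + t) * ((norm x)\<^sup>2 + 2 * t * x $ i + t\<^sup>2 + \<eta>) powr (- r)) has_real_derivative
    ((norm x)\<^sup>2 + \<eta>) powr (- r) - 2 * r * (x $ i)\<^sup>2 * ((norm x)\<^sup>2 + \<eta>) powr (- r - 1)) (at 0)"
    by (auto intro!: derivative_eq_intros simp: power2_eq_square powr_diff)
  then show ?thesis unfolding * by simp
qed

text \<open>Since \<open>r < 1\<close>, the power \<open>N\<^sup>1\<^sup>-\<^sup>2\<^sup>r\<close> is less singular at \<open>0\<close> than \<open>N\<^sup>-\<^sup>r\<close>; the two cases are small and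
  large \<open>N\<close>.\<close>

lemma powr_interpolation:
  fixes N r \<delta> :: real
  assumes r: "1/2 \<le> r" "r < 1" and \<delta>: "\<delta> > 0" and N: "N > 0"
  shows "N powr (1 - 2 * r) \<le> \<delta> * N powr (- r) + \<delta> powr ((2 * r - 1) / (r - 1))"
proof (cases "N powr (1 - r) \<le> \<delta>")
  case True
  have "N powr (1 - 2 * r) = N powr (1 - r) * N powr (- r)" by (simp add: powr_add[symmetric])
  also have "\<dots> \<le> \<delta> * N powr (- r)" using True by (intro mult_right_mono) auto
  also have "\<dots> \<le> \<delta> * N powr (- r) + \<delta> powr ((2 * r - 1) / (r - 1))" by simp
  finally show ?thesis .
next
  case False
  have "N powr (1 - 2 * r) = (N powr (1 - r)) powr ((2 * r - 1) / (r - 1))"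
  proof -
    have "(1 - r) * ((2 * r - 1) / (r - 1)) = 1 - 2 * r" using r by (simp add: divide_simps) (simp add: algebra_simps)
    then show ?thesis by (simp add: powr_powr)
  qed
  also have "\<dots> \<le> \<delta> powr ((2 * r - 1) / (r - 1))"
    using False \<delta> r by (intro powr_mono2') (auto simp: divide_nonneg_neg)
  also have "\<dots> \<le> \<delta> * N powr (- r) + \<delta> powr ((2 * r - 1) / (r - 1))" using \<delta> by simp
  finally show ?thesis .
qed

text \<open>With \<open>N = |x|\<^sup>2 + \<eta>\<close>, the vector field \<open>\<psi> = x N\<^sup>-\<^sup>r\<close> has divergence at least \<open>(2 - 2 r) N\<^sup>-\<^sup>r\<close> and satisfies
  \<open>|\<psi>|\<^sup>2 \<le> N\<^sup>1\<^sup>-\<^sup>2\<^sup>r\<close>. So \<open>weight_derivative_bound\<close> controls the integral of \<open>N\<^sup>-\<^sup>r |u|\<^sup>2\<close> by a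
  less singular one, which is absorbed by \<open>powr_interpolation\<close>. The regularisation \<open>\<eta>\<close> makes \<open>\<psi>\<close>
  Lipschitz and makes the integrals finite, as the absorption requires; \<open>2 r \<ge> 1\<close> makes \<open>\<psi>\<close> bounded. The
  constant does not depend on \<open>\<eta>\<close>.\<close>

lemma regularised_hardy:
  assumes r: "1/2 \<le> r" "r < 1" and \<epsilon>: "\<epsilon> > 0"
  shows "\<exists>C. \<forall>u g \<eta>. u \<in> L2 \<longrightarrow> g \<in> L2 \<longrightarrow> is_weak_gradient u g \<longrightarrow> (\<integral>x. (norm (u x))\<^sup>2 \<partial>lborel) = 1 \<longrightarrow> \<eta> > 0 \<longrightarrow>
    integrable lborel (\<lambda>x. ((norm x)\<^sup>2 + \<eta>) powr (- r) * (norm (u x))\<^sup>2) \<and>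
    (\<integral>x. ((norm x)\<^sup>2 + \<eta>) powr (- r) * (norm (u x))\<^sup>2 \<partial>lborel) \<le> \<epsilon> * (\<integral>x. (norm (g x))\<^sup>2 \<partial>lborel) + C"
proof -
  \<comment> \<open>With the interpolation parameter \<open>\<kappa> (1 - r)\<close>, half of the left-hand side \<open>(2 - 2 r) P\<close> is absorbed and
      \<open>(1 - r) P \<le> \<kappa> D + C0 / \<kappa>\<close> remains.\<close>
  define \<kappa> where "\<kappa> = \<epsilon> * (1 - r)"
  have \<kappa>: "\<kappa> > 0" using r \<epsilon> by (simp add: \<kappa>_def)
  define C0 where "C0 = (\<kappa> * (1 - r)) powr ((2 * r - 1) / (r - 1))"
  define C where "C = C0 / (\<kappa> * (1 - r))"
  show ?thesis
  proof (intro exI[of _ C] allI impI, goal_cases)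
    case (1 u g \<eta>)
    then have u: "u \<in> L2" and g: "g \<in> L2" and wg: "is_weak_gradient u g"
      and one: "(\<integral>x. (norm (u x))\<^sup>2 \<partial>lborel) = 1" and \<eta>: "\<eta> > 0" by auto
    have [measurable]: "u \<in> borel_measurable borel" "g \<in> borel_measurable borel"
      using u g by (auto intro: L2_measurable)
    define N where "N x = (norm x)\<^sup>2 + \<eta>" for x :: "real^2"
    have N\<eta>: "N x \<ge> \<eta>" for x by (simp add: N_def)
    then have N: "N x > 0" for x using \<eta> by (rule less_le_trans[rotated])
    have xN: "(x $ i)\<^sup>2 \<le> N x" for x i
    proof -
      have "(x $ i)\<^sup>2 \<le> (norm x)\<^sup>2" using component_le_norm_cart[of x i] by (simp add: abs_le_square_iff[symmetric])
      then show ?thesis using \<eta> by (simp add: N_def)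
    qed
    have [measurable]: "N \<in> borel_measurable borel" unfolding N_def[abs_def] by measurable
    define \<psi> where "\<psi> i x = x $ i * N x powr (- r)" for i :: 2 and x
    define \<psi>' where "\<psi>' i x = N x powr (- r) - 2 * r * (x $ i)\<^sup>2 * N x powr (- r - 1)" for i :: 2 and x
    have comp [measurable]: "(\<lambda>x::real^2. x $ i) \<in> borel_measurable borel" for i
      by (intro borel_measurable_continuous_onI continuous_intros)
    have m [measurable]: "\<psi> i \<in> borel_measurable borel" "\<psi>' i \<in> borel_measurable borel" for i
      unfolding \<psi>_def[abs_def] \<psi>'_def[abs_def] by measurable
    have weight: "N x powr (- r) \<le> \<eta> powr (- r)" for x
      using N\<eta>[of x] \<eta> r by (intro powr_mono2') auto
    have \<psi>2: "(\<psi> i x)\<^sup>2 = (x $ i)\<^sup>2 * N x powr (- 2 * r)" for i x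
    proof -
      have "(N x powr (- r))\<^sup>2 = N x powr (- 2 * r)"
        by (simp add: power2_eq_square powr_add[symmetric])
      then show ?thesis by (simp add: \<psi>_def power_mult_distrib)
    qed
    have NN: "N x * N x powr (- 2 * r) = N x powr (1 - 2 * r)" for x
      using powr_add[of "N x" 1 "- 2 * r"] N[of x] by simp
    have NN': "N x * N x powr (- r - 1) = N x powr (- r)" for x
      using powr_add[of "N x" 1 "- r - 1"] N[of x] by simp
    have B: "\<bar>\<psi> i x\<bar> \<le> sqrt (\<eta> powr (1 - 2 * r))" for i x
    proof -
      have "(\<psi> i x)\<^sup>2 \<le> N x * N x powr (- 2 * r)" unfolding \<psi>2 by (intro mult_right_mono xN) auto
      also have "\<dots> \<le> \<eta> powr (1 - 2 * r)" unfolding NN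
        using N\<eta>[of x] \<eta> r by (intro powr_mono2') auto
      finally show ?thesis using real_sqrt_le_mono real_sqrt_abs by metis
    qed
    have K: "\<bar>\<psi>' i x\<bar> \<le> (1 + 2 * r) * \<eta> powr (- r)" for i x
    proof -
      have "(x $ i)\<^sup>2 * N x powr (- r - 1) \<le> N x * N x powr (- r - 1)"
        by (intro mult_right_mono xN) auto
      then have "2 * r * ((x $ i)\<^sup>2 * N x powr (- r - 1)) \<le> 2 * r * N x powr (- r)"
        unfolding NN' using r by (intro mult_left_mono) auto
      moreover have "0 \<le> 2 * r * ((x $ i)\<^sup>2 * N x powr (- r - 1))" using r by simp
      moreover have "0 \<le> N x powr (- r)" "0 \<le> 2 * r * N x powr (- r)" using r by simp_all
      moreover have "(1 + 2 * r) * N x powr (- r) = N x powr (- r) + 2 * r * N x powr (- r)"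
        by (simp add: distrib_right)
      moreover have "\<psi>' i x = N x powr (- r) - 2 * r * ((x $ i)\<^sup>2 * N x powr (- r - 1))"
        by (simp add: \<psi>'_def)
      ultimately have "\<bar>\<psi>' i x\<bar> \<le> (1 + 2 * r) * N x powr (- r)" unfolding abs_le_iff by linarith
      also have "\<dots> \<le> (1 + 2 * r) * \<eta> powr (- r)"
        using weight r by (intro mult_left_mono) auto
      finally show ?thesis .
    qed
    have deriv: "((\<lambda>t. \<psi> i (x + t *\<^sub>R axis i 1)) has_real_derivative \<psi>' i x) (at 0)" for i x
      unfolding \<psi>_def \<psi>'_def N_def by (rule radial_field_deriv[OF \<eta>])
    define U where "U x = (norm (u x))\<^sup>2" for x
    have [measurable]: "U \<in> borel_measurable borel" unfolding U_def[abs_def] by measurable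
    have iU: "integrable lborel U" using u by (simp add: U_def[abs_def] L2_def)
    have U0: "U x \<ge> 0" for x by (simp add: U_def)
    note iw = integrable_bounded_mult[OF iU]
    have iN: "integrable lborel (\<lambda>x. N x powr (- r) * U x)"
      by (rule iw[of _ "\<eta> powr (- r)"]) (use weight in auto)
    have i\<psi>': "integrable lborel (\<lambda>x. \<psi>' i x * U x)" for i by (rule iw[OF _ K]) measurable
    have i\<psi>: "integrable lborel (\<lambda>x. (\<psi> i x)\<^sup>2 * U x)" for i
    proof (rule iw)
      show "\<bar>(\<psi> i x)\<^sup>2\<bar> \<le> (sqrt (\<eta> powr (1 - 2 * r)))\<^sup>2" for x
        using power_mono[OF B[of i x], of 2] by simp
    qed measurable
    define P where "P = (\<integral>x. N x powr (- r) * U x \<partial>lborel)"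
    define G where "G i = (\<integral>x. (norm (g x $ i))\<^sup>2 \<partial>lborel)" for i
    define D where "D = (\<integral>x. (norm (g x))\<^sup>2 \<partial>lborel)"
    have sum2: "(norm y)\<^sup>2 = (norm (y $ 1))\<^sup>2 + (norm (y $ 2))\<^sup>2" for y :: "complex^2"
      by (simp add: norm_vec_def L2_set_def sum_2)
    have sum2': "(norm y)\<^sup>2 = (y $ 1)\<^sup>2 + (y $ 2)\<^sup>2" for y :: "real^2"
      by (simp add: norm_vec_def L2_set_def sum_2)
    have GD: "G 1 + G 2 = D"
    proof -
      have "integrable lborel (\<lambda>x. (norm (g x $ i))\<^sup>2)" for i
        using L2_component[OF g, of i] by (simp add: L2_def)
      then show ?thesis unfolding G_def D_def sum2 by simp
    qed
    have "(2 - 2 * r) * P = (\<integral>x. (2 - 2 * r) * (N x powr (- r) * U x) \<partial>lborel)" by (simp add: P_def)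
    also have "\<dots> \<le> (\<integral>x. \<psi>' 1 x * U x + \<psi>' 2 x * U x \<partial>lborel)"
    proof (rule integral_mono)
      fix x
      have "(norm x)\<^sup>2 * N x powr (- r - 1) \<le> N x powr (- r)"
        unfolding NN'[symmetric] by (rule mult_right_mono) (use \<eta> in \<open>auto simp: N_def\<close>)
      then have "2 * r * ((norm x)\<^sup>2 * N x powr (- r - 1)) \<le> 2 * r * N x powr (- r)"
        using r by (intro mult_left_mono) auto
      then have "(2 - 2 * r) * N x powr (- r) \<le> \<psi>' 1 x + \<psi>' 2 x"
        unfolding \<psi>'_def sum2' by (simp add: algebra_simps)
      then have "(2 - 2 * r) * N x powr (- r) * U x \<le> (\<psi>' 1 x + \<psi>' 2 x) * U x"
        using U0 by (rule mult_right_mono)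
      then show "(2 - 2 * r) * (N x powr (- r) * U x) \<le> \<psi>' 1 x * U x + \<psi>' 2 x * U x"
        by (simp add: algebra_simps)
    qed (use iN i\<psi>' in auto)
    also have "\<dots> = (\<integral>x. \<psi>' 1 x * U x \<partial>lborel) + (\<integral>x. \<psi>' 2 x * U x \<partial>lborel)" using i\<psi>' by simp
    also have "\<dots> \<le> (\<kappa> * G 1 + 1 / \<kappa> * (\<integral>x. (\<psi> 1 x)\<^sup>2 * U x \<partial>lborel)) + (\<kappa> * G 2 + 1 / \<kappa> * (\<integral>x. (\<psi> 2 x)\<^sup>2 * U x \<partial>lborel))"
      unfolding U_def G_def
      by (intro add_mono weight_derivative_bound[OF u g wg \<kappa> m B K deriv])
    also have "\<dots> = \<kappa> * D + 1 / \<kappa> * (\<integral>x. (\<psi> 1 x)\<^sup>2 * U x + (\<psi> 2 x)\<^sup>2 * U x \<partial>lborel)"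
      using i\<psi> by (simp add: GD[symmetric] algebra_simps)
    also have "(\<integral>x. (\<psi> 1 x)\<^sup>2 * U x + (\<psi> 2 x)\<^sup>2 * U x \<partial>lborel) \<le>
        (\<integral>x. \<kappa> * (1 - r) * (N x powr (- r) * U x) + C0 * U x \<partial>lborel)"
    proof (rule integral_mono)
      fix x
      have "(\<psi> 1 x)\<^sup>2 + (\<psi> 2 x)\<^sup>2 = (norm x)\<^sup>2 * N x powr (- 2 * r)"
        unfolding \<psi>2 sum2' by (simp add: algebra_simps)
      also have "\<dots> \<le> N x powr (1 - 2 * r)"
        unfolding NN[symmetric] by (rule mult_right_mono) (use \<eta> in \<open>auto simp: N_def\<close>)
      also have "\<dots> \<le> \<kappa> * (1 - r) * N x powr (- r) + C0"
        unfolding C0_def using r \<kappa> N by (intro powr_interpolation) auto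
      finally have "((\<psi> 1 x)\<^sup>2 + (\<psi> 2 x)\<^sup>2) * U x \<le> (\<kappa> * (1 - r) * N x powr (- r) + C0) * U x"
        using U0 by (rule mult_right_mono)
      then show "(\<psi> 1 x)\<^sup>2 * U x + (\<psi> 2 x)\<^sup>2 * U x \<le> \<kappa> * (1 - r) * (N x powr (- r) * U x) + C0 * U x"
        by (simp add: algebra_simps)
    qed (use i\<psi> iN iU in auto)
    also have "\<dots> = \<kappa> * (1 - r) * P + C0"
    proof -
      have "(\<integral>x. U x \<partial>lborel) = 1" using one by (simp add: U_def)
      then show ?thesis using iN iU by (simp add: P_def)
    qed
    finally have "(2 - 2 * r) * P \<le> \<kappa> * D + 1 / \<kappa> * (\<kappa> * (1 - r) * P + C0)"
      using \<kappa> by (simp add: divide_right_mono)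
    moreover have "1 / \<kappa> * (\<kappa> * (1 - r) * P + C0) = (1 - r) * P + C0 / \<kappa>"
      using \<kappa> by (simp add: distrib_left)
    moreover have "(2 - 2 * r) * P = (1 - r) * P + (1 - r) * P" by (simp add: algebra_simps)
    moreover have "(1 - r) * (\<epsilon> * D + C) = \<kappa> * D + C0 / \<kappa>"
      using r \<kappa> by (simp add: distrib_left C_def \<kappa>_def mult.commute)
    ultimately have "(1 - r) * P \<le> (1 - r) * (\<epsilon> * D + C)" by linarith
    then have "P \<le> \<epsilon> * D + C" using r by simp
    then show ?case using iN by (simp add: P_def D_def N_def U_def)
  qed
qed

text \<open>Fatou's lemma removes the regularisation. The exponent is first raised to \<open>2 r = max p 1\<close>, using
  \<open>|x|\<^sup>-\<^sup>p \<le> 1 + |x|\<^sup>-\<^sup>2\<^sup>r\<close>. At the origin the weight is \<open>0 powr (- p) = 0\<close>.\<close>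

lemma hardy:
  assumes p: "0 < p" "p < 2" and \<epsilon>: "\<epsilon> > 0"
  shows "\<exists>C. \<forall>u g. u \<in> L2 \<longrightarrow> g \<in> L2 \<longrightarrow> is_weak_gradient u g \<longrightarrow> (\<integral>x. (norm (u x))\<^sup>2 \<partial>lborel) = 1 \<longrightarrow>
    (\<integral>x. norm x powr (- p) * (norm (u x))\<^sup>2 \<partial>lborel) \<le> \<epsilon> * (\<integral>x. (norm (g x))\<^sup>2 \<partial>lborel) + C"
proof -
  define r where "r = max p 1 / 2"
  have r: "1/2 \<le> r" "r < 1" "p \<le> 2 * r" using p by (auto simp: r_def)
  obtain C where C: "\<And>u g \<eta>. u \<in> L2 \<Longrightarrow> g \<in> L2 \<Longrightarrow> is_weak_gradient u g \<Longrightarrow> (\<integral>x. (norm (u x))\<^sup>2 \<partial>lborel) = 1 \<Longrightarrow> \<eta> > 0 \<Longrightarrow>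
    integrable lborel (\<lambda>x. ((norm x)\<^sup>2 + \<eta>) powr (- r) * (norm (u x))\<^sup>2) \<and>
    (\<integral>x. ((norm x)\<^sup>2 + \<eta>) powr (- r) * (norm (u x))\<^sup>2 \<partial>lborel) \<le> \<epsilon> * (\<integral>x. (norm (g x))\<^sup>2 \<partial>lborel) + C"
    using regularised_hardy[OF r(1,2) \<epsilon>] by blast
  show ?thesis
  proof (intro exI[of _ "1 + max 0 C"] allI impI)
    fix u :: "real^2 \<Rightarrow> complex" and g :: "real^2 \<Rightarrow> complex^2"
    assume u: "u \<in> L2" and g: "g \<in> L2" and wg: "is_weak_gradient u g"
      and one: "(\<integral>x. (norm (u x))\<^sup>2 \<partial>lborel) = 1"
    have [measurable]: "u \<in> borel_measurable borel" using u by (rule L2_measurable)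
    define D where "D = (\<integral>x. (norm (g x))\<^sup>2 \<partial>lborel)"
    have "D \<ge> 0" by (simp add: D_def)
    define \<eta> where "\<eta> n = 1 / real (Suc n)" for n
    have \<eta>: "\<eta> n > 0" for n by (simp add: \<eta>_def)
    have \<eta>0: "\<eta> \<longlonglongrightarrow> 0" unfolding \<eta>_def by (rule LIMSEQ_Suc[OF lim_1_over_n])
    define W where "W n x = ((norm x)\<^sup>2 + \<eta> n) powr (- r) * (norm (u x))\<^sup>2" for n x
    have [measurable]: "W n \<in> borel_measurable borel" for n unfolding W_def[abs_def] by measurable
    have bound: "(\<integral>\<^sup>+x. ennreal (W n x) \<partial>lborel) \<le> ennreal (\<epsilon> * D + max 0 C)" for n
    proof -
      have "integrable lborel (W n)" "(\<integral>x. W n x \<partial>lborel) \<le> \<epsilon> * D + C"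
        using C[OF u g wg one \<eta>[of n]] by (auto simp: W_def[abs_def] D_def)
      then have "integrable lborel (W n)" "(\<integral>x. W n x \<partial>lborel) \<le> \<epsilon> * D + max 0 C" by auto
      then show ?thesis
        by (subst nn_integral_eq_integral) (simp_all add: ennreal_leI, simp add: W_def)
    qed
    have "ennreal (norm x powr (- 2 * r) * (norm (u x))\<^sup>2) \<le> liminf (\<lambda>n. ennreal (W n x))" for x
    proof (cases "x = 0")
      case False
      have "(norm x powr 2) powr (- r) = norm x powr (- 2 * r)" by (simp only: powr_powr) simp
      then have "((norm x)\<^sup>2 + 0) powr (- r) = norm x powr (- 2 * r)" by simp
      moreover have "(\<lambda>n. W n x) \<longlonglongrightarrow> ((norm x)\<^sup>2 + 0) powr (- r) * (norm (u x))\<^sup>2"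
        unfolding W_def using False \<eta>0 by (intro tendsto_intros) auto
      ultimately have "(\<lambda>n. ennreal (W n x)) \<longlonglongrightarrow> ennreal (norm x powr (- 2 * r) * (norm (u x))\<^sup>2)"
        by (intro tendsto_ennrealI) simp
      then show ?thesis using lim_imp_Liminf[of sequentially] by fastforce
    qed simp
    then have "(\<integral>\<^sup>+x. ennreal (norm x powr (- 2 * r) * (norm (u x))\<^sup>2) \<partial>lborel) \<le> (\<integral>\<^sup>+x. liminf (\<lambda>n. ennreal (W n x)) \<partial>lborel)"
      by (rule nn_integral_mono)
    also have "\<dots> \<le> liminf (\<lambda>n. \<integral>\<^sup>+x. ennreal (W n x) \<partial>lborel)"
      by (rule nn_integral_liminf) measurable
    also have "\<dots> \<le> ennreal (\<epsilon> * D + max 0 C)"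
      using bound by (intro Liminf_le) auto
    finally have singular: "(\<integral>\<^sup>+x. ennreal (norm x powr (- 2 * r) * (norm (u x))\<^sup>2) \<partial>lborel) \<le> ennreal (\<epsilon> * D + max 0 C)" .
    have weight: "norm x powr (- p) \<le> 1 + norm x powr (- 2 * r)" for x :: "real^2"
    proof (cases "norm x < 1")
      case True
      then have "norm x powr (- p) \<le> norm x powr (- 2 * r)" using r p
        by (cases "x = 0") (auto intro!: powr_mono')
      then show ?thesis by simp
    next
      case False
      then have "norm x powr (- p) \<le> 1 powr (- p)" using p by (intro powr_mono2') auto
      then show ?thesis by (simp add: add_increasing2)
    qed
    have "(\<integral>\<^sup>+x. ennreal (norm x powr (- p) * (norm (u x))\<^sup>2) \<partial>lborel) \<le>
       (\<integral>\<^sup>+x. ennreal ((norm (u x))\<^sup>2) + ennreal (norm x powr (- 2 * r) * (norm (u x))\<^sup>2) \<partial>lborel)"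
    proof (rule nn_integral_mono)
      fix x
      have "norm x powr (- p) * (norm (u x))\<^sup>2 \<le> (norm (u x))\<^sup>2 + norm x powr (- 2 * r) * (norm (u x))\<^sup>2"
        using mult_right_mono[OF weight[of x], of "(norm (u x))\<^sup>2"] by (simp add: algebra_simps)
      then have "ennreal (norm x powr (- p) * (norm (u x))\<^sup>2) \<le> ennreal ((norm (u x))\<^sup>2 + norm x powr (- 2 * r) * (norm (u x))\<^sup>2)"
        by (rule ennreal_leI)
      then show "ennreal (norm x powr (- p) * (norm (u x))\<^sup>2) \<le> ennreal ((norm (u x))\<^sup>2) + ennreal (norm x powr (- 2 * r) * (norm (u x))\<^sup>2)"
        by simp
    qed
    also have "\<dots> = 1 + (\<integral>\<^sup>+x. ennreal (norm x powr (- 2 * r) * (norm (u x))\<^sup>2) \<partial>lborel)"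
      using nn_integral_L2[OF u] by (simp add: nn_integral_add one)
    also have "\<dots> \<le> 1 + ennreal (\<epsilon> * D + max 0 C)" by (rule add_left_mono[OF singular])
    also have "\<dots> = ennreal (\<epsilon> * D + (1 + max 0 C))"
      using \<epsilon> \<open>D \<ge> 0\<close> by (simp add: ennreal_plus[symmetric] algebra_simps flip: ennreal_1 del: ennreal_plus)
    finally have "(\<integral>\<^sup>+x. ennreal (norm x powr (- p) * (norm (u x))\<^sup>2) \<partial>lborel) \<le> ennreal (\<epsilon> * D + (1 + max 0 C))" .
    then show "(\<integral>x. norm x powr (- p) * (norm (u x))\<^sup>2 \<partial>lborel) \<le> \<epsilon> * (\<integral>x. (norm (g x))\<^sup>2 \<partial>lborel) + (1 + max 0 C)"
      unfolding D_def[symmetric]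
      by (intro integral_real_bounded) (use \<epsilon> \<open>D \<ge> 0\<close> in auto)
  qed
qed

section \<open>Test functions as elements of the Sobolev space\<close>

lemma test_function_differentiable: "test_function \<phi> \<Longrightarrow> \<phi> differentiable (at x)"
  unfolding test_function_def by (metis C_k.simps(2))

lemma test_function_continuous: "test_function \<phi> \<Longrightarrow> continuous_on UNIV \<phi>"
  unfolding test_function_def by (metis C_k.simps(1))

lemma test_function_partial_continuous: "test_function \<phi> \<Longrightarrow> continuous_on UNIV (partial_deriv i \<phi>)"
  unfolding test_function_def by (metis C_k.simps)

lemma partial_deriv_eq:
  "(\<phi> has_derivative \<phi>') (at x) \<Longrightarrow> partial_deriv i \<phi> x = \<phi>' (axis i 1)"
  unfolding partial_deriv_def by (simp add: frechet_derivative_at[symmetric])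

lemma line_derivative:
  assumes "\<phi> differentiable (at x)"
  shows "((\<lambda>t. \<phi> (x + t *\<^sub>R axis i 1)) has_real_derivative partial_deriv i \<phi> x) (at 0)"
proof -
  have d: "(\<phi> has_derivative frechet_derivative \<phi> (at x)) (at x)"
    using assms by (simp add: frechet_derivative_works)
  have "((\<lambda>t. \<phi> (x + t *\<^sub>R axis i 1)) has_derivative (\<lambda>t. frechet_derivative \<phi> (at x) (t *\<^sub>R axis i 1))) (at 0)"
    by (rule has_derivative_compose[of "\<lambda>t. x + t *\<^sub>R axis i 1" _ 0 UNIV \<phi>])
       (use d in \<open>auto intro!: derivative_eq_intros\<close>)
  moreover have "frechet_derivative \<phi> (at x) (t *\<^sub>R axis i 1) = partial_deriv i \<phi> x * t" for t
    using linear_scale[OF has_derivative_linear[OF d]] by (simp add: partial_deriv_def)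
  ultimately show ?thesis by (simp add: has_field_derivative_def)
qed

lemma test_function_support:
  assumes \<phi>: "test_function \<phi>"
  obtains R B where "R > 0" "\<And>x. norm x > R \<Longrightarrow> \<phi> x = 0" "\<And>x i. norm x > R \<Longrightarrow> partial_deriv i \<phi> x = 0"
    "\<And>x. \<bar>\<phi> x\<bar> \<le> B" "\<And>x i. \<bar>partial_deriv i \<phi> x\<bar> \<le> B"
proof -
  have "bounded (closure {x. \<phi> x \<noteq> 0})" using \<phi> by (simp add: test_function_def compact_imp_bounded)
  then obtain R where R: "R > 0" "\<And>x. x \<in> closure {x. \<phi> x \<noteq> 0} \<Longrightarrow> norm x \<le> R"
    by (auto simp: bounded_pos)
  have z: "\<phi> x = 0" if "norm x > R" for x
    using R(2)[of x] that closure_subset[of "{x. \<phi> x \<noteq> 0}"] by force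
  have z': "partial_deriv i \<phi> x = 0" if x: "norm x > R" for x i
  proof -
    have "(\<phi> has_derivative (\<lambda>_. 0)) (at x)"
    proof (rule has_derivative_transform_within_open[where f="\<lambda>_. 0" and s="- cball 0 R"])
      show "0 = \<phi> y" if "y \<in> - cball 0 R" for y using z[of y] that by simp
    qed (use x in auto)
    then show ?thesis by (simp add: partial_deriv_eq)
  qed
  have "\<exists>B. \<forall>x. \<bar>f x\<bar> \<le> B" if "continuous_on UNIV f" "\<And>x. norm x > R \<Longrightarrow> f x = 0" for f :: "real^2 \<Rightarrow> real"
  proof -
    have "compact (f ` cball 0 R)"
      by (intro compact_continuous_image continuous_on_subset[OF that(1)]) auto
    then obtain B where "\<forall>y\<in>f ` cball 0 R. \<bar>y\<bar> \<le> B"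
      using compact_imp_bounded bounded_real by blast
    then have "\<bar>f x\<bar> \<le> B" if "norm x \<le> R" for x using that by simp
    then have "\<bar>f x\<bar> \<le> max B 0" for x
      using that(2)[of x] by (cases "norm x \<le> R") (auto simp: le_max_iff_disj)
    then show ?thesis by blast
  qed
  note ex = this
  obtain B0 where B0: "\<And>x. \<bar>\<phi> x\<bar> \<le> B0" using ex[OF test_function_continuous[OF \<phi>] z] by blast
  have "\<forall>i. \<exists>B. \<forall>x. \<bar>partial_deriv i \<phi> x\<bar> \<le> B"
    using ex[OF test_function_partial_continuous[OF \<phi>] z'] by blast
  then obtain B1 where B1: "\<And>i x. \<bar>partial_deriv i \<phi> x\<bar> \<le> B1 i" by metis
  define B where "B = max B0 (Max (range B1))"
  have "\<bar>\<phi> x\<bar> \<le> B" for x using B0[of x] by (simp add: B_def)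
  moreover have "\<bar>partial_deriv i \<phi> x\<bar> \<le> B" for i x
  proof -
    have "B1 i \<le> Max (range B1)" by (rule Max_ge) auto
    then show ?thesis
      unfolding B_def using B1[of i x] by (meson le_max_iff_disj order_trans)
  qed
  ultimately show thesis using that R(1) z z' by blast
qed

text \<open>The integral of a difference quotient vanishes by translation invariance; let the step tend to zero.\<close>

lemma integral_line_derivative_zero:
  fixes F F' :: "real^2 \<Rightarrow> real"
  assumes [measurable]: "F \<in> borel_measurable borel" "F' \<in> borel_measurable borel"
    and deriv: "\<And>x. ((\<lambda>t. F (x + t *\<^sub>R axis i 1)) has_real_derivative F' x) (at 0)"
    and K: "\<And>x. \<bar>F' x\<bar> \<le> K" and B: "\<And>x. \<bar>F x\<bar> \<le> B" and R: "\<And>x. norm x > R \<Longrightarrow> F x = 0"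
  shows "(\<integral>x. F' x \<partial>lborel) = 0"
proof -
  define e :: "real^2" where "e = axis i 1"
  have e: "norm e = 1" by (simp add: e_def)
  define h where "h n = 1 / real (Suc n)" for n
  have h: "h n > 0" "h n \<le> 1" for n by (simp_all add: h_def)
  have h0: "h \<longlonglongrightarrow> 0" unfolding h_def by (rule LIMSEQ_Suc[OF lim_1_over_n])
  have "K \<ge> 0" using K[of 0] by linarith
  have "B \<ge> 0" using B[of 0] by linarith
  note deriv_line = derivative_along_line[OF deriv, folded e_def]
  have iF: "integrable lborel F" by (rule integrable_bounded_support[OF _ B R]) measurable
  have "(\<lambda>n. \<integral>x. (F (x + h n *\<^sub>R e) - F x) / h n \<partial>lborel) \<longlonglongrightarrow> (\<integral>x. F' x \<partial>lborel)"
  proof (rule integral_dominated_convergence[where w="\<lambda>x. K * indicator (cball 0 (R + 1)) x"])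
    show "integrable lborel (\<lambda>x::real^2. K * indicator (cball 0 (R + 1)) x)"
      by (intro integrable_mult_right integrable_real_indicator)
         (auto simp: emeasure_lborel_cball_finite[unfolded infinity_ennreal_def])
    show "AE x in lborel. (\<lambda>n. (F (x + h n *\<^sub>R e) - F x) / h n) \<longlonglongrightarrow> F' x"
    proof (rule AE_I2)
      fix x
      have "((\<lambda>t. (F (x + t *\<^sub>R e) - F x) / t) \<longlongrightarrow> F' x) (at 0)"
        using deriv_line[of x 0] by (simp add: has_field_derivative_iff)
      moreover have "filterlim h (at 0) sequentially"
        using h0 h by (auto simp: filterlim_at intro!: always_eventually) (metis less_irrefl)
      ultimately show "(\<lambda>n. (F (x + h n *\<^sub>R e) - F x) / h n) \<longlonglongrightarrow> F' x"
        by (rule filterlim_compose)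
    qed
    have "\<bar>(F (x + h n *\<^sub>R e) - F x) / h n\<bar> \<le> K * indicator (cball 0 (R + 1)) x" for n x
    proof (cases "norm x > R + 1")
      case True
      have "norm x \<le> norm (x + h n *\<^sub>R e) + norm (h n *\<^sub>R e)"
        using norm_triangle_ineq4[of "x + h n *\<^sub>R e" "h n *\<^sub>R e"] by simp
      then have "norm (x + h n *\<^sub>R e) > R" using True h[of n] e by simp
      then show ?thesis using True R by simp
    next
      case False
      obtain z where "F (x + h n *\<^sub>R e) - F (x + 0 *\<^sub>R e) = (h n - 0) * F' (x + z *\<^sub>R e)"
        using MVT2[of 0 "h n" "\<lambda>t. F (x + t *\<^sub>R e)" "\<lambda>t. F' (x + t *\<^sub>R e)"] deriv_line h[of n] by auto
      then have "(F (x + h n *\<^sub>R e) - F x) / h n = F' (x + z *\<^sub>R e)" using h[of n] by simp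
      then show ?thesis using K False by simp
    qed
    then show "AE x in lborel. norm ((F (x + h n *\<^sub>R e) - F x) / h n) \<le> K * indicator (cball 0 (R + 1)) x" for n
      by (intro AE_I2) simp
  qed measurable
  moreover have "(\<integral>x. (F (x + h n *\<^sub>R e) - F x) / h n \<partial>lborel) = 0" for n
    using iF integrable_translate[OF iF, of "h n *\<^sub>R e"] integral_translate[of F "h n *\<^sub>R e"] by simp
  ultimately show ?thesis by (simp only: LIMSEQ_const_iff)
qed

lemma test_function_measurable:
  assumes "test_function \<phi>"
  shows "\<phi> \<in> borel_measurable borel" "partial_deriv i \<phi> \<in> borel_measurable borel"
  using assms by (auto intro!: borel_measurable_continuous_onI test_function_continuous
      test_function_partial_continuous)

lemma test_function_integration_by_parts:
  assumes \<zeta>: "test_function \<zeta>" and \<phi>: "test_function \<phi>"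
  shows "(\<integral>x. partial_deriv i \<zeta> x * \<phi> x \<partial>lborel) = - (\<integral>x. \<zeta> x * partial_deriv i \<phi> x \<partial>lborel)"
proof -
  note [measurable] = test_function_measurable[OF \<zeta>] test_function_measurable[OF \<phi>]
  obtain R B where \<zeta>B: "R > 0" "\<And>x. norm x > R \<Longrightarrow> \<zeta> x = 0" "\<And>x i. norm x > R \<Longrightarrow> partial_deriv i \<zeta> x = 0"
    "\<And>x. \<bar>\<zeta> x\<bar> \<le> B" "\<And>x i. \<bar>partial_deriv i \<zeta> x\<bar> \<le> B"
    using test_function_support[OF \<zeta>] by metis
  obtain R' B' where \<phi>B: "R' > 0" "\<And>x. norm x > R' \<Longrightarrow> \<phi> x = 0" "\<And>x i. norm x > R' \<Longrightarrow> partial_deriv i \<phi> x = 0"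
    "\<And>x. \<bar>\<phi> x\<bar> \<le> B'" "\<And>x i. \<bar>partial_deriv i \<phi> x\<bar> \<le> B'"
    using test_function_support[OF \<phi>] by metis
  have B0: "0 \<le> B" "0 \<le> B'" using \<zeta>B(4)[of 0] \<phi>B(4)[of 0] by linarith+
  have i: "integrable lborel (\<lambda>x. v x * w x)"
    if [measurable]: "v \<in> borel_measurable borel" "w \<in> borel_measurable borel"
      and v: "\<And>x. \<bar>v x\<bar> \<le> B" "\<And>x. norm x > R \<Longrightarrow> v x = 0" and w: "\<And>x. \<bar>w x\<bar> \<le> B'" for v w :: "real^2 \<Rightarrow> real"
  proof (rule integrable_bounded_support[of _ "B * B'" R])
    show "\<bar>v x * w x\<bar> \<le> B * B'" for x
      using v(1)[of x] w[of x] B0 by (simp add: abs_mult mult_mono)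
    show "norm x > R \<Longrightarrow> v x * w x = 0" for x using v(2) by simp
  qed measurable
  have "(\<integral>x. partial_deriv i \<zeta> x * \<phi> x + \<zeta> x * partial_deriv i \<phi> x \<partial>lborel) = 0"
  proof (rule integral_line_derivative_zero[where F="\<lambda>x. \<zeta> x * \<phi> x" and K="B * B' + B * B'" and B="B * B'" and R=R])
    show "((\<lambda>t. \<zeta> (x + t *\<^sub>R axis i 1) * \<phi> (x + t *\<^sub>R axis i 1)) has_real_derivative
        partial_deriv i \<zeta> x * \<phi> x + \<zeta> x * partial_deriv i \<phi> x) (at 0)" for x
      using DERIV_mult[OF line_derivative[OF test_function_differentiable[OF \<zeta>]]
          line_derivative[OF test_function_differentiable[OF \<phi>]], of x i x i]
      by (simp add: mult.commute)
    show "\<bar>partial_deriv i \<zeta> x * \<phi> x + \<zeta> x * partial_deriv i \<phi> x\<bar> \<le> B * B' + B * B'" for x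
      using \<zeta>B(4,5) \<phi>B(4,5) B0
      by (intro order_trans[OF abs_triangle_ineq] add_mono) (auto simp: abs_mult intro!: mult_mono)
    show "\<bar>\<zeta> x * \<phi> x\<bar> \<le> B * B'" for x
      using \<zeta>B(4) \<phi>B(4) B0 by (auto simp: abs_mult intro!: mult_mono)
    show "norm x > R \<Longrightarrow> \<zeta> x * \<phi> x = 0" for x using \<zeta>B(2) by simp
  qed measurable
  moreover have "integrable lborel (\<lambda>x. partial_deriv i \<zeta> x * \<phi> x)"
    by (rule i) (use \<zeta>B \<phi>B in auto)
  moreover have "integrable lborel (\<lambda>x. \<zeta> x * partial_deriv i \<phi> x)"
    by (rule i) (use \<zeta>B \<phi>B in auto)
  ultimately show ?thesis by simp
qed

text \<open>The classical gradient is a weak gradient, by \<open>test_function_integration_by_parts\<close>. Normalised test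
  functions then show that the unit sphere of \<open>H1\<close> is nonempty.\<close>

lemma test_function_H1:
  assumes \<phi>: "test_function \<phi>"
  shows "(\<lambda>x. of_real (\<phi> x)) \<in> H1"
proof -
  note [measurable] = test_function_measurable[OF \<phi>]
  obtain R B where \<phi>B: "R > 0" "\<And>x. norm x > R \<Longrightarrow> \<phi> x = 0" "\<And>x i. norm x > R \<Longrightarrow> partial_deriv i \<phi> x = 0"
    "\<And>x. \<bar>\<phi> x\<bar> \<le> B" "\<And>x i. \<bar>partial_deriv i \<phi> x\<bar> \<le> B"
    using test_function_support[OF \<phi>] by metis
  have "0 \<le> B" using \<phi>B(4)[of 0] by linarith
  have sq: "integrable lborel (\<lambda>x. (w x)\<^sup>2)"
    if [measurable]: "w \<in> borel_measurable borel"
      and w: "\<And>x. \<bar>w x\<bar> \<le> B" "\<And>x. norm x > R \<Longrightarrow> w x = 0" for w :: "real^2 \<Rightarrow> real"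
  proof (rule integrable_bounded_support[of _ "B\<^sup>2" R])
    show "\<bar>(w x)\<^sup>2\<bar> \<le> B\<^sup>2" for x
      using w(1)[of x] \<open>0 \<le> B\<close> by (simp add: abs_le_square_iff[symmetric])
    show "norm x > R \<Longrightarrow> (w x)\<^sup>2 = 0" for x using w(2) by simp
  qed measurable
  define g :: "real^2 \<Rightarrow> complex^2" where "g x = (\<chi> i. of_real (partial_deriv i \<phi> x))" for x
  have "continuous_on UNIV g"
    unfolding g_def[abs_def]
    by (intro continuous_intros test_function_partial_continuous \<phi>)
  then have [measurable]: "g \<in> borel_measurable borel" by (rule borel_measurable_continuous_onI)
  have norm_g: "(norm (g x))\<^sup>2 = (partial_deriv 1 \<phi> x)\<^sup>2 + (partial_deriv 2 \<phi> x)\<^sup>2" for x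
    by (simp add: g_def norm_vec_def L2_set_def sum_2)
  have "integrable lborel (\<lambda>x. (norm (g x))\<^sup>2)"
    unfolding norm_g by (intro Bochner_Integration.integrable_add sq) (use \<phi>B in auto)
  then have "g \<in> L2" by (simp add: L2_def)
  moreover have "(\<lambda>x. complex_of_real (\<phi> x)) \<in> L2"
    using sq[of \<phi>] \<phi>B by (simp add: L2_def)
  moreover have "is_weak_gradient (\<lambda>x. of_real (\<phi> x)) g"
    unfolding is_weak_gradient_def
  proof (intro allI impI)
    fix \<zeta> i assume \<zeta>: "test_function \<zeta>"
    have "(\<integral>x. partial_deriv i \<zeta> x *\<^sub>R complex_of_real (\<phi> x) \<partial>lborel) =
        of_real (\<integral>x. partial_deriv i \<zeta> x * \<phi> x \<partial>lborel)"
      by (simp add: scaleR_conv_of_real flip: of_real_mult)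
    also have "\<dots> = - of_real (\<integral>x. \<zeta> x * partial_deriv i \<phi> x \<partial>lborel)"
      by (simp add: test_function_integration_by_parts[OF \<zeta> \<phi>])
    also have "\<dots> = - (\<integral>x. \<zeta> x *\<^sub>R (g x $ i) \<partial>lborel)"
      by (simp add: g_def scaleR_conv_of_real flip: of_real_mult)
    finally show "(\<integral>x. partial_deriv i \<zeta> x *\<^sub>R complex_of_real (\<phi> x) \<partial>lborel) =
        - (\<integral>x. \<zeta> x *\<^sub>R (g x $ i) \<partial>lborel)" .
  qed
  ultimately show ?thesis by (auto simp: H1_def)
qed

lemma partial_deriv_dilate:
  assumes "\<And>x. \<phi> differentiable (at x)"
  shows "partial_deriv i (\<lambda>x. d * \<phi> (c *\<^sub>R x)) = (\<lambda>x. (d * c) * partial_deriv i \<phi> (c *\<^sub>R x))"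
    and "(\<lambda>x. d * \<phi> (c *\<^sub>R x)) differentiable (at x)"
proof -
  have D: "((\<lambda>x. d * \<phi> (c *\<^sub>R x)) has_derivative (\<lambda>y. d * frechet_derivative \<phi> (at (c *\<^sub>R x)) (c *\<^sub>R y))) (at x)" for x
  proof (rule has_derivative_mult_right)
    show "((\<lambda>x. \<phi> (c *\<^sub>R x)) has_derivative (\<lambda>y. frechet_derivative \<phi> (at (c *\<^sub>R x)) (c *\<^sub>R y))) (at x)"
    proof (rule has_derivative_compose[of "\<lambda>x. c *\<^sub>R x" _ x UNIV \<phi>])
      show "((*\<^sub>R) c has_derivative (*\<^sub>R) c) (at x)"
        by (rule bounded_linear_imp_has_derivative[OF bounded_linear_scaleR_right])
      show "(\<phi> has_derivative frechet_derivative \<phi> (at (c *\<^sub>R x))) (at (c *\<^sub>R x))"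
        by (rule iffD1[OF frechet_derivative_works assms])
    qed
  qed
  then show "(\<lambda>x. d * \<phi> (c *\<^sub>R x)) differentiable (at x)" unfolding differentiable_def by blast
  show "partial_deriv i (\<lambda>x. d * \<phi> (c *\<^sub>R x)) = (\<lambda>x. (d * c) * partial_deriv i \<phi> (c *\<^sub>R x))"
  proof
    fix x
    have "linear (frechet_derivative \<phi> (at (c *\<^sub>R x)))" using assms by (rule linear_frechet_derivative)
    then show "partial_deriv i (\<lambda>x. d * \<phi> (c *\<^sub>R x)) x = (d * c) * partial_deriv i \<phi> (c *\<^sub>R x)"
      unfolding partial_deriv_eq[OF D] by (simp add: partial_deriv_def linear_scale)
  qed
qed

lemma C_k_dilate: "C_k k \<phi> \<Longrightarrow> C_k k (\<lambda>x. d * \<phi> (c *\<^sub>R x))"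
proof (induction k arbitrary: \<phi> d)
  case 0
  have "continuous_on UNIV (\<lambda>x. \<phi> (c *\<^sub>R x))"
  proof (rule continuous_on_compose2[of UNIV \<phi>])
    show "continuous_on UNIV \<phi>" using 0 by simp
    show "continuous_on UNIV (\<lambda>x :: real^2. c *\<^sub>R x)" by (intro continuous_intros)
  qed simp
  then show ?case unfolding C_k.simps by (intro continuous_intros)
next
  case (Suc k)
  then have "\<And>x. \<phi> differentiable (at x)" by simp
  from partial_deriv_dilate[OF this] show ?case using Suc by simp
qed

lemma test_function_dilate:
  assumes \<phi>: "test_function \<phi>" and c: "c > 0"
  shows "test_function (\<lambda>x. d * \<phi> (c *\<^sub>R x))"
proof -
  obtain R where R: "\<And>x. norm x > R \<Longrightarrow> \<phi> x = 0" using test_function_support[OF \<phi>] by metis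
  have "norm x \<le> R / c" if "\<phi> (c *\<^sub>R x) \<noteq> 0" for x
  proof -
    have "\<not> R < norm (c *\<^sub>R x)" using R[of "c *\<^sub>R x"] that by blast
    then show ?thesis using c by (simp add: field_simps)
  qed
  then have "bounded {x. d * \<phi> (c *\<^sub>R x) \<noteq> 0}" unfolding bounded_iff by auto
  then show ?thesis using \<phi> C_k_dilate by (auto simp: test_function_def)
qed

section \<open>The unit sphere of the Sobolev space\<close>

definition H1_sphere :: "(real^2 \<Rightarrow> complex) set" where
  "H1_sphere = {u \<in> H1. L2_norm u = 1}"

lemma H1_weak_gradient:
  assumes "u \<in> H1"
  shows "u \<in> L2" "weak_gradient u \<in> L2" "is_weak_gradient u (weak_gradient u)"
proof -
  show "u \<in> L2" using assms by (simp add: H1_def)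
  have "\<exists>g. g \<in> L2 \<and> is_weak_gradient u g" using assms by (auto simp: H1_def)
  from someI_ex[OF this] show "weak_gradient u \<in> L2" "is_weak_gradient u (weak_gradient u)"
    by (simp_all add: weak_gradient_def)
qed

lemma H1_sphere_iff: "u \<in> H1_sphere \<longleftrightarrow> u \<in> H1 \<and> (\<integral>x. (norm (u x))\<^sup>2 \<partial>lborel) = 1"
  by (auto simp: H1_sphere_def L2_norm_def)

lemma dirichlet_integral_eq:
  assumes "u \<in> L2" "g \<in> L2" "is_weak_gradient u g"
  shows "dirichlet_integral u = (\<integral>x. (norm (g x))\<^sup>2 \<partial>lborel)"
proof -
  have "u \<in> H1" using assms by (auto simp: H1_def)
  note w = H1_weak_gradient[OF this]
  have [measurable]: "g \<in> borel_measurable borel" "weak_gradient u \<in> borel_measurable borel"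
    using assms w by (auto intro: L2_measurable)
  show ?thesis
    unfolding dirichlet_integral_def
    by (rule integral_cong_AE)
       (use weak_gradient_unique[OF w(2) assms(2) w(3) assms(3)] in \<open>auto\<close>)
qed

text \<open>If \<open>g\<close> is a weak gradient of \<open>u\<close>, then \<open>t\<^sup>2 g(t x)\<close> is one of \<open>t u(t x)\<close>, by testing with \<open>\<phi> (x / t)\<close>; by
  uniqueness it may be used to evaluate the Dirichlet integral. Areas scale with \<open>t\<^sup>-\<^sup>2\<close>.\<close>

lemma H1_sphere_dilate:
  assumes u: "u \<in> H1_sphere" and t: "t > 0"
  shows "(\<lambda>x. t *\<^sub>R u (t *\<^sub>R x)) \<in> H1_sphere"
    and "dirichlet_integral (\<lambda>x. t *\<^sub>R u (t *\<^sub>R x)) = t\<^sup>2 * dirichlet_integral u"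
    and "(\<integral>x. (norm (t *\<^sub>R u (t *\<^sub>R x))) ^ 4 \<partial>lborel) = t\<^sup>2 * (\<integral>x. (norm (u x)) ^ 4 \<partial>lborel)"
proof -
  have "u \<in> H1" and one: "(\<integral>x. (norm (u x))\<^sup>2 \<partial>lborel) = 1" using u by (auto simp: H1_sphere_iff)
  define g where "g = weak_gradient u"
  have uL: "u \<in> L2" and gL: "g \<in> L2" and wg: "is_weak_gradient u g"
    using H1_weak_gradient[OF \<open>u \<in> H1\<close>] by (auto simp: g_def)
  have [measurable]: "u \<in> borel_measurable borel" "g \<in> borel_measurable borel"
    using uL gL by (auto intro: L2_measurable)
  define v where "v x = t *\<^sub>R u (t *\<^sub>R x)" for x
  define G where "G x = t\<^sup>2 *\<^sub>R g (t *\<^sub>R x)" for x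
  have v2: "(norm (v x))\<^sup>2 = t\<^sup>2 * (norm (u (t *\<^sub>R x)))\<^sup>2" for x
    by (simp add: v_def power_mult_distrib)
  have G2: "(norm (G x))\<^sup>2 = t ^ 4 * (norm (g (t *\<^sub>R x)))\<^sup>2" for x
    by (simp add: G_def power_mult_distrib flip: power_mult)
  have vL: "v \<in> L2"
  proof -
    have "v \<in> borel_measurable borel" unfolding v_def[abs_def] by measurable
    moreover have "integrable lborel (\<lambda>x. (norm (v x))\<^sup>2)"
      unfolding v2 using uL t by (intro integrable_mult_right integrable_dilate) (auto simp: L2_def)
    ultimately show ?thesis by (simp add: L2_def)
  qed
  have GL: "G \<in> L2"
  proof -
    have "G \<in> borel_measurable borel" unfolding G_def[abs_def] by measurable
    moreover have "integrable lborel (\<lambda>x. (norm (G x))\<^sup>2)"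
      unfolding G2 using gL t by (intro integrable_mult_right integrable_dilate) (auto simp: L2_def)
    ultimately show ?thesis by (simp add: L2_def)
  qed
  have wG: "is_weak_gradient v G"
    unfolding is_weak_gradient_def
  proof (intro allI impI)
    fix \<phi> i assume \<phi>: "test_function \<phi>"
    note [measurable] = test_function_measurable[OF \<phi>]
    define \<zeta> where "\<zeta> = (\<lambda>x. 1 * \<phi> ((1 / t) *\<^sub>R x))"
    have \<zeta>: "test_function \<zeta>" unfolding \<zeta>_def by (rule test_function_dilate[OF \<phi>]) (use t in simp)
    have d\<zeta>: "partial_deriv i \<zeta> = (\<lambda>x. (1 * (1 / t)) * partial_deriv i \<phi> ((1 / t) *\<^sub>R x))"
      unfolding \<zeta>_def by (rule partial_deriv_dilate(1)[OF test_function_differentiable[OF \<phi>]])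
    note [measurable] = test_function_measurable[OF \<zeta>]
    have "(\<integral>x. partial_deriv i \<phi> x *\<^sub>R v x \<partial>lborel) =
        (\<integral>x. t\<^sup>2 *\<^sub>R (partial_deriv i \<zeta> (t *\<^sub>R x) *\<^sub>R u (t *\<^sub>R x)) \<partial>lborel)"
      unfolding d\<zeta> v_def using t by (simp add: power2_eq_square mult.commute)
    also have "\<dots> = t\<^sup>2 *\<^sub>R (\<integral>x. partial_deriv i \<zeta> (t *\<^sub>R x) *\<^sub>R u (t *\<^sub>R x) \<partial>lborel)"
      by (rule integral_scaleR_right)
    also have "(\<integral>x. partial_deriv i \<zeta> (t *\<^sub>R x) *\<^sub>R u (t *\<^sub>R x) \<partial>lborel) =
        (1 / t\<^sup>2) *\<^sub>R (\<integral>x. partial_deriv i \<zeta> x *\<^sub>R u x \<partial>lborel)"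
      by (rule integral_dilate[where f="\<lambda>x. partial_deriv i \<zeta> x *\<^sub>R u x"]) (use t in auto)
    also have "(\<integral>x. partial_deriv i \<zeta> x *\<^sub>R u x \<partial>lborel) = - (\<integral>x. \<zeta> x *\<^sub>R (g x $ i) \<partial>lborel)"
      by (rule wg[unfolded is_weak_gradient_def, rule_format, OF \<zeta>])
    also have "t\<^sup>2 *\<^sub>R (1 / t\<^sup>2) *\<^sub>R - (\<integral>x. \<zeta> x *\<^sub>R (g x $ i) \<partial>lborel) =
        - (t\<^sup>2 *\<^sub>R (1 / t\<^sup>2) *\<^sub>R (\<integral>x. \<zeta> x *\<^sub>R (g x $ i) \<partial>lborel))" by simp
    also have "(1 / t\<^sup>2) *\<^sub>R (\<integral>x. \<zeta> x *\<^sub>R (g x $ i) \<partial>lborel) = (\<integral>x. \<zeta> (t *\<^sub>R x) *\<^sub>R (g (t *\<^sub>R x) $ i) \<partial>lborel)"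
      by (rule integral_dilate[where f="\<lambda>x. \<zeta> x *\<^sub>R (g x $ i)", symmetric]) (use t in auto)
    also have "t\<^sup>2 *\<^sub>R (\<integral>x. \<zeta> (t *\<^sub>R x) *\<^sub>R (g (t *\<^sub>R x) $ i) \<partial>lborel) =
        (\<integral>x. t\<^sup>2 *\<^sub>R (\<zeta> (t *\<^sub>R x) *\<^sub>R (g (t *\<^sub>R x) $ i)) \<partial>lborel)"
      by (rule integral_scaleR_right[symmetric])
    also have "\<dots> = (\<integral>x. \<phi> x *\<^sub>R (G x $ i) \<partial>lborel)"
      unfolding \<zeta>_def G_def using t by (simp add: mult.commute)
    finally show "(\<integral>x. partial_deriv i \<phi> x *\<^sub>R v x \<partial>lborel) = - (\<integral>x. \<phi> x *\<^sub>R (G x $ i) \<partial>lborel)" .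
  qed
  have "(\<integral>x. (norm (v x))\<^sup>2 \<partial>lborel) = 1"
    unfolding v2 using integral_dilate[of "\<lambda>x. (norm (u x))\<^sup>2" t] t one by simp
  then have "v \<in> H1_sphere" using vL GL wG by (auto simp: H1_sphere_iff H1_def)
  then show "(\<lambda>x. t *\<^sub>R u (t *\<^sub>R x)) \<in> H1_sphere" by (simp add: v_def[abs_def])
  have "dirichlet_integral v = (\<integral>x. (norm (G x))\<^sup>2 \<partial>lborel)" by (rule dirichlet_integral_eq[OF vL GL wG])
  also have "\<dots> = t\<^sup>2 * (\<integral>x. (norm (g x))\<^sup>2 \<partial>lborel)"
    unfolding G2 using integral_dilate[of "\<lambda>x. (norm (g x))\<^sup>2" t] t
    by (simp add: power2_eq_square power4_eq_xxxx)
  finally show "dirichlet_integral (\<lambda>x. t *\<^sub>R u (t *\<^sub>R x)) = t\<^sup>2 * dirichlet_integral u"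
    by (simp add: v_def[abs_def] dirichlet_integral_eq[OF uL gL wg])
  have "(\<integral>x. (norm (t *\<^sub>R u (t *\<^sub>R x))) ^ 4 \<partial>lborel) = (\<integral>x. t ^ 4 * (norm (u (t *\<^sub>R x))) ^ 4 \<partial>lborel)"
    using t by (simp add: power_mult_distrib)
  also have "\<dots> = t\<^sup>2 * (\<integral>x. (norm (u x)) ^ 4 \<partial>lborel)"
    using integral_dilate[of "\<lambda>x. (norm (u x)) ^ 4" t] t by (simp add: power2_eq_square power4_eq_xxxx)
  finally show "(\<integral>x. (norm (t *\<^sub>R u (t *\<^sub>R x))) ^ 4 \<partial>lborel) = t\<^sup>2 * (\<integral>x. (norm (u x)) ^ 4 \<partial>lborel)" .
qed

lemma H1_sphere_nonempty: "H1_sphere \<noteq> {}"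
proof -
  define \<phi> where "\<phi> = tensor (\<lambda>_. interval_bump 0 1 0)"
  have \<phi>: "test_function \<phi>"
    unfolding \<phi>_def by (intro test_function_tensor bump_function_interval_bump)
  note [measurable] = test_function_measurable[OF \<phi>]
  have L2: "(\<lambda>x. complex_of_real (\<phi> x)) \<in> L2" using H1_weak_gradient(1)[OF test_function_H1[OF \<phi>]] .
  then have int: "integrable lborel (\<lambda>x. (\<phi> x)\<^sup>2)" by (simp add: L2_def)
  define A where "A = (\<integral>x. (\<phi> x)\<^sup>2 \<partial>lborel)"
  have "A \<noteq> 0"
  proof
    assume "A = 0"
    then have "AE x in lborel. (\<phi> x)\<^sup>2 = 0"
      using integral_nonneg_eq_0_iff_AE[OF int] by (simp add: A_def)
    moreover have "\<phi> x \<noteq> 0" if "x \<in> box 0 1" for x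
      using that by (simp add: \<phi>_def tensor_def interval_bump_inside mem_box_cart)
    ultimately have "AE x in lborel. x \<notin> box 0 (1 :: real^2)" by (auto elim!: eventually_mono)
    then have "emeasure lborel (box 0 (1 :: real^2)) = 0"
      by (subst (asm) AE_iff_measurable[of "box 0 1"]) auto
    moreover have "emeasure lborel (box 0 (1 :: real^2)) = ennreal (\<Prod>b\<in>Basis. ((1 :: real^2) - 0) \<bullet> b)"
      by (rule emeasure_lborel_box) (auto simp: Basis_vec_def inner_axis)
    moreover have "(\<Prod>b\<in>Basis. ((1 :: real^2) - 0) \<bullet> b) = 1"
      by (intro prod.neutral) (auto simp: Basis_vec_def inner_axis)
    ultimately show False by simp
  qed
  moreover have "A \<ge> 0" by (simp add: A_def)
  ultimately have A: "A > 0" by simp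
  define \<psi> where "\<psi> = (\<lambda>x. (1 / sqrt A) * \<phi> (1 *\<^sub>R x))"
  have \<psi>: "test_function \<psi>" unfolding \<psi>_def by (rule test_function_dilate[OF \<phi>]) simp
  have "(\<integral>x. (norm (complex_of_real (\<psi> x)))\<^sup>2 \<partial>lborel) = (\<integral>x. 1 / A * (\<phi> x)\<^sup>2 \<partial>lborel)"
    unfolding norm_of_real using A by (simp add: \<psi>_def power_divide)
  also have "\<dots> = 1" using A by (simp add: A_def)
  finally have "(\<lambda>x. complex_of_real (\<psi> x)) \<in> H1_sphere"
    using test_function_H1[OF \<psi>] by (simp add: H1_sphere_iff)
  then show ?thesis by blast
qed

lemma H1_sphere_quartic:
  assumes "u \<in> H1_sphere"
  shows "0 < (\<integral>x. (norm (u x)) ^ 4 \<partial>lborel)"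
    and "(\<integral>x. (norm (u x)) ^ 4 \<partial>lborel) \<le> 16 * dirichlet_integral u"
proof -
  have "u \<in> H1" and one: "(\<integral>x. (norm (u x))\<^sup>2 \<partial>lborel) = 1" using assms by (auto simp: H1_sphere_iff)
  note w = H1_weak_gradient[OF \<open>u \<in> H1\<close>]
  show "(\<integral>x. (norm (u x)) ^ 4 \<partial>lborel) \<le> 16 * dirichlet_integral u"
    using gagliardo_nirenberg[OF w one] by (simp add: dirichlet_integral_def)
  have "(\<integral>x. (norm (u x)) ^ 4 \<partial>lborel) \<noteq> 0"
  proof
    assume "(\<integral>x. (norm (u x)) ^ 4 \<partial>lborel) = 0"
    then have "AE x in lborel. (norm (u x)) ^ 4 = 0"
      using integral_nonneg_eq_0_iff_AE[OF quartic_bound(1)[OF w, of 1]] by simp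
    then have "AE x in lborel. (norm (u x))\<^sup>2 = 0" by eventually_elim simp
    then have "(\<integral>x. (norm (u x))\<^sup>2 \<partial>lborel) = 0" by (rule integral_eq_zero_AE)
    then show False using one by simp
  qed
  moreover have "0 \<le> (\<integral>x. (norm (u x)) ^ 4 \<partial>lborel)" by simp
  ultimately show "0 < (\<integral>x. (norm (u x)) ^ 4 \<partial>lborel)" by linarith
qed

text \<open>The admissible constants \<open>c\<close> are exactly the lower bounds of the quotients \<open>2 D / Q\<close>. As \<open>Q > 0\<close> on the
  nonempty sphere, the greatest one exists and is the infimum of the quotients; by
  \<open>gagliardo_nirenberg\<close> it is at least \<open>1 / 8\<close>.\<close>

lemma gagliardo_nirenberg_const_props:
  shows "gagliardo_nirenberg_const > 0"
    and "\<And>u. u \<in> H1_sphere \<Longrightarrow>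
      gagliardo_nirenberg_const / 2 * (\<integral>x. (norm (u x)) ^ 4 \<partial>lborel) \<le> dirichlet_integral u"
    and "\<And>c. c > gagliardo_nirenberg_const \<Longrightarrow>
      \<exists>u\<in>H1_sphere. dirichlet_integral u < c / 2 * (\<integral>x. (norm (u x)) ^ 4 \<partial>lborel)"
proof -
  define Q where "Q u = (\<integral>x. (norm (u x)) ^ 4 \<partial>lborel)" for u :: "real^2 \<Rightarrow> complex"
  define X where "X = (\<lambda>u. 2 * dirichlet_integral u / Q u) ` H1_sphere"
  have Q: "0 < Q u" "Q u \<le> 16 * dirichlet_integral u" if "u \<in> H1_sphere" for u
    using H1_sphere_quartic[OF that] by (auto simp: Q_def)
  have lower: "1 / 8 \<le> x" if "x \<in> X" for x
    using that Q by (auto simp: X_def field_simps)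
  have "X \<noteq> {}" using H1_sphere_nonempty by (simp add: X_def)
  have bdd: "bdd_below X" unfolding bdd_below_def using lower by blast
  have adm: "c / 2 * Q u \<le> dirichlet_integral u \<longleftrightarrow> c \<le> 2 * dirichlet_integral u / Q u" if "u \<in> H1_sphere" for u c
    using Q(1)[OF that] by (simp add: field_simps)
  have const: "gagliardo_nirenberg_const = Inf X"
    unfolding gagliardo_nirenberg_const_def
  proof (rule Greatest_equality)
    show "\<forall>u\<in>H1. L2_norm u = 1 \<longrightarrow> Inf X / 2 * (\<integral>x. (norm (u x)) ^ 4 \<partial>lborel) \<le> dirichlet_integral u"
    proof (intro ballI impI)
      fix u assume "u \<in> H1" "L2_norm u = 1"
      then have u: "u \<in> H1_sphere" by (simp add: H1_sphere_def)
      have "Inf X \<le> 2 * dirichlet_integral u / Q u"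
        by (rule cInf_lower[OF _ bdd]) (use u in \<open>auto simp: X_def\<close>)
      then show "Inf X / 2 * (\<integral>x. (norm (u x)) ^ 4 \<partial>lborel) \<le> dirichlet_integral u"
        using adm[OF u] by (simp add: Q_def)
    qed
  next
    fix c assume c: "\<forall>u\<in>H1. L2_norm u = 1 \<longrightarrow> c / 2 * (\<integral>x. (norm (u x)) ^ 4 \<partial>lborel) \<le> dirichlet_integral u"
    show "c \<le> Inf X"
    proof (rule cInf_greatest[OF \<open>X \<noteq> {}\<close>])
      fix x assume "x \<in> X"
      then obtain u where u: "u \<in> H1_sphere" "x = 2 * dirichlet_integral u / Q u" by (auto simp: X_def)
      then show "c \<le> x" using c adm[OF u(1), of c] by (auto simp: H1_sphere_def Q_def)
    qed
  qed
  have "1 / 8 \<le> Inf X" by (rule cInf_greatest[OF \<open>X \<noteq> {}\<close> lower])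
  then show "gagliardo_nirenberg_const > 0" by (simp add: const)
  show "gagliardo_nirenberg_const / 2 * (\<integral>x. (norm (u x)) ^ 4 \<partial>lborel) \<le> dirichlet_integral u"
    if u: "u \<in> H1_sphere" for u
  proof -
    have "Inf X \<le> 2 * dirichlet_integral u / Q u"
      by (rule cInf_lower[OF _ bdd]) (use u in \<open>auto simp: X_def\<close>)
    then show ?thesis using adm[OF u] by (simp add: Q_def const)
  qed
  show "\<exists>u\<in>H1_sphere. dirichlet_integral u < c / 2 * (\<integral>x. (norm (u x)) ^ 4 \<partial>lborel)"
    if c: "c > gagliardo_nirenberg_const" for c
  proof -
    obtain x where "x \<in> X" "x < c"
      using c cInf_lessD[OF \<open>X \<noteq> {}\<close>, of c] by (auto simp: const)
    then obtain u where u: "u \<in> H1_sphere" "2 * dirichlet_integral u / Q u < c" by (auto simp: X_def)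
    then have "dirichlet_integral u < c / 2 * Q u" using adm[OF u(1), of c] by linarith
    then show ?thesis using u(1) by (auto simp: Q_def)
  qed
qed

section \<open>Bounds for the ground state energy\<close>

text \<open>Estimate \<open>Q\<close> by the optimal constant and \<open>P\<close> by \<open>hardy\<close>, then complete the square in \<open>D\<close>. The constant is
  uniform in \<open>b\<close>.\<close>

lemma energy_lower_bound:
  fixes a p \<epsilon> :: real
  assumes p: "0 < p" "p < 2" and a: "a > 0" and \<epsilon>: "\<epsilon> > 0"
  shows "\<exists>C. \<forall>b>0. \<forall>u\<in>H1_sphere.
    - (a / gagliardo_nirenberg_const - 1 + \<epsilon>)\<^sup>2 / (4 * b) - C \<le> kirchhoff_energy (\<lambda>x. - (norm x powr (- p))) a b u"
proof -
  obtain C where C: "\<And>u g. u \<in> L2 \<Longrightarrow> g \<in> L2 \<Longrightarrow> is_weak_gradient u g \<Longrightarrow> (\<integral>x. (norm (u x))\<^sup>2 \<partial>lborel) = 1 \<Longrightarrow>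
    (\<integral>x. norm x powr (- p) * (norm (u x))\<^sup>2 \<partial>lborel) \<le> \<epsilon> * (\<integral>x. (norm (g x))\<^sup>2 \<partial>lborel) + C"
    using hardy[OF p \<epsilon>] by blast
  show ?thesis
  proof (intro exI[of _ C] allI impI ballI)
    fix b :: real and u assume b: "b > 0" and u: "u \<in> H1_sphere"
    define r where "r = gagliardo_nirenberg_const"
    define D where "D = dirichlet_integral u"
    define Q where "Q = (\<integral>x. (norm (u x)) ^ 4 \<partial>lborel)"
    define P where "P = (\<integral>x. norm x powr (- p) * (norm (u x))\<^sup>2 \<partial>lborel)"
    define m where "m = a / r - 1 + \<epsilon>"
    have r: "r > 0" "r / 2 * Q \<le> D"
      using gagliardo_nirenberg_const_props(1,2) u by (auto simp: r_def Q_def D_def)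
    have "u \<in> H1" "(\<integral>x. (norm (u x))\<^sup>2 \<partial>lborel) = 1" using u by (auto simp: H1_sphere_iff)
    then have P: "P \<le> \<epsilon> * D + C"
      unfolding P_def D_def dirichlet_integral_def by (intro C H1_weak_gradient)
    have "a / r * (r / 2 * Q) \<le> a / r * D" using r a by (intro mult_left_mono) auto
    then have Q: "a / 2 * Q \<le> a / r * D" using r by simp
    have "kirchhoff_energy (\<lambda>x. - (norm x powr (- p))) a b u = D + b * D\<^sup>2 - P - a / 2 * Q"
      by (simp add: kirchhoff_energy_def D_def P_def Q_def)
    moreover have "b * D\<^sup>2 - m * D = b * (D - m / (2 * b))\<^sup>2 - m\<^sup>2 / (4 * b)"
      using b by (simp add: field_simps power2_eq_square)
    moreover have "b * (D - m / (2 * b))\<^sup>2 \<ge> 0" using b by simp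
    moreover have "m * D = a / r * D - D + \<epsilon> * D" by (simp add: m_def algebra_simps)
    ultimately have "- (m\<^sup>2 / (4 * b)) - C \<le> kirchhoff_energy (\<lambda>x. - (norm x powr (- p))) a b u"
      using P Q by linarith
    then show "- (a / gagliardo_nirenberg_const - 1 + \<epsilon>)\<^sup>2 / (4 * b) - C \<le> kirchhoff_energy (\<lambda>x. - (norm x powr (- p))) a b u"
      by (simp add: m_def r_def)
  qed
qed

text \<open>Dilate \<open>u\<close> so that its Dirichlet integral becomes \<open>k / (2 b)\<close>, the minimiser of \<open>b D\<^sup>2 - k D\<close>.\<close>

lemma energy_upper_bound:
  fixes a p b k :: real
  assumes u: "u \<in> H1_sphere" and b: "b > 0" and k: "k > 0"
    and Q: "(1 + k) * dirichlet_integral u \<le> a / 2 * (\<integral>x. (norm (u x)) ^ 4 \<partial>lborel)"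
  shows "\<exists>v\<in>H1_sphere. kirchhoff_energy (\<lambda>x. - (norm x powr (- p))) a b v \<le> - k\<^sup>2 / (4 * b)"
proof -
  define D where "D = dirichlet_integral u"
  define t where "t = sqrt (k / (2 * b) / D)"
  have D: "D > 0" using H1_sphere_quartic[OF u] by (simp add: D_def)
  have t: "t > 0" using D k b by (simp add: t_def)
  have t2: "t\<^sup>2 * D = k / (2 * b)" using D k b by (simp add: t_def)
  define v where "v = (\<lambda>x. t *\<^sub>R u (t *\<^sub>R x))"
  define q where "q = (\<integral>x. (norm (u x)) ^ 4 \<partial>lborel)"
  have v: "v \<in> H1_sphere" "dirichlet_integral v = t\<^sup>2 * D" "(\<integral>x. (norm (v x)) ^ 4 \<partial>lborel) = t\<^sup>2 * q"
    using H1_sphere_dilate[OF u t] by (auto simp: v_def D_def q_def)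
  define P where "P = (\<integral>x. norm x powr (- p) * (norm (v x))\<^sup>2 \<partial>lborel)"
  have "P \<ge> 0" by (simp add: P_def)
  have "t\<^sup>2 * ((1 + k) * D) \<le> t\<^sup>2 * (a / 2 * q)"
    using Q by (intro mult_left_mono) (auto simp: D_def q_def)
  then have "(1 + k) * (k / (2 * b)) \<le> a / 2 * (t\<^sup>2 * q)"
    unfolding t2[symmetric] by (simp add: mult_ac)
  moreover have "kirchhoff_energy (\<lambda>x. - (norm x powr (- p))) a b v =
      k / (2 * b) + b * (k / (2 * b))\<^sup>2 - P - a / 2 * (t\<^sup>2 * q)"
    by (simp add: kirchhoff_energy_def v t2 P_def)
  moreover have "k / (2 * b) + b * (k / (2 * b))\<^sup>2 - (1 + k) * (k / (2 * b)) = - k\<^sup>2 / (4 * b)"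
    using b by (simp add: field_simps power2_eq_square)
  ultimately have "kirchhoff_energy (\<lambda>x. - (norm x powr (- p))) a b v \<le> - k\<^sup>2 / (4 * b)"
    using \<open>P \<ge> 0\<close> by linarith
  then show ?thesis using v(1) by blast
qed

lemma ground_state_energy_eq:
  "ground_state_energy V a b = Inf (kirchhoff_energy V a b ` H1_sphere)"
  unfolding ground_state_energy_def H1_sphere_def by (rule arg_cong[of _ _ Inf]) auto

theorem theorem3:
  fixes a p :: real and V :: "real^2 \<Rightarrow> real"
  assumes "0 < p" and "p < 2"
    and "V = (\<lambda>x. - (norm x powr (- p)))"
    and "a > gagliardo_nirenberg_const"
  shows "((\<lambda>b. b * ground_state_energy V a b) \<longlongrightarrow>
           - (1 / 4) * (a / gagliardo_nirenberg_const - 1)\<^sup>2) (at_right 0)"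
proof -
  define r where "r = gagliardo_nirenberg_const"
  define k where "k = a / r - 1"
  have r: "r > 0" "a > r" using assms(4) gagliardo_nirenberg_const_props(1) by (auto simp: r_def)
  have k: "k > 0" using r by (simp add: k_def)
  have a: "a > 0" using r by simp
  have lower: "\<exists>C. \<forall>b>0. \<forall>u\<in>H1_sphere. - (k + \<epsilon>)\<^sup>2 / (4 * b) - C \<le> kirchhoff_energy V a b u" if "\<epsilon> > 0" for \<epsilon>
    using energy_lower_bound[OF assms(1,2) a that] by (simp add: assms(3) k_def r_def)
  have bdd: "bdd_below (kirchhoff_energy V a b ` H1_sphere)" if "b > 0" for b
    using lower[of 1] that unfolding bdd_below_def by auto
  have upper: "b * ground_state_energy V a b \<le> - (1 / 4) * k\<^sup>2" if b: "b > 0" for b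
  proof (rule ccontr)
    assume *: "\<not> b * ground_state_energy V a b \<le> - (1 / 4) * k\<^sup>2"
    \<comment> \<open>Otherwise some \<open>k' < k\<close> satisfies \<open>k'\<^sup>2 > - 4 b E(b)\<close>, and a function whose quotient \<open>2 D / Q\<close>
        is below \<open>a / (1 + k')\<close> gives, after dilation, an energy below the infimum.\<close>
    define y where "y = max 0 (- 4 * (b * ground_state_energy V a b))"
    have y: "0 \<le> y" "y < k\<^sup>2" using * k by (auto simp: y_def)
    define k' where "k' = sqrt ((y + k\<^sup>2) / 2)"
    have k'2: "k'\<^sup>2 = (y + k\<^sup>2) / 2" using y by (simp add: k'_def)
    have k': "0 < k'" using y k by (simp add: k'_def add_nonneg_pos)
    have "k'\<^sup>2 < k\<^sup>2" using k'2 y by simp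
    then have "k' < k" using k by (simp add: power2_less_imp_less)
    then have "r < a / (1 + k')" using r k' by (simp add: k_def field_simps)
    then obtain u where u: "u \<in> H1_sphere"
        "dirichlet_integral u < a / (1 + k') / 2 * (\<integral>x. (norm (u x)) ^ 4 \<partial>lborel)"
      using gagliardo_nirenberg_const_props(3)[of "a / (1 + k')"] by (auto simp only: r_def)
    have "(1 + k') * dirichlet_integral u \<le> a / 2 * (\<integral>x. (norm (u x)) ^ 4 \<partial>lborel)"
      using u(2) k' by (simp add: field_simps)
    then obtain v where v: "v \<in> H1_sphere" "kirchhoff_energy V a b v \<le> - k'\<^sup>2 / (4 * b)"
      using energy_upper_bound[OF u(1) b k'] unfolding assms(3) by blast
    have "ground_state_energy V a b \<le> kirchhoff_energy V a b v"
      unfolding ground_state_energy_eq by (rule cInf_lower[OF _ bdd[OF b]]) (use v in auto)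
    also note v(2)
    finally have "b * ground_state_energy V a b \<le> b * (- k'\<^sup>2 / (4 * b))"
      using b by (intro mult_left_mono) auto
    also have "\<dots> = - k'\<^sup>2 / 4" using b by simp
    finally have "4 * k'\<^sup>2 / 4 \<le> - 4 * (b * ground_state_energy V a b)" by simp
    then show False using k'2 y by (auto simp: y_def)
  qed
  have "((\<lambda>b. b * ground_state_energy V a b) \<longlongrightarrow> - (1 / 4) * k\<^sup>2) (at_right 0)"
  proof (rule order_tendstoI)
    fix c assume "- (1 / 4) * k\<^sup>2 < c"
    then have "b * ground_state_energy V a b < c" if "b > 0" for b using upper[OF that] by linarith
    then show "\<forall>\<^sub>F b in at_right 0. b * ground_state_energy V a b < c"
      by (intro eventually_mono[OF eventually_at_right_less]) auto
  next
    fix c assume c: "c < - (1 / 4) * k\<^sup>2"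
    define d where "d = - (1 / 4) * k\<^sup>2 - c"
    have d: "d > 0" using c by (simp add: d_def)
    define \<epsilon> where "\<epsilon> = min 1 (d / (2 * k + 1))"
    have \<epsilon>: "\<epsilon> > 0" "\<epsilon> \<le> 1" using d k by (auto simp: \<epsilon>_def)
    have "\<epsilon> * (2 * k + \<epsilon>) \<le> d / (2 * k + 1) * (2 * k + 1)"
      using \<epsilon> k d by (intro mult_mono) (auto simp: \<epsilon>_def)
    then have "\<epsilon> * (2 * k + \<epsilon>) \<le> d" using k by simp
    then have sq: "(k + \<epsilon>)\<^sup>2 \<le> k\<^sup>2 + d" by (simp add: power2_eq_square algebra_simps)
    obtain C where C: "\<And>b u. b > 0 \<Longrightarrow> u \<in> H1_sphere \<Longrightarrow> - (k + \<epsilon>)\<^sup>2 / (4 * b) - C \<le> kirchhoff_energy V a b u"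
      using lower[OF \<epsilon>(1)] by blast
    have "c < b * ground_state_energy V a b" if b: "0 < b" "b < d / (2 * (\<bar>C\<bar> + 1))" for b
    proof -
      have "- (k + \<epsilon>)\<^sup>2 / (4 * b) - C \<le> ground_state_energy V a b"
        unfolding ground_state_energy_eq
        by (rule cInf_greatest) (use H1_sphere_nonempty C b in auto)
      then have "b * (- (k + \<epsilon>)\<^sup>2 / (4 * b) - C) \<le> b * ground_state_energy V a b"
        using b by (intro mult_left_mono) auto
      moreover have "b * (- (k + \<epsilon>)\<^sup>2 / (4 * b) - C) = - ((k + \<epsilon>)\<^sup>2 / 4) - b * C"
        using b by (simp add: right_diff_distrib)
      ultimately have "- ((k + \<epsilon>)\<^sup>2 / 4) - b * C \<le> b * ground_state_energy V a b" by simp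
      moreover have "b * C \<le> b * (\<bar>C\<bar> + 1)" using b by (intro mult_left_mono) auto
      moreover have "b * (\<bar>C\<bar> + 1) < d / 2" using b by (simp add: field_simps)
      moreover have "(k + \<epsilon>)\<^sup>2 / 4 \<le> k\<^sup>2 / 4 + d / 4" using sq by simp
      moreover have "c = - (k\<^sup>2 / 4) - d" by (simp add: d_def)
      ultimately show ?thesis using d by linarith
    qed
    moreover have "d / (2 * (\<bar>C\<bar> + 1)) > 0" using d by simp
    ultimately show "\<forall>\<^sub>F b in at_right 0. c < b * ground_state_energy V a b"
      unfolding eventually_at_right_field by blast
  qed
  then show ?thesis by (simp add: k_def r_def)
qed

end
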